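(* Let $k\ge 2$ be an integer, let $\omega\in\mathbb{R}$ be irrational, and let $\lambda\in\mathbb{C}$ with $0<|\lambda|<1$. For $x\in\mathbb{R}/\mathbb{Z}$ let $\mu_x$ be the probability measure on the unit circle $\partial\mathbb{D}$ whose Verblunsky coefficients are $$\alpha_{x,n}=\lambda e^{2\pi i\,\omega n^k}\,e^{2\pi i x},\qquad n=0,1,2,\dots$$ Then for Lebesgue almost every $x$ the measure $\mu_x$ is pure point.
   Context: $\mathbb{D}=\{z\in\mathbb{C}:|z|<1\}$. Given a sequence $\alpha_n\in\mathbb{D}$, $n\ge 0$ (Verblunsky coefficients), define monic polynomials by $\Phi_0(z)=1$, $\Phi_{n+1}(z)=z\Phi_n(z)-\overline{\alpha_n}\,\Phi_n^*(z)$, where $\Phi_n^*(z)=z^n\overline{\Phi_n(\overline{z}^{-1})}$. By Verblunsky's theorem there is a unique probability measure $\mu$ on $\partial\mathbb{D}$ with respect to which the $\Phi_n$ are orthogonal; $\mu$ is called the measure with Verblunsky coefficients $(\alpha_n)$. The measures $\mu_x$ obtained by multiplying all Verblunsky coefficients by the constant $e^{2\pi i x}$ are called Aleksandrov measures. Pure point means that the measure is a countable sum of point masses. *)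

theory Defs
  imports "HOL-Probability.Probability" "HOL-Computational_Algebra.Polynomial"
begin

text \<open>
  The reversal \<open>p\<^sup>*(z) = z\<^sup>n * cnj (p (1 / cnj z))\<close> of a polynomial of degree at most \<open>n\<close>, given by
  its coefficients so that it is again a polynomial (in particular defined at \<open>z = 0\<close>).
\<close>

definition szego_reverse :: "nat \<Rightarrow> complex poly \<Rightarrow> complex poly" where
  "szego_reverse n p = (\<Sum>i\<le>n. monom (cnj (coeff p (n - i))) i)"

lemma poly_szego_reverse:
  assumes "degree p \<le> n" and "z \<noteq> 0"
  shows "poly (szego_reverse n p) z = z ^ n * cnj (poly p (inverse (cnj z)))"
proof -
  have "cnj (poly p (inverse (cnj z))) = (\<Sum>i\<le>n. cnj (coeff p i) * inverse z ^ i)"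
    unfolding poly_altdef using assms(1)
    by (auto simp: le_degree intro!: sum.mono_neutral_left)
  then have "z ^ n * cnj (poly p (inverse (cnj z))) = (\<Sum>i\<le>n. cnj (coeff p i) * z ^ (n - i))"
    using assms(2) by (auto simp: sum_distrib_left power_diff field_simps intro!: sum.cong)
  also have "\<dots> = (\<Sum>i\<le>n. cnj (coeff p (n - i)) * z ^ i)"
    by (rule sum.reindex_bij_witness[of _ "\<lambda>i. n - i" "\<lambda>i. n - i"]) auto
  finally show ?thesis
    by (simp add: szego_reverse_def poly_sum poly_monom)
qed

primrec Phi :: "(nat \<Rightarrow> complex) \<Rightarrow> nat \<Rightarrow> complex poly" where
  "Phi \<alpha> 0 = 1"
| "Phi \<alpha> (Suc n) = monom 1 1 * Phi \<alpha> n - smult (cnj (\<alpha> n)) (szego_reverse n (Phi \<alpha> n))"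

lemma degree_szego_reverse_le: "degree (szego_reverse n p) \<le> n"
  unfolding szego_reverse_def by (intro degree_sum_le) (auto intro: order_trans[OF degree_monom_le])

lemma Phi_monic: "degree (Phi \<alpha> n) = n \<and> lead_coeff (Phi \<alpha> n) = 1"
proof (induction n)
  case (Suc n)
  let ?q = "smult (cnj (\<alpha> n)) (szego_reverse n (Phi \<alpha> n))"
  have lc: "coeff (Phi \<alpha> n) n = 1" using Suc by metis
  have nz: "Phi \<alpha> n \<noteq> 0" using Suc by auto
  have q: "degree ?q \<le> n"
    using degree_szego_reverse_le[of n "Phi \<alpha> n"] degree_smult_le order_trans by blast
  have "degree (monom 1 1 * Phi \<alpha> n) = Suc n"
    using Suc nz by (simp add: degree_mult_eq degree_monom_eq)
  moreover have "coeff (monom 1 1 * Phi \<alpha> n) (Suc n) = 1"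
    using lc by (simp add: coeff_monom_mult)
  moreover have "coeff ?q (Suc n) = 0" using q by (intro coeff_eq_0) simp
  ultimately have c: "coeff (Phi \<alpha> (Suc n)) (Suc n) = 1" and d: "degree (Phi \<alpha> (Suc n)) \<le> Suc n"
    using q by (auto intro!: degree_diff_le)
  then have "degree (Phi \<alpha> (Suc n)) = Suc n" by (intro antisym le_degree) auto
  then show ?case using c by simp
qed simp

definition has_verblunsky_coeffs :: "complex measure \<Rightarrow> (nat \<Rightarrow> complex) \<Rightarrow> bool" where
  "has_verblunsky_coeffs M \<alpha> \<longleftrightarrow>
     (\<forall>n. \<alpha> n \<in> ball 0 1) \<and>
     prob_space M \<and> sets M = sets (restrict_space borel (sphere 0 1)) \<and>
     (\<forall>m n. m \<noteq> n \<longrightarrow> (LINT z|M. poly (Phi \<alpha> m) z * cnj (poly (Phi \<alpha> n) z)) = 0)"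

text \<open>A countable sum of point masses: \<open>M = (\<Sum>z\<in>C. w z * \<delta>\<^sub>z)\<close>, evaluated on measurable sets.\<close>

definition pure_point :: "'a measure \<Rightarrow> bool" where
  "pure_point M \<longleftrightarrow>
     (\<exists>C w. countable C \<and> C \<subseteq> space M \<and>
        (\<forall>A\<in>sets M. emeasure M A = (\<integral>\<^sup>+z. w z * indicator A z \<partial>count_space C)))"

end

theory Submission
  imports Defs "HOL-Complex_Analysis.Complex_Analysis" "HOL-Real_Asymp.Real_Asymp"
begin

text \<open>
  Write \<open>\<rho>\<^sup>2 = 1 - \<bar>l\<bar>\<^sup>2\<close> and let \<open>\<phi>\<^sub>n = \<Phi>\<^sub>n / \<rho> ^ n\<close> be the normalised orthogonal polynomials of \<open>\<mu> x\<close>. A point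
  \<open>z\<close> with \<open>(\<Sum>n. \<bar>\<phi>\<^sub>n z\<bar>\<^sup>2) < \<infinity>\<close> is an atom, so it suffices that for almost every \<open>x\<close> this sum is finite
  \<open>\<mu> x\<close>-almost everywhere. Averaged over \<open>x\<close>, the law of \<open>z\<close> is uniform, and conditionally on \<open>z\<close> the boundary
  phase has a Poisson kernel as its density; this is spectral averaging for the Bernstein--Szego approximants.

  Growth: taking \<open>k\<close> differences linearises the phase, and the Taylor coefficients of \<open>ln\<close> of the entry \<open>p\<^sub>N\<close> of
  the transfer matrix are sums of \<open>e(P j)\<close> with \<open>P\<close> of polynomial type. Weyl's inequality bounds them at \<open>N = q ^ 4\<close>
  for a denominator \<open>q\<close> of a good rational approximation to \<open>\<omega>\<close>. Hence \<open>ln \<bar>p\<^sub>N\<bar>\<close> is at most \<open>o(N)\<close> on the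
  circle; as its mean is \<open>0\<close>, it is close to \<open>0\<close>, and \<open>\<bar>p\<^sub>N\<bar> / \<rho> ^ N\<close> is exponentially large, off a set of measure
  \<open>O((ln q) powr (-1/6))\<close>. If \<open>\<omega>\<close> has no denominator in the required range, it is extremely well approximable
  there; the transfer matrices are then nearly periodic, and growth at the scale \<open>a\<close> carries over to \<open>a\<^sup>2\<close> at no cost
  in measure. In this way the matrices grow along a sequence of scales with \<open>a\<^sub>j\<^sup>2 \<le> a\<^sub>j\<^sub>+\<^sub>1 \<le> exp (c * a\<^sub>j)\<close>.

  Decay: a large matrix forces \<open>\<phi>\<^sub>a\<close> to be small unless the random direction falls into a resonance. The square
  root of the resonance strength is integrable with a universal bound, by two applications of the mean value
  property, so resonances are exponentially unlikely, and a union bound covers all times between two scales.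
\<close>

section \<open>Weyl sums\<close>

text \<open>The measures \<open>\<mu> x\<close> may be singular, so a Lebesgue-small set of points
  is harmless only after averaging over \<open>x\<close>, when the law of the point becomes exactly
  uniform. No Diophantine condition is imposed on \<open>\<omega>\<close>: Weyl's inequality works
  only near denominators of good approximations, whose gaps can be enormous, and this shapes the
  chain of scales. The upper bound on \<open>a\<^sub>j\<^sub>+\<^sub>1\<close> comes from the union
  bound, as each of the up to \<open>exp (c * a\<^sub>j)\<close> times in between has a resonance
  probability exponentially small in \<open>a\<^sub>j\<close>. The lower bound
  \<open>a\<^sub>j\<^sup>2\<close> doubles the logarithm, which makes the exceptional measures
  summable for any negative power of it. The power -1/6 arises from cutting Taylor series at order
  \<open>M\<close> about \<open>(ln q) powr (1/3)\<close>: the total weight of the phases, up to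
  \<open>2 ^ M\<^sup>2\<close>, then grows more slowly than any power of \<open>q\<close>, and
  working at radius \<open>1 - 1 / sqrt M\<close> costs a relative error \<open>1 / sqrt M\<close>.
  That square-summable points are atoms is Christoffel's inequality tested on polynomials peaking at
  the point.\<close>

abbreviation ec :: "real \<Rightarrow> complex" where "ec x \<equiv> cis (2 * pi * x)"

text \<open>A discrete stand-in for a polynomial of degree \<open>d\<close> with leading coefficient
  \<open>c / fact d\<close>. Only this number enters Weyl's inequality, so the lower coefficients
  are never tracked.\<close>

primrec const_diff :: "nat \<Rightarrow> real \<Rightarrow> (nat \<Rightarrow> real) \<Rightarrow> bool" where
  "const_diff 0 c P = (\<forall>j. P j = c)"
| "const_diff (Suc d) c P = const_diff d c (\<lambda>j. P (Suc j) - P j)"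

lemma const_diff_cong: "const_diff d c P \<Longrightarrow> c = c' \<Longrightarrow> (\<And>j. P j = P' j) \<Longrightarrow> const_diff d c' P'"
  by (metis ext)

lemma const_diff_add:
  "const_diff d c P \<Longrightarrow> const_diff d c' P' \<Longrightarrow> const_diff d (c + c') (\<lambda>j. P j + P' j)"
proof (induction d arbitrary: P P')
  case (Suc d)
  have "const_diff d (c + c') (\<lambda>j. (P (Suc j) - P j) + (P' (Suc j) - P' j))"
    using Suc by simp
  then show ?case by (auto elim!: const_diff_cong)
qed simp

lemma const_diff_cmult: "const_diff d c P \<Longrightarrow> const_diff d (a * c) (\<lambda>j. a * P j)"
proof (induction d arbitrary: P)
  case (Suc d)
  have "const_diff d (a * c) (\<lambda>j. a * (P (Suc j) - P j))" using Suc by simp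
  then show ?case by (auto elim!: const_diff_cong simp: algebra_simps)
qed simp

lemma const_diff_shift: "const_diff d c P \<Longrightarrow> const_diff d c (\<lambda>j. P (j + i))"
proof (induction d arbitrary: P)
  case (Suc d)
  have "const_diff d c (\<lambda>j. P (Suc j) - P j)" using Suc.prems by simp
  from Suc.IH[OF this] show ?case by simp
qed simp

lemma const_diff_sum:
  "finite A \<Longrightarrow> (\<And>i. i \<in> A \<Longrightarrow> const_diff d (c i) (P i)) \<Longrightarrow>
     const_diff d (\<Sum>i\<in>A. c i) (\<lambda>j. \<Sum>i\<in>A. P i j)"
proof (induction A rule: finite_induct)
  case empty
  have "const_diff d 0 (\<lambda>_. 0)" by (induction d) simp_all
  then show ?case by simp
next
  case (insert x F)
  then show ?case using const_diff_add[of d "c x" "P x" "\<Sum>i\<in>F. c i" "\<lambda>j. \<Sum>i\<in>F. P i j"] by simp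
qed

text \<open>Weyl differencing: the difference over \<open>h\<close> steps telescopes into
  \<open>h\<close> shifted first differences, so the order drops by one and \<open>c\<close> is
  multiplied by \<open>h\<close>.\<close>

lemma const_diff_step:
  assumes "const_diff (Suc d) c P"
  shows "const_diff d (real h * c) (\<lambda>j. P (j + h) - P j)"
proof -
  have "const_diff d (\<Sum>i<h. c) (\<lambda>j. \<Sum>i<h. P (Suc (j + i)) - P (j + i))"
    using assms by (intro const_diff_sum const_diff_shift) auto
  moreover have "(\<Sum>i<h. P (Suc (j + i)) - P (j + i)) = P (j + h) - P j" for j
    by (induction h) auto
  ultimately show ?thesis by simp
qed

text \<open>The lower powers are carried along because the first difference of the top power is a
  binomial combination of all of them; only the term \<open>r = d\<close> survives.\<close>

lemma const_diff_power_aux: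
  "(\<forall>i<d. const_diff d 0 (\<lambda>j. real j ^ i)) \<and> const_diff d (fact d) (\<lambda>j. real j ^ d)"
proof (induction d)
  case (Suc d)
  have *: "real (Suc j) ^ i - real j ^ i = (\<Sum>r<i. real (i choose r) * real j ^ r)" for i j
  proof -
    have "real (Suc j) ^ i = (real j + 1) ^ i" by (simp add: add.commute)
    also have "\<dots> = (\<Sum>r\<le>i. real (i choose r) * real j ^ r)" by (simp add: binomial_ring)
    also have "\<dots> = (\<Sum>r<i. real (i choose r) * real j ^ r) + real j ^ i"
      by (simp add: lessThan_Suc_atMost[symmetric])
    finally show ?thesis by simp
  qed
  have "const_diff d 0 (\<lambda>j. real (Suc j) ^ i - real j ^ i)" if "i < Suc d" for i
  proof -
    have "const_diff d (\<Sum>r<i. real (i choose r) * 0) (\<lambda>j. \<Sum>r<i. real (i choose r) * real j ^ r)"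
      using Suc that by (intro const_diff_sum const_diff_cmult) auto
    then show ?thesis by (simp only: * mult_zero_right sum.neutral_const)
  qed
  moreover have "const_diff d (fact (Suc d)) (\<lambda>j. real (Suc j) ^ Suc d - real j ^ Suc d)"
  proof -
    have "const_diff d (\<Sum>r<Suc d. real (Suc d choose r) * (if r = d then fact d else 0))
        (\<lambda>j. \<Sum>r<Suc d. real (Suc d choose r) * real j ^ r)"
      using Suc by (intro const_diff_sum const_diff_cmult) auto
    then show ?thesis unfolding * by (simp add: algebra_simps)
  qed
  ultimately show ?case by simp
qed simp

lemma const_diff_power: "const_diff d (fact d) (\<lambda>j. real j ^ d)"
  using const_diff_power_aux by blast

section \<open>Weyl's inequality\<close>

lemma sin_ge_half: assumes "0 \<le> x" "x \<le> pi / 2" shows "sin x \<ge> x / 2"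
proof -
  have p: "pi < 3.3" using pi_approx by simp
  have b: "\<bar>sin x - (\<Sum>m<3. sin_coeff m * x ^ m)\<bar> \<le> inverse (fact 3) * \<bar>x\<bar> ^ 3"
    by (rule Maclaurin_sin_bound)
  have c: "(\<Sum>m<3. sin_coeff m * x ^ m) = x" by (simp add: eval_nat_numeral sin_coeff_def)
  have d: "inverse (fact 3) * \<bar>x\<bar> ^ 3 = x ^ 3 / 6" using assms by (simp add: eval_nat_numeral)
  have "x * x\<^sup>2 \<le> x * 3" using assms p
  proof -
    have "x\<^sup>2 \<le> 1.65\<^sup>2" using assms p by (intro power_mono) auto
    also have "\<dots> \<le> 3" by (simp add: power2_eq_square)
    finally show ?thesis using assms by (intro mult_left_mono)
  qed
  then have "x ^ 3 / 6 \<le> x / 2" by (simp add: power3_eq_cube power2_eq_square)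
  then show ?thesis using b c d by linarith
qed

text \<open>With \<open>u\<close> the offset of \<open>c\<close> from the nearest integer,
  \<open>norm (1 - ec c) = 2 * \<bar>sin (pi * u)\<bar>\<close>, which \<open>sin_ge_half\<close>
  bounds below by \<open>pi * \<bar>u\<bar>\<close>.\<close>

lemma norm_one_minus_ec_ge:
  assumes "\<And>i::int. \<bar>c - of_int i\<bar> \<ge> \<delta>" "\<delta> > 0"
  shows "norm (1 - ec c) \<ge> 2 * \<delta>"
proof -
  define u where "u = c - of_int (round c)"
  have u: "\<bar>u\<bar> \<le> 1/2" unfolding u_def using of_int_round_abs_le[of c] by (simp add: abs_minus_commute)
  have ud: "\<bar>u\<bar> \<ge> \<delta>" using assms(1)[of "round c"] by (simp add: u_def)
  have "ec c = ec u * ec (of_int (round c))"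
    by (simp add: cis_mult u_def algebra_simps)
  also have "ec (of_int (round c)) = 1"
    by (metis cis_multiple_2pi Ints_of_int)
  finally have e: "ec c = ec u" by simp
  have "(norm (1 - ec u))\<^sup>2 = (1 - cos (2*(pi*u)))\<^sup>2 + (sin (2*(pi*u)))\<^sup>2"
    by (simp add: cmod_def algebra_simps)
  also have "\<dots> = 2 - 2 * cos (2 * (pi*u))"
    using sin_cos_squared_add[of "2*(pi*u)"] by (simp add: power2_eq_square algebra_simps)
  also have "\<dots> = (2 * sin (pi * u))\<^sup>2"
    by (simp add: cos_double_sin power_mult_distrib)
  finally have n: "norm (1 - ec u) = \<bar>2 * sin (pi * u)\<bar>"
    by (metis abs_norm_cancel power2_eq_iff_nonneg abs_ge_zero power2_abs)
  have "\<bar>sin (pi * u)\<bar> = sin (pi * \<bar>u\<bar>)"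
  proof (cases "u \<ge> 0")
    case True
    then have "sin (pi * u) \<ge> 0" using u by (intro sin_ge_zero) auto
    then show ?thesis using True by simp
  next
    case False
    have "pi * (- u) \<le> pi * 1" using u by (intro mult_left_mono) auto
    then have "sin (pi * (- u)) \<ge> 0" using False by (intro sin_ge_zero mult_nonneg_nonneg) auto
    then show ?thesis using False by simp
  qed
  also have "\<dots> \<ge> pi * \<bar>u\<bar> / 2"
    using u by (intro sin_ge_half) auto
  finally have "\<bar>sin (pi * u)\<bar> \<ge> pi * \<bar>u\<bar> / 2" .
  moreover have "pi * \<bar>u\<bar> \<ge> 2 * \<delta>"
    using pi_ge_two ud assms(2) by (intro mult_mono) auto
  ultimately show ?thesis using n e by (simp add: abs_mult)
qed

text \<open>A geometric series with ratio \<open>ec c\<close>: the numerator is at most 2 and the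
  denominator at least \<open>2 * \<delta>\<close>, whatever the length.\<close>

lemma weyl_linear:
  assumes "const_diff (Suc 0) c P" "\<And>i::int. \<bar>c - of_int i\<bar> \<ge> \<delta>" "\<delta> > 0"
  shows "norm (\<Sum>j<n. ec (P j)) \<le> 1 / \<delta>"
proof -
  have Pj: "P j = P 0 + real j * c" for j
  proof (induction j)
    case (Suc j)
    have "P (Suc j) - P j = c" using assms(1) by simp
    then show ?case using Suc by (simp add: algebra_simps)
  qed simp
  have Pj2: "2 * pi * P j = 2 * pi * P 0 + real j * (2 * pi * c)" for j
    by (subst Pj) (simp add: algebra_simps)
  have E: "ec (P j) = ec (P 0) * ec c ^ j" for j
    unfolding Pj2[of j] by (simp add: Complex.DeMoivre cis_mult)
  have "(\<Sum>j<n. ec (P j)) = (\<Sum>j<n. ec (P 0) * ec c ^ j)" by (intro sum.cong refl E)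
  then have "norm (\<Sum>j<n. ec (P j)) = norm (\<Sum>j<n. ec c ^ j)"
    by (simp only: sum_distrib_left[symmetric] norm_mult norm_cis mult_1_left)
  moreover have ne: "norm (1 - ec c) \<ge> 2 * \<delta>" using assms(2,3) by (rule norm_one_minus_ec_ge)
  moreover have "(1 - ec c) * (\<Sum>j<n. ec c ^ j) = 1 - ec c ^ n"
    by (metis one_diff_power_eq)
  then have "norm (1 - ec c) * norm (\<Sum>j<n. ec c ^ j) = norm (1 - ec c ^ n)"
    by (metis norm_mult)
  moreover have "norm (1 - ec c ^ n) \<le> 2"
    using norm_triangle_ineq4[of 1 "ec c ^ n"] by (simp add: norm_power)
  ultimately have "2 * \<delta> * norm (\<Sum>j<n. ec (P j)) \<le> 2"
    by (smt (verit) mult_right_mono norm_ge_zero)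
  then show ?thesis using assms(3) by (simp add: field_simps)
qed

text \<open>The sum is averaged over \<open>H\<close> shifts and Cauchy--Schwarz is applied. The
  correlations are assumed small from every base point \<open>h'\<close>, so that all of them keep
  the length \<open>n\<close>; for phases described by \<open>const_diff\<close> this comes from
  shift invariance.\<close>

lemma van_der_corput:
  fixes u :: "nat \<Rightarrow> complex"
  assumes u: "\<And>j. norm (u j) \<le> 1" and H: "H \<ge> 1" and \<eta>: "\<eta> \<ge> 0"
    and corr: "\<And>h h'. 1 \<le> h \<Longrightarrow> h < H \<Longrightarrow>
      norm (\<Sum>j<n. u (j + h' + h) * cnj (u (j + h'))) \<le> real n * \<eta>"
  shows "norm (\<Sum>j<n. u j) \<le> real H + real n * sqrt (1 / real H + \<eta>)"
proof -
  define S where "S = (\<Sum>j<n. u j)"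
  define T where "T = (\<Sum>j<n. \<Sum>h<H. u (j + h))"
  \<comment> \<open>Shifting by one exchanges one end term for another and costs at most 2; over all
    \<open>H\<close> shifts this adds up to at most \<open>H\<^sup>2\<close>.\<close>
  have sh: "norm ((\<Sum>j<n. u (j + h)) - S) \<le> 2 * real h" for h
  proof (induction h)
    case (Suc h)
    have "(\<Sum>j<n. u (j + Suc h)) - (\<Sum>j<n. u (j + h)) = u (n + h) - u h"
      by (induction n) (auto simp: algebra_simps)
    moreover have "norm (u (n + h) - u h) \<le> 2"
      using norm_triangle_ineq4[of "u (n+h)" "u h"] u[of "n+h"] u[of h] by linarith
    ultimately have "norm ((\<Sum>j<n. u (j + Suc h)) - (\<Sum>j<n. u (j + h))) \<le> 2" by simp
    then show ?case
      using Suc norm_triangle_ineq[of "(\<Sum>j<n. u (j + Suc h)) - (\<Sum>j<n. u (j + h))" "(\<Sum>j<n. u (j + h)) - S"]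
      by simp
  qed (simp add: S_def)
  have T: "T = (\<Sum>h<H. \<Sum>j<n. u (j + h))" unfolding T_def by (rule sum.swap)
  have "T - of_nat H * S = (\<Sum>h<H. (\<Sum>j<n. u (j + h)) - S)"
    by (simp add: T sum_subtractf)
  then have "norm (T - of_nat H * S) \<le> (\<Sum>h<H. 2 * real h)"
    using sh by (auto intro!: order_trans[OF norm_sum] sum_mono)
  also have "\<dots> \<le> real H * real H"
  proof -
    have "(\<Sum>h<H. 2 * real h) = real H * (real H - 1)"
      by (induction H) (auto simp: algebra_simps)
    then show ?thesis by (simp add: algebra_simps)
  qed
  finally have 1: "norm (T - of_nat H * S) \<le> real H * real H" .
  have "(norm T)\<^sup>2 \<le> (\<Sum>j<n. norm (\<Sum>h<H. u (j + h)))\<^sup>2"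
    unfolding T_def by (intro power_mono norm_sum) simp
  also have "\<dots> \<le> (\<Sum>j<n. 1\<^sup>2) * (\<Sum>j<n. (norm (\<Sum>h<H. u (j + h)))\<^sup>2)"
    using Cauchy_Schwarz_ineq_sum[of "\<lambda>_. 1" "\<lambda>j. norm (\<Sum>h<H. u (j + h))" "{..<n}"] by simp
  finally have 2: "(norm T)\<^sup>2 \<le> real n * (\<Sum>j<n. (norm (\<Sum>h<H. u (j + h)))\<^sup>2)" by simp
  have "complex_of_real (\<Sum>j<n. (norm (\<Sum>h<H. u (j + h)))\<^sup>2)
      = (\<Sum>j<n. (\<Sum>h<H. u (j + h)) * cnj (\<Sum>h<H. u (j + h)))"
    by (simp add: complex_norm_square[symmetric] del: cnj_sum)
  also have "\<dots> = (\<Sum>j<n. \<Sum>h<H. \<Sum>h'<H. u (j + h) * cnj (u (j + h')))"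
    by (simp add: sum_product)
  also have "\<dots> = (\<Sum>h<H. \<Sum>h'<H. \<Sum>j<n. u (j + h) * cnj (u (j + h')))"
    by (subst sum.swap) (intro sum.cong refl sum.swap)
  finally have e: "complex_of_real (\<Sum>j<n. (norm (\<Sum>h<H. u (j + h)))\<^sup>2)
      = (\<Sum>h<H. \<Sum>h'<H. \<Sum>j<n. u (j + h) * cnj (u (j + h')))" .
  have term_le: "norm (\<Sum>j<n. u (j + h) * cnj (u (j + h'))) \<le> (if h = h' then real n else 0) + real n * \<eta>"
    if hh: "h < H" "h' < H" for h h'
  proof -
    consider "h = h'" | "h > h'" | "h < h'" by linarith
    then show ?thesis
    proof cases
      case 1
      have "norm (\<Sum>j<n. u (j + h) * cnj (u (j + h'))) \<le> (\<Sum>j<n. 1)"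
        using u by (intro order_trans[OF norm_sum] sum_mono) (auto simp: norm_mult intro: mult_le_one)
      then show ?thesis using 1 \<eta> by simp (smt (verit) mult_nonneg_nonneg of_nat_0_le_iff)
    next
      case 2
      then show ?thesis using corr[of "h - h'" h'] hh by simp
    next
      case 3
      have "norm (\<Sum>j<n. u (j + h) * cnj (u (j + h'))) = norm (cnj (\<Sum>j<n. u (j + h) * cnj (u (j + h'))))"
        by (simp only: complex_mod_cnj)
      also have "cnj (\<Sum>j<n. u (j + h) * cnj (u (j + h'))) = (\<Sum>j<n. u (j + h + (h' - h)) * cnj (u (j + h)))"
        using 3 by (simp add: mult.commute)
      finally show ?thesis using corr[of "h' - h" h] hh 3 by simp
    qed
  qed
  have "(\<Sum>j<n. (norm (\<Sum>h<H. u (j + h)))\<^sup>2) = norm (complex_of_real (\<Sum>j<n. (norm (\<Sum>h<H. u (j + h)))\<^sup>2))"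
    by (subst norm_of_real) (simp add: sum_nonneg)
  also have "\<dots> \<le> (\<Sum>h<H. \<Sum>h'<H. (if h = h' then real n else 0) + real n * \<eta>)"
    unfolding e by (intro order_trans[OF norm_sum] sum_mono term_le) auto
  also have "\<dots> = real H * real n + real H * real H * (real n * \<eta>)"
    by (simp add: sum.distrib distrib_left mult.assoc)
  finally have "(norm T)\<^sup>2 \<le> real n * (real H * real n + real H * real H * (real n * \<eta>))"
    using 2 by (meson mult_left_mono of_nat_0_le_iff order_trans)
  also have "\<dots> = (real H * real n)\<^sup>2 * (1 / real H + \<eta>)"
    using H by (simp add: power2_eq_square field_simps)
  finally have "norm T \<le> sqrt ((real H * real n)\<^sup>2 * (1 / real H + \<eta>))"
    by (rule real_le_rsqrt)
  also have "\<dots> = real H * real n * sqrt (1 / real H + \<eta>)"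
    by (simp add: real_sqrt_mult)
  finally have 3: "norm T \<le> real H * (real n * sqrt (1 / real H + \<eta>))" by (simp add: mult.assoc)
  have "real H * norm S = norm (of_nat H * S)" by (simp add: norm_mult)
  also have "\<dots> \<le> norm T + norm (T - of_nat H * S)"
    using norm_triangle_ineq2[of "of_nat H * S" T] by (simp add: norm_minus_commute)
  also have "\<dots> \<le> real H * (real H + real n * sqrt (1 / real H + \<eta>))"
    using 1 3 by (simp add: algebra_simps)
  finally show ?thesis using H by (simp add: S_def)
qed

text \<open>Each differencing multiplies the leading number by some \<open>h < H\<close> and takes
  one square root. After \<open>d\<close> of them the multipliers reach up to \<open>H ^ d\<close>,
  the range in which \<open>dist\<close> is required, and the saving \<open>1 / H\<close> has shrunk
  to its power \<open>1 / 2 ^ d\<close>.\<close>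

lemma weyl_sum_aux:
  assumes H: "H \<ge> 1" and n: "n \<ge> 1" and \<delta>: "\<delta> > 0"
    and small: "1 / (\<delta> * real n) \<le> 1 / real H" "real H / real n \<le> 1 / real H"
    and dist: "\<And>D i::int. 1 \<le> D \<Longrightarrow> D \<le> int H ^ d \<Longrightarrow> \<bar>of_int D * c - of_int i\<bar> \<ge> \<delta>"
    and P: "const_diff (Suc d) c P"
  shows "norm (\<Sum>j<n. ec (P j)) \<le> real n * (3 * (1 / real H) powr (1 / 2 ^ d))"
  using dist P
proof (induction d arbitrary: c P)
  case 0
  have "norm (\<Sum>j<n. ec (P j)) \<le> 1 / \<delta>"
    using 0(1)[of 1] by (intro weyl_linear[OF 0(2) _ \<delta>]) auto
  also have "\<dots> \<le> real n * (1 / real H)"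
    using small(1) \<delta> n by (simp add: field_simps)
  also have "\<dots> \<le> real n * (3 * (1 / real H))"
    using n H by (intro mult_left_mono) (auto simp: divide_simps)
  finally show ?case using H by (simp add: powr_one)
next
  case (Suc d)
  define x where "x = 1 / real H"
  define \<eta> where "\<eta> = 3 * x powr (1 / 2 ^ d)"
  have x: "0 < x" "x \<le> 1" using H by (auto simp: x_def)
  have \<eta>0: "\<eta> \<ge> 0" by (simp add: \<eta>_def)
  have "norm (\<Sum>j<n. ec (P j)) \<le> real H + real n * sqrt (1 / real H + \<eta>)"
  proof (rule van_der_corput)
    fix h h' assume h: "1 \<le> h" "h < H"
    have "const_diff (Suc d) (real h * c) (\<lambda>j. P (j + h) - P j)"
      using Suc.prems(2) by (rule const_diff_step)
    then have "const_diff (Suc d) (real h * c) (\<lambda>j. P (j + h' + h) - P (j + h'))"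
      by (rule const_diff_shift)
    moreover have "\<bar>of_int D * (real h * c) - of_int i\<bar> \<ge> \<delta>" if "1 \<le> D" "D \<le> int H ^ d" for D i :: int
    proof -
      have "1 * 1 \<le> D * int h" using that h by (intro mult_mono) auto
      moreover have "D * int h \<le> int H ^ d * int H"
        using that h by (intro mult_mono) auto
      ultimately have "\<bar>of_int (D * int h) * c - of_int i\<bar> \<ge> \<delta>"
        by (intro Suc.prems(1)) (auto simp: mult.commute)
      then show ?thesis by (simp add: mult.assoc)
    qed
    ultimately have "norm (\<Sum>j<n. ec (P (j + h' + h) - P (j + h'))) \<le> real n * \<eta>"
      unfolding \<eta>_def x_def using Suc.IH[of "real h * c"] by blast
    then show "norm (\<Sum>j<n. ec (P (j + h' + h)) * cnj (ec (P (j + h')))) \<le> real n * \<eta>"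
      by (simp add: cis_cnj cis_mult right_diff_distrib)
  qed (use H \<eta>0 in auto)
  also have "real H + real n * sqrt (1 / real H + \<eta>) \<le> real n * x + real n * sqrt (1 / real H + \<eta>)"
    using small(2) n H by (simp add: field_simps x_def)
  also have "real n * x + real n * sqrt (1 / real H + \<eta>) \<le> real n * (3 * x powr (1 / 2 ^ Suc d))"
  proof -
    have xp: "x \<le> x powr (1 / 2 ^ e)" for e
      using x by (intro order_trans[OF _ powr_mono'[of "1 / 2^e" 1 x]]) (auto simp: field_simps)
    \<comment> \<open>The constant 3 reproduces itself: \<open>sqrt (1 + 3) = 2\<close>, and the
      boundary term \<open>x\<close> contributes one more.\<close>
    have "1 / real H + \<eta> \<le> 4 * x powr (1 / 2 ^ d)"
      using xp[of d] by (simp add: \<eta>_def x_def)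
    then have "sqrt (1 / real H + \<eta>) \<le> sqrt (4 * x powr (1 / 2 ^ d))" by simp
    also have "\<dots> = 2 * x powr (1 / 2 ^ Suc d)"
      using x by (simp add: real_sqrt_mult powr_half_sqrt[symmetric] powr_powr mult.commute)
    finally have "x + sqrt (1 / real H + \<eta>) \<le> 3 * x powr (1 / 2 ^ Suc d)"
      using xp[of "Suc d"] by simp
    then show ?thesis
      by (metis distrib_left mult_left_mono of_nat_0_le_iff)
  qed
  finally show ?case by (simp add: x_def)
qed

text \<open>Linear combinations, of total weight at most \<open>K\<close>, of exponentials of phases with \<open>d\<close>-th difference \<open>m * c\<close>.\<close>

inductive phase_class :: "nat \<Rightarrow> real \<Rightarrow> nat \<Rightarrow> real \<Rightarrow> (nat \<Rightarrow> complex) \<Rightarrow> bool"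
  for d :: nat and c :: real where
  phase: "const_diff d (real m * c) P \<Longrightarrow> phase_class d c m 1 (\<lambda>j. ec (P j))"
| zero: "phase_class d c m 0 (\<lambda>_. 0)"
| scale: "phase_class d c m K u \<Longrightarrow> phase_class d c m (norm a * K) (\<lambda>j. a * u j)"
| add: "phase_class d c m K u \<Longrightarrow> phase_class d c m K' u' \<Longrightarrow> phase_class d c m (K + K') (\<lambda>j. u j + u' j)"
| mono: "phase_class d c m K u \<Longrightarrow> K \<le> K' \<Longrightarrow> phase_class d c m K' u"

lemma phase_class_nonneg: "phase_class d c m K u \<Longrightarrow> 0 \<le> K"
  by (induction rule: phase_class.induct) auto

text \<open>Phases add under multiplication, so \<open>m\<close> grades the classes. Taylor
  coefficients of order \<open>m\<close> will lie in grade \<open>m\<close>.\<close>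

lemma phase_class_mult:
  assumes "phase_class d c m K u" "phase_class d c m' K' u'"
  shows "phase_class d c (m + m') (K * K') (\<lambda>j. u j * u' j)"
  using assms(1)
proof (induction rule: phase_class.induct)
  case (phase m P)
  from assms(2) show ?case
  proof (induction rule: phase_class.induct)
    case (phase m' P')
    have "const_diff d (real m * c + real m' * c) (\<lambda>j. P j + P' j)"
      using phase \<open>const_diff d (real m * c) P\<close> by (intro const_diff_add)
    then have "phase_class d c (m + m') 1 (\<lambda>j. ec (P j + P' j))"
      by (intro phase_class.phase) (simp add: algebra_simps)
    then show ?case by (simp add: cis_mult distrib_left)
  next
    case (zero m) then show ?case by (simp add: phase_class.zero)
  next
    case (scale m K u a)
    from phase_class.scale[OF scale.IH, of a] show ?case by (simp add: algebra_simps)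
  next
    case (add m K u K' u')
    from phase_class.add[OF add.IH] show ?case by (simp add: algebra_simps)
  next
    case (mono m K u K') then show ?case by (auto intro: phase_class.mono)
  qed
next
  case (zero m) then show ?case by (simp add: phase_class.zero)
next
  case (scale m K u a)
  from phase_class.scale[OF scale.IH, of a] show ?case by (simp add: algebra_simps)
next
  case (add m K u K' u')
  from phase_class.add[OF add.IH] show ?case by (simp add: algebra_simps)
next
  case (mono m K u K'')
  have "K * K' \<le> K'' * K'" using mono phase_class_nonneg[OF assms(2)] by (intro mult_right_mono)
  with mono.IH show ?case by (rule phase_class.mono)
qed

lemma phase_class_sum:
  "finite A \<Longrightarrow> (\<And>i. i \<in> A \<Longrightarrow> phase_class d c m (K i) (u i)) \<Longrightarrow>
     phase_class d c m (\<Sum>i\<in>A. K i) (\<lambda>j. \<Sum>i\<in>A. u i j)"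
  by (induction A rule: finite_induct) (auto intro: phase_class.intros)

lemma phase_class_bound:
  assumes "phase_class d c m K u"
    and "\<And>P. const_diff d (real m * c) P \<Longrightarrow> norm (\<Sum>j<n. ec (P j)) \<le> B"
    and "B \<ge> 0"
  shows "norm (\<Sum>j<n. u j) \<le> K * B"
  using assms(1,2)
proof (induction rule: phase_class.induct)
  case (scale m K u a)
  have "norm (\<Sum>j<n. a * u j) = norm a * norm (\<Sum>j<n. u j)"
    by (simp add: sum_distrib_left[symmetric] norm_mult)
  then show ?case using scale by (simp add: mult.assoc mult_left_mono)
next
  case (add m K u K' u')
  have "norm (\<Sum>j<n. u j + u' j) \<le> norm (\<Sum>j<n. u j) + norm (\<Sum>j<n. u' j)"
    by (simp add: sum.distrib norm_triangle_ineq)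
  then show ?case using add by (fastforce simp: distrib_right)
next
  case (mono m K u K')
  then show ?case by (meson assms(3) mult_right_mono order_trans)
qed auto

section \<open>Szego recursion\<close>

text \<open>The Szego recursion for the pair \<open>(\<Phi>\<^sub>n\<^sup>*, \<Phi>\<^sub>n)\<close>; the initial vector \<open>(V, 1)\<close> corresponds to multiplying all
  Verblunsky coefficients by \<open>cnj V\<close>.\<close>

primrec szego :: "(nat \<Rightarrow> complex) \<Rightarrow> complex \<Rightarrow> complex \<times> complex \<Rightarrow> nat \<Rightarrow> complex \<times> complex" where
  "szego \<alpha> z w 0 = w"
| "szego \<alpha> z w (Suc n) = (fst (szego \<alpha> z w n) - \<alpha> n * z * snd (szego \<alpha> z w n),
      z * snd (szego \<alpha> z w n) - cnj (\<alpha> n) * fst (szego \<alpha> z w n))"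

text \<open>The entries of the transfer matrix: \<open>szp\<close> and \<open>szq\<close> form its
  first column, \<open>szr\<close> and \<open>szs\<close> its second. For coefficients in the disc
  \<open>szp\<close> has no zeros in the closed disc and equals 1 at the origin, which makes its
  logarithm available.\<close>

definition szp where "szp \<alpha> n z = fst (szego \<alpha> z (1, 0) n)"
definition szq where "szq \<alpha> n z = snd (szego \<alpha> z (1, 0) n)"
definition szr where "szr \<alpha> n z = fst (szego \<alpha> z (0, 1) n)"
definition szs where "szs \<alpha> n z = snd (szego \<alpha> z (0, 1) n)"

lemma szp_0 [simp]: "szp \<alpha> 0 z = 1" and szq_0 [simp]: "szq \<alpha> 0 z = 0"
  and szr_0 [simp]: "szr \<alpha> 0 z = 0" and szs_0 [simp]: "szs \<alpha> 0 z = 1"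
  by (simp_all add: szp_def szq_def szr_def szs_def)

lemma szp_Suc: "szp \<alpha> (Suc n) z = szp \<alpha> n z - \<alpha> n * z * szq \<alpha> n z"
  and szq_Suc: "szq \<alpha> (Suc n) z = z * szq \<alpha> n z - cnj (\<alpha> n) * szp \<alpha> n z"
  and szr_Suc: "szr \<alpha> (Suc n) z = szr \<alpha> n z - \<alpha> n * z * szs \<alpha> n z"
  and szs_Suc: "szs \<alpha> (Suc n) z = z * szs \<alpha> n z - cnj (\<alpha> n) * szr \<alpha> n z"
  by (simp_all add: szp_def szq_def szr_def szs_def)

lemma szego_eq:
  "szego \<alpha> z (u, v) n = (u * szp \<alpha> n z + v * szr \<alpha> n z, u * szq \<alpha> n z + v * szs \<alpha> n z)"
  by (induction n) (simp_all add: szp_Suc szq_Suc szr_Suc szs_Suc algebra_simps)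

lemma szego_add: "szego \<alpha> z w (a + m) = szego (\<lambda>i. \<alpha> (a + i)) z (szego \<alpha> z w a) m"
  by (induction m) simp_all

lemma szego_det:
  "szp \<alpha> n z * szs \<alpha> n z - szq \<alpha> n z * szr \<alpha> n z = z ^ n * of_real (\<Prod>i<n. 1 - (norm (\<alpha> i))\<^sup>2)"
proof (induction n)
  case (Suc n)
  have "szp \<alpha> (Suc n) z * szs \<alpha> (Suc n) z - szq \<alpha> (Suc n) z * szr \<alpha> (Suc n) z
      = z * (1 - \<alpha> n * cnj (\<alpha> n)) * (szp \<alpha> n z * szs \<alpha> n z - szq \<alpha> n z * szr \<alpha> n z)"
    by (simp add: szp_Suc szq_Suc szr_Suc szs_Suc algebra_simps)
  moreover have "\<alpha> n * cnj (\<alpha> n) = (complex_of_real (norm (\<alpha> n)))\<^sup>2"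
    using complex_norm_square[of "\<alpha> n"] by simp
  ultimately show ?case using Suc by simp
qed simp

text \<open>On the circle each step is a scalar multiple of an element of U(1,1), hence scales the
  indefinite form by a fixed factor.\<close>

lemma szego_norm_diff:
  assumes "norm z = 1"
  shows "(norm (fst (szego \<alpha> z w n)))\<^sup>2 - (norm (snd (szego \<alpha> z w n)))\<^sup>2
      = (\<Prod>i<n. 1 - (norm (\<alpha> i))\<^sup>2) * ((norm (fst w))\<^sup>2 - (norm (snd w))\<^sup>2)"
proof (induction n)
  case (Suc n)
  let ?u = "fst (szego \<alpha> z w n)" and ?v = "snd (szego \<alpha> z w n)"
  have zz: "z * cnj z = 1" using assms by (simp add: complex_norm_square[symmetric])
  have "complex_of_real ((norm (?u - \<alpha> n * z * ?v))\<^sup>2 - (norm (z * ?v - cnj (\<alpha> n) * ?u))\<^sup>2)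
      = (1 - \<alpha> n * cnj (\<alpha> n)) * (?u * cnj ?u) - (z * cnj z) * (1 - \<alpha> n * cnj (\<alpha> n)) * (?v * cnj ?v)"
    unfolding of_real_diff complex_norm_square complex_cnj_diff complex_cnj_mult complex_cnj_cnj
    by (simp add: algebra_simps)
  also have "\<dots> = complex_of_real ((1 - (norm (\<alpha> n))\<^sup>2) * ((norm ?u)\<^sup>2 - (norm ?v)\<^sup>2))"
    unfolding zz of_real_diff of_real_mult complex_norm_square by (simp add: algebra_simps)
  finally have "(norm (?u - \<alpha> n * z * ?v))\<^sup>2 - (norm (z * ?v - cnj (\<alpha> n) * ?u))\<^sup>2
      = (1 - (norm (\<alpha> n))\<^sup>2) * ((norm ?u)\<^sup>2 - (norm ?v)\<^sup>2)" by (simp only: of_real_eq_iff)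
  then show ?case using Suc by simp
qed simp

lemma szp_szq_circle:
  assumes "norm z = 1"
  shows "(norm (szp \<alpha> n z))\<^sup>2 - (norm (szq \<alpha> n z))\<^sup>2 = (\<Prod>i<n. 1 - (norm (\<alpha> i))\<^sup>2)"
  using szego_norm_diff[OF assms, of \<alpha> "(1,0)" n] by (simp add: szp_def szq_def)

text \<open>The recursion is symmetric under reflection in the circle, which exchanges the two
  columns of the transfer matrix up to \<open>z ^ n\<close>. On the circle only \<open>szp\<close>
  and \<open>szq\<close> remain to be estimated.\<close>

lemma szs_szr_eq:
  assumes "z \<noteq> 0"
  shows "szs \<alpha> n z = z ^ n * cnj (szp \<alpha> n (inverse (cnj z)))"
    and "szr \<alpha> n z = z ^ n * cnj (szq \<alpha> n (inverse (cnj z)))"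
proof (induction n)
  case (Suc n)
  { case 1 show ?case using Suc assms by (simp add: szs_Suc szp_Suc algebra_simps) next
    case 2 show ?case using Suc assms by (simp add: szr_Suc szq_Suc algebra_simps) }
qed simp_all

lemma szs_szr_circle:
  assumes "norm z = 1"
  shows "szs \<alpha> n z = z ^ n * cnj (szp \<alpha> n z)" "szr \<alpha> n z = z ^ n * cnj (szq \<alpha> n z)"
proof -
  have z: "z \<noteq> 0" using assms by auto
  have "z * cnj z = 1" using assms by (simp add: complex_norm_square[symmetric])
  then have "inverse (cnj z) = z" using z by (metis complex_cnj_zero_iff inverse_unique mult.commute)
  then show "szs \<alpha> n z = z ^ n * cnj (szp \<alpha> n z)" "szr \<alpha> n z = z ^ n * cnj (szq \<alpha> n z)"
    using szs_szr_eq[OF z] by simp_all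
qed

lemma moebius_lt_one:
  fixes a b :: complex
  assumes "norm a < 1" "norm b < 1"
  shows "norm (b - cnj a) < norm (1 - a * b)"
proof -
  have "complex_of_real ((norm (1 - a * b))\<^sup>2 - (norm (b - cnj a))\<^sup>2)
      = complex_of_real ((1 - (norm a)\<^sup>2) * (1 - (norm b)\<^sup>2))"
    unfolding of_real_diff of_real_mult complex_norm_square by (simp add: algebra_simps)
  then have "(norm (1 - a * b))\<^sup>2 - (norm (b - cnj a))\<^sup>2 = (1 - (norm a)\<^sup>2) * (1 - (norm b)\<^sup>2)"
    by (simp only: of_real_eq_iff)
  also have "\<dots> > 0" using assms by (simp add: power_less_one_iff)
  finally show ?thesis using power_less_imp_less_base[of "norm (b - cnj a)" 2 "norm (1 - a * b)"] by auto
qed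

text \<open>The quotient \<open>szq / szp\<close> starts at 0 and evolves by \<open>w \<mapsto> (z *
  w - cnj (\<alpha> n)) / (1 - \<alpha> n * z * w)\<close>, which keeps the open disc by
  \<open>moebius_lt_one\<close>. The strict inequality also carries \<open>szp \<noteq> 0\<close>
  through the induction.\<close>

lemma szq_less_szp:
  assumes "\<And>i. norm (\<alpha> i) < 1" "norm z \<le> 1"
  shows "norm (szq \<alpha> n z) < norm (szp \<alpha> n z)"
proof (induction n)
  case (Suc n)
  let ?p = "szp \<alpha> n z" and ?q = "szq \<alpha> n z"
  have p: "?p \<noteq> 0" using Suc by auto
  have "norm (z * (?q / ?p)) \<le> 1 * norm (?q / ?p)"
    unfolding norm_mult using assms(2) by (intro mult_right_mono) auto
  also have "\<dots> < 1" using Suc p by (simp add: norm_divide divide_simps)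
  finally have "norm (z * (?q / ?p) - cnj (\<alpha> n)) < norm (1 - \<alpha> n * (z * (?q / ?p)))"
    using assms(1) by (intro moebius_lt_one) auto
  then have "norm ?p * norm (z * (?q / ?p) - cnj (\<alpha> n)) < norm ?p * norm (1 - \<alpha> n * (z * (?q / ?p)))"
    using p by (intro mult_strict_left_mono) auto
  moreover have "?p * (z * (?q / ?p) - cnj (\<alpha> n)) = szq \<alpha> (Suc n) z"
    "?p * (1 - \<alpha> n * (z * (?q / ?p))) = szp \<alpha> (Suc n) z"
    using p by (simp_all add: szp_Suc szq_Suc field_simps)
  ultimately show ?case by (simp only: norm_mult[symmetric])
qed simp

lemma szp_nonzero: "(\<And>i. norm (\<alpha> i) < 1) \<Longrightarrow> norm z \<le> 1 \<Longrightarrow> szp \<alpha> n z \<noteq> 0"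
  using szq_less_szp[of \<alpha> z n] by auto

lemma szego_holomorphic: "szp \<alpha> n holomorphic_on A" "szq \<alpha> n holomorphic_on A"
    "szr \<alpha> n holomorphic_on A" "szs \<alpha> n holomorphic_on A"
proof -
  have "szp \<alpha> n holomorphic_on A \<and> szq \<alpha> n holomorphic_on A \<and> szr \<alpha> n holomorphic_on A \<and> szs \<alpha> n holomorphic_on A"
  proof (induction n)
    case 0
    have "szp \<alpha> 0 = (\<lambda>_. 1)" "szq \<alpha> 0 = (\<lambda>_. 0)" "szr \<alpha> 0 = (\<lambda>_. 0)" "szs \<alpha> 0 = (\<lambda>_. 1)" by auto
    then show ?case by simp
  next
    case (Suc n)
    have "szp \<alpha> (Suc n) = (\<lambda>z. szp \<alpha> n z - \<alpha> n * z * szq \<alpha> n z)"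
      "szq \<alpha> (Suc n) = (\<lambda>z. z * szq \<alpha> n z - cnj (\<alpha> n) * szp \<alpha> n z)"
      "szr \<alpha> (Suc n) = (\<lambda>z. szr \<alpha> n z - \<alpha> n * z * szs \<alpha> n z)"
      "szs \<alpha> (Suc n) = (\<lambda>z. z * szs \<alpha> n z - cnj (\<alpha> n) * szr \<alpha> n z)"
      by (auto simp: szp_Suc szq_Suc szr_Suc szs_Suc)
    then show ?case using Suc by (auto intro!: holomorphic_intros)
  qed
  then show "szp \<alpha> n holomorphic_on A" "szq \<alpha> n holomorphic_on A"
    "szr \<alpha> n holomorphic_on A" "szs \<alpha> n holomorphic_on A" by auto
qed

lemma szego_continuous [continuous_intros]:
  assumes "continuous_on A f"
  shows "continuous_on A (\<lambda>x. szp \<alpha> n (f x))" "continuous_on A (\<lambda>x. szq \<alpha> n (f x))"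
    "continuous_on A (\<lambda>x. szr \<alpha> n (f x))" "continuous_on A (\<lambda>x. szs \<alpha> n (f x))"
  using szego_holomorphic[of \<alpha> n UNIV, THEN holomorphic_on_imp_continuous_on]
  by (auto intro!: continuous_on_compose2[OF _ assms])

section \<open>Cauchy's formula and the mean value property on the unit circle\<close>

lemma circle_Cauchy_integral:
  assumes "continuous_on (cball 0 1) f" "f holomorphic_on ball 0 1" "norm w < 1"
  shows "((\<lambda>t. f (ec t) * ec t / (ec t - w)) has_integral f w) {0..1}"
proof -
  have "((\<lambda>u. f u / (u - w)) has_contour_integral (2 * of_real pi * \<i> * f w)) (circlepath 0 1)"
    using assms by (intro Cauchy_integral_circlepath) auto
  then have "((\<lambda>t. f (circlepath 0 1 t) / (circlepath 0 1 t - w) * vector_derivative (circlepath 0 1) (at t within {0..1}))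
      has_integral (2 * of_real pi * \<i> * f w)) {0..1}"
    by (simp add: has_contour_integral_def)
  then have "((\<lambda>t. f (ec t) / (ec t - w) * (2 * pi * \<i> * ec t)) has_integral (2 * of_real pi * \<i> * f w)) {0..1}"
  proof (rule has_integral_eq[rotated])
    fix t :: real assume t: "t \<in> {0..1}"
    have c: "circlepath 0 1 t = ec t" by (simp add: circlepath cis_conv_exp mult_ac)
    show "f (circlepath 0 1 t) / (circlepath 0 1 t - w) * vector_derivative (circlepath 0 1) (at t within {0..1})
        = f (ec t) / (ec t - w) * (2 * pi * \<i> * ec t)"
      using t by (subst vector_derivative_circlepath01) (auto simp: c cis_conv_exp mult_ac)
  qed
  then have "((\<lambda>t. 1 / (2 * of_real pi * \<i>) * (f (ec t) / (ec t - w) * (2 * pi * \<i> * ec t)))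
      has_integral (1 / (2 * of_real pi * \<i>) * (2 * of_real pi * \<i> * f w))) {0..1}"
    by (rule has_integral_mult_right)
  then show ?thesis by (simp add: field_simps)
qed

lemma circle_mean_value:
  assumes "continuous_on (cball 0 1) f" "f holomorphic_on ball 0 1"
  shows "((\<lambda>t. f (ec t)) has_integral f 0) {0..1}"
  using circle_Cauchy_integral[OF assms, of 0] by simp

section \<open>Upper bounds for the transfer matrices\<close>

definition szg :: "(nat \<Rightarrow> complex) \<Rightarrow> nat \<Rightarrow> complex \<Rightarrow> complex" where
  "szg \<alpha> n z = \<alpha> n * z * szq \<alpha> n z / szp \<alpha> n z"

lemma szp_eq_prod:
  assumes "\<And>i. norm (\<alpha> i) < 1" "norm z \<le> 1"
  shows "szp \<alpha> n z = (\<Prod>j<n. 1 - szg \<alpha> j z)"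
proof (induction n)
  case (Suc n)
  have "szp \<alpha> (Suc n) z = szp \<alpha> n z * (1 - szg \<alpha> n z)"
    using szp_nonzero[of \<alpha> z n, OF assms] by (simp add: szp_Suc szg_def field_simps)
  then show ?case using Suc by simp
qed simp

lemma norm_szg_le:
  assumes "\<And>i. norm (\<alpha> i) < 1" "norm z \<le> 1"
  shows "norm (szg \<alpha> n z) \<le> norm (\<alpha> n)"
proof -
  have "norm (szg \<alpha> n z) = norm (\<alpha> n) * (norm z * (norm (szq \<alpha> n z) / norm (szp \<alpha> n z)))"
    by (simp add: szg_def norm_mult norm_divide)
  also have "\<dots> \<le> norm (\<alpha> n) * (1 * 1)"
    using szq_less_szp[of \<alpha> z n, OF assms] assms(2)
    by (intro mult_left_mono mult_mono) (auto simp: divide_simps)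
  finally show ?thesis by simp
qed

lemma szg_holomorphic:
  assumes "\<And>i. norm (\<alpha> i) < 1" "A \<subseteq> cball 0 1"
  shows "szg \<alpha> n holomorphic_on A"
  unfolding szg_def[abs_def] using assms(2)
  by (intro holomorphic_intros szego_holomorphic szp_nonzero assms(1)) auto

lemma szg_0 [simp]: "szg \<alpha> 0 z = 0" and szg_at_0 [simp]: "szg \<alpha> n 0 = 0"
  by (simp_all add: szg_def)

text \<open>\<open>szp\<close> changes by the factor \<open>1 - szg\<close> in one step; if consecutive coefficients differ by the phase \<open>s\<close>, \<open>szg\<close>
  satisfies the closed recursion \<open>szg \<alpha> (Suc n) z = s * z * szR \<alpha> n z\<close>.\<close>

definition szR :: "(nat \<Rightarrow> complex) \<Rightarrow> nat \<Rightarrow> complex \<Rightarrow> complex" where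
  "szR \<alpha> n z = (szg \<alpha> n z - of_real ((norm (\<alpha> n))\<^sup>2)) / (1 - szg \<alpha> n z)"

lemma one_minus_szg_Re:
  assumes "\<And>i. norm (\<alpha> i) < 1" "norm z \<le> 1"
  shows "Re (1 - szg \<alpha> n z) > 0"
  using norm_szg_le[of \<alpha> z n, OF assms] assms(1)[of n] complex_Re_le_cmod[of "szg \<alpha> n z"]
  by simp

lemma one_minus_szg_nonzero:
  assumes "\<And>i. norm (\<alpha> i) < 1" "norm z \<le> 1"
  shows "1 - szg \<alpha> n z \<noteq> 0"
  using one_minus_szg_Re[of \<alpha> z n, OF assms] by auto

lemma szR_holomorphic:
  assumes "\<And>i. norm (\<alpha> i) < 1" "A \<subseteq> cball 0 1"
  shows "szR \<alpha> n holomorphic_on A"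
  unfolding szR_def[abs_def] using assms(2)
  by (intro holomorphic_intros szg_holomorphic one_minus_szg_nonzero assms) auto

lemma szg_Suc:
  assumes "\<And>i. norm (\<alpha> i) < 1" "norm z \<le> 1" "\<alpha> (Suc n) = \<alpha> n * s"
  shows "szg \<alpha> (Suc n) z = s * z * szR \<alpha> n z"
proof -
  have p: "szp \<alpha> n z \<noteq> 0" by (rule szp_nonzero[OF assms(1,2)])
  have eq: "szp \<alpha> (Suc n) z = szp \<alpha> n z * (1 - szg \<alpha> n z)"
    using p by (simp add: szp_Suc szg_def field_simps)
  have "\<alpha> n * szq \<alpha> (Suc n) z = szp \<alpha> n z * (szg \<alpha> n z - of_real ((norm (\<alpha> n))\<^sup>2))"
    unfolding complex_norm_square using p by (simp add: szq_Suc szg_def field_simps)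
  then have "s * z * (\<alpha> n * szq \<alpha> (Suc n) z) = s * z * (szp \<alpha> n z * (szg \<alpha> n z - of_real ((norm (\<alpha> n))\<^sup>2)))"
    by simp
  then have "\<alpha> (Suc n) * z * szq \<alpha> (Suc n) z = s * z * (szp \<alpha> n z * (szg \<alpha> n z - of_real ((norm (\<alpha> n))\<^sup>2)))"
    unfolding assms(3) by (simp only: mult_ac)
  then have "szg \<alpha> (Suc n) z = (s * z * (szp \<alpha> n z * (szg \<alpha> n z - of_real ((norm (\<alpha> n))\<^sup>2)))) / (szp \<alpha> n z * (1 - szg \<alpha> n z))"
    unfolding szg_def[of \<alpha> "Suc n"] eq by (simp only:)
  then show ?thesis unfolding szR_def using p by simp
qed

section \<open>Taylor coefficients of the logarithm of \<open>szp\<close>\<close>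

definition szG where "szG \<alpha> n = fps_expansion (szg \<alpha> n) 0"
definition szRF where "szRF \<alpha> n = fps_expansion (szR \<alpha> n) 0"
definition szL where "szL \<alpha> n = fps_expansion (\<lambda>z. Ln (1 - szg \<alpha> n z)) 0"

lemma holomorphic_Ln_szg:
  assumes "\<And>i. norm (\<alpha> i) < 1" "A \<subseteq> cball 0 1"
  shows "(\<lambda>z. Ln (1 - szg \<alpha> n z)) holomorphic_on A"
proof (rule holomorphic_on_Ln')
  fix z assume "z \<in> A"
  then show "1 - szg \<alpha> n z \<notin> \<real>\<^sub>\<le>\<^sub>0"
    using one_minus_szg_Re[of \<alpha> z n, OF assms(1)] assms(2)
    by (auto simp: complex_nonpos_Reals_iff)
qed (intro holomorphic_intros szg_holomorphic assms)

lemma ev_ball: "(\<And>z. norm z < 1 \<Longrightarrow> P z) \<Longrightarrow> eventually P (nhds (0::complex))"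
  by (rule eventually_mono[OF eventually_nhds_in_open[of "ball 0 1"]]) auto

lemma szego_expansions:
  assumes "\<And>i. norm (\<alpha> i) < 1"
  shows "szg \<alpha> n has_fps_expansion szG \<alpha> n" "szR \<alpha> n has_fps_expansion szRF \<alpha> n"
    "(\<lambda>z. Ln (1 - szg \<alpha> n z)) has_fps_expansion szL \<alpha> n"
  unfolding szG_def szRF_def szL_def
  using szg_holomorphic[of \<alpha> "ball 0 1" n, OF assms] szR_holomorphic[of \<alpha> "ball 0 1" n, OF assms]
    holomorphic_Ln_szg[of \<alpha> "ball 0 1" n, OF assms]
  by (auto intro!: has_fps_expansion_fps_expansion[of "ball 0 1"] ball_subset_cball)

text \<open>The relations between \<open>szg\<close>, \<open>szR\<close> and the logarithm near the
  origin, carried over to power series by uniqueness of expansions; the third is the logarithmic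
  derivative.\<close>

lemma szG_rec:
  assumes "\<And>i. norm (\<alpha> i) < 1"
  shows "\<alpha> (Suc n) = \<alpha> n * s \<Longrightarrow> szG \<alpha> (Suc n) = fps_const s * fps_X * szRF \<alpha> n"
    and "szRF \<alpha> n * (1 - szG \<alpha> n) = szG \<alpha> n - fps_const (of_real ((norm (\<alpha> n))\<^sup>2))"
    and "fps_deriv (szL \<alpha> n) * (1 - szG \<alpha> n) = - fps_deriv (szG \<alpha> n)"
proof -
  note E = szego_expansions[of \<alpha> n, OF assms]
  { assume s: "\<alpha> (Suc n) = \<alpha> n * s"
    have "(\<lambda>z. s * z * szR \<alpha> n z) has_fps_expansion fps_const s * fps_X * szRF \<alpha> n"
      by (intro fps_expansion_intros E)
    moreover have "eventually (\<lambda>z. szg \<alpha> (Suc n) z = s * z * szR \<alpha> n z) (nhds 0)"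
      by (intro ev_ball szg_Suc assms s) auto
    ultimately have "szg \<alpha> (Suc n) has_fps_expansion fps_const s * fps_X * szRF \<alpha> n"
      by (subst has_fps_expansion_cong[OF _ refl]) auto
    then show "szG \<alpha> (Suc n) = fps_const s * fps_X * szRF \<alpha> n"
      using szego_expansions(1)[of \<alpha> "Suc n", OF assms] by (rule fps_expansion_unique_complex[symmetric]) }
  have "(\<lambda>z. szR \<alpha> n z * (1 - szg \<alpha> n z)) has_fps_expansion szRF \<alpha> n * (1 - szG \<alpha> n)"
    by (intro fps_expansion_intros E)
  moreover have "eventually (\<lambda>z. szR \<alpha> n z * (1 - szg \<alpha> n z) = szg \<alpha> n z - of_real ((norm (\<alpha> n))\<^sup>2)) (nhds 0)"
    using one_minus_szg_nonzero[of \<alpha> _ n, OF assms] by (intro ev_ball) (simp add: szR_def)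
  ultimately have "(\<lambda>z. szg \<alpha> n z - of_real ((norm (\<alpha> n))\<^sup>2)) has_fps_expansion szRF \<alpha> n * (1 - szG \<alpha> n)"
    by (simp only: has_fps_expansion_cong[OF _ refl])
  moreover have "(\<lambda>z. szg \<alpha> n z - of_real ((norm (\<alpha> n))\<^sup>2)) has_fps_expansion szG \<alpha> n - fps_const (of_real ((norm (\<alpha> n))\<^sup>2))"
    by (intro fps_expansion_intros E)
  ultimately show "szRF \<alpha> n * (1 - szG \<alpha> n) = szG \<alpha> n - fps_const (of_real ((norm (\<alpha> n))\<^sup>2))"
    by (rule fps_expansion_unique_complex)
  have "(\<lambda>z. deriv (\<lambda>z. Ln (1 - szg \<alpha> n z)) z * (1 - szg \<alpha> n z)) has_fps_expansion fps_deriv (szL \<alpha> n) * (1 - szG \<alpha> n)"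
    by (intro fps_expansion_intros E)
  moreover have "eventually (\<lambda>z. deriv (\<lambda>z. Ln (1 - szg \<alpha> n z)) z * (1 - szg \<alpha> n z) = - deriv (szg \<alpha> n) z) (nhds 0)"
  proof (rule ev_ball)
    fix z :: complex assume z: "norm z < 1"
    have np: "1 - szg \<alpha> n z \<notin> \<real>\<^sub>\<le>\<^sub>0"
      using one_minus_szg_Re[of \<alpha> z n, OF assms] z by (auto simp: complex_nonpos_Reals_iff)
    have "(szg \<alpha> n has_field_derivative deriv (szg \<alpha> n) z) (at z)"
      using szg_holomorphic[of \<alpha> "ball 0 1" n, OF assms] z
      by (intro holomorphic_derivI[of _ "ball 0 1"]) auto
    then have "((\<lambda>z. Ln (1 - szg \<alpha> n z)) has_field_derivative (inverse (1 - szg \<alpha> n z) * (0 - deriv (szg \<alpha> n) z))) (at z)"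
      using np by (auto intro!: derivative_eq_intros)
    then have "deriv (\<lambda>z. Ln (1 - szg \<alpha> n z)) z = inverse (1 - szg \<alpha> n z) * (0 - deriv (szg \<alpha> n) z)"
      by (rule DERIV_imp_deriv)
    then show "deriv (\<lambda>z. Ln (1 - szg \<alpha> n z)) z * (1 - szg \<alpha> n z) = - deriv (szg \<alpha> n) z"
      using one_minus_szg_nonzero[of \<alpha> z n, OF assms] z by (simp add: field_simps)
  qed
  ultimately have "(\<lambda>z. - deriv (szg \<alpha> n) z) has_fps_expansion fps_deriv (szL \<alpha> n) * (1 - szG \<alpha> n)"
    by (simp only: has_fps_expansion_cong[OF _ refl])
  moreover have "(\<lambda>z. - deriv (szg \<alpha> n) z) has_fps_expansion - fps_deriv (szG \<alpha> n)"
    by (intro fps_expansion_intros E)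
  ultimately show "fps_deriv (szL \<alpha> n) * (1 - szG \<alpha> n) = - fps_deriv (szG \<alpha> n)"
    by (rule fps_expansion_unique_complex)
qed

lemma szG_nth_0: "(\<And>i. norm (\<alpha> i) < 1) \<Longrightarrow> fps_nth (szG \<alpha> n) 0 = 0"
  by (simp add: szG_def fps_expansion_def)

lemma szL_nth_0: "(\<And>i. norm (\<alpha> i) < 1) \<Longrightarrow> fps_nth (szL \<alpha> n) 0 = 0"
  by (simp add: szL_def fps_expansion_def)

text \<open>The weights \<open>2 ^ m\<^sup>2\<close> dominate the convolutions in the coefficient
  recursions. So crude a majorant suffices because the order is later kept below
  \<open>(ln q) powr (1/3)\<close>.\<close>

lemma pow2_sq_step: "m \<ge> 1 \<Longrightarrow> (1 + real m) * 2 ^ (m - 1)\<^sup>2 \<le> 2 ^ m\<^sup>2"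
  "(2 * real m + 1) * 2 ^ m\<^sup>2 \<le> 2 ^ (Suc m)\<^sup>2"
proof -
  have b: "real m + 1 \<le> 2 ^ m" for m :: nat
    by (induction m) auto
  { assume m: "m \<ge> 1"
    then have "m\<^sup>2 = (m - 1)\<^sup>2 + (2 * m - 1)" by (cases m) (auto simp: power2_eq_square)
    then have e: "(2::real) ^ m\<^sup>2 = 2 ^ (m - 1)\<^sup>2 * 2 ^ (2 * m - 1)" by (simp only: power_add)
    have g: "(2::real) ^ m \<le> 2 ^ (2 * m - 1)" using m by (intro power_increasing) auto
    show "(1 + real m) * 2 ^ (m - 1)\<^sup>2 \<le> 2 ^ m\<^sup>2"
    proof -
      have "(1 + real m) * 2 ^ (m - 1)\<^sup>2 \<le> 2 ^ (2 * m - 1) * 2 ^ (m - 1)\<^sup>2"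
        using order_trans[OF b[of m] g] by (intro mult_right_mono) auto
      then show ?thesis unfolding e by (simp only: mult.commute)
    qed }
  have "(Suc m)\<^sup>2 = m\<^sup>2 + (2 * m + 1)" by (simp add: power2_eq_square)
  then have "(2::real) ^ (Suc m)\<^sup>2 = 2 ^ m\<^sup>2 * 2 ^ (2 * m + 1)" by (simp only: power_add)
  moreover have "(2::real) ^ (2 * m + 1) \<ge> 2 * real m + 1" using b[of "2 * m + 1"] by simp
  ultimately show "(2 * real m + 1) * 2 ^ m\<^sup>2 \<le> 2 ^ (Suc m)\<^sup>2"
    by (simp add: mult.commute mult_left_mono)
qed

lemma pow2_sq_add: "a + b \<le> m \<Longrightarrow> (2::real) ^ a\<^sup>2 * 2 ^ b\<^sup>2 \<le> 2 ^ m\<^sup>2"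
proof -
  assume "a + b \<le> m"
  then have "(a + b)\<^sup>2 \<le> m\<^sup>2" by (rule power_mono) simp
  then have "a\<^sup>2 + b\<^sup>2 \<le> m\<^sup>2" by (simp add: power2_sum)
  then show ?thesis by (simp add: power_add[symmetric] power_increasing)
qed

lemma phase_class_cmult:
  "phase_class d c m K u \<Longrightarrow> norm a * K \<le> K' \<Longrightarrow> phase_class d c m K' (\<lambda>j. a * u j)"
  by (rule phase_class.mono[OF phase_class.scale])

lemma phase_class_const: "phase_class d c 0 (norm a) (\<lambda>_. a)"
proof -
  have "const_diff d 0 (\<lambda>_. 0)" by (induction d) simp_all
  then have "phase_class d c 0 1 (\<lambda>j. ec ((\<lambda>_. 0) j))"
    by (intro phase_class.phase) simp
  from phase_class_cmult[OF this, of a "norm a"] show ?thesis by simp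
qed

text \<open>Comparing coefficients gives \<open>R\<^sub>m = G\<^sub>m + (\<Sum>l<m. R\<^sub>l *
  G\<^sub>m\<^sub>-\<^sub>l)\<close> and, one time step later,
  \<open>G\<^sub>m\<^sub>+\<^sub>1 = ec P * R\<^sub>m\<close>. Order \<open>m\<close> thus reaches
  \<open>m\<close> steps back in time, whence the shift by \<open>i \<ge> m\<close>, and each factor
  \<open>ec P\<close> raises the grade by one.\<close>

lemma szRF_phase_class:
  assumes \<alpha>: "\<And>i. norm (\<alpha> i) = \<kappa>" "\<kappa> < 1"
    and P: "const_diff d c P" "\<And>j. \<alpha> (Suc j) = \<alpha> j * ec (P j)"
    and "m \<le> i"
  shows "phase_class d c m (2 ^ m\<^sup>2) (\<lambda>j. fps_nth (szRF \<alpha> (j + i)) m)"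
    and "phase_class d c (Suc m) (2 ^ m\<^sup>2) (\<lambda>j. fps_nth (szG \<alpha> (j + Suc i)) (Suc m))"
proof -
  have \<alpha>1: "norm (\<alpha> i) < 1" for i using \<alpha> by simp
  have \<kappa>0: "0 \<le> \<kappa>" using \<alpha>(1)[of 0] norm_ge_zero by metis
  have main: "\<forall>i\<ge>m. phase_class d c m (2 ^ m\<^sup>2) (\<lambda>j. fps_nth (szRF \<alpha> (j + i)) m) \<and>
        phase_class d c (Suc m) (2 ^ m\<^sup>2) (\<lambda>j. fps_nth (szG \<alpha> (j + Suc i)) (Suc m))" for m
  proof (induction m rule: less_induct)
    case (less m)
    have R: "phase_class d c m (2 ^ m\<^sup>2) (\<lambda>j. fps_nth (szRF \<alpha> (j + i)) m)" if i: "m \<le> i" for i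
    proof (cases m)
      case 0
      have "fps_nth (szRF \<alpha> n * (1 - szG \<alpha> n)) 0 = - of_real (\<kappa>\<^sup>2)" for n
        unfolding szG_rec(2)[OF \<alpha>1] by (simp add: szG_nth_0[OF \<alpha>1] \<alpha>)
      then have "fps_nth (szRF \<alpha> n) 0 = - of_real (\<kappa>\<^sup>2)" for n
        by (simp add: szG_nth_0[OF \<alpha>1])
      moreover have "phase_class d c 0 1 (\<lambda>_. - of_real (\<kappa>\<^sup>2))"
        by (rule phase_class.mono[OF phase_class_const])
           (use \<kappa>0 \<alpha>(2) in \<open>simp add: norm_power power_le_one\<close>)
      ultimately show ?thesis using 0 by simp
    next
      case (Suc m')
      have eq: "fps_nth (szRF \<alpha> n) m = fps_nth (szG \<alpha> n) m
          + (\<Sum>l<m. fps_nth (szRF \<alpha> n) l * fps_nth (szG \<alpha> n) (m - l))" for n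
      proof -
        have "fps_nth (szRF \<alpha> n * (1 - szG \<alpha> n)) m = fps_nth (szG \<alpha> n) m"
          unfolding szG_rec(2)[OF \<alpha>1] using Suc by simp
        moreover have "fps_nth (szRF \<alpha> n * (1 - szG \<alpha> n)) m
            = fps_nth (szRF \<alpha> n) m - fps_nth (szRF \<alpha> n * szG \<alpha> n) m" by (simp add: algebra_simps)
        moreover have "fps_nth (szRF \<alpha> n * szG \<alpha> n) m
            = (\<Sum>l<m. fps_nth (szRF \<alpha> n) l * fps_nth (szG \<alpha> n) (m - l))"
          unfolding fps_mult_nth by (simp add: atLeast0AtMost lessThan_Suc_atMost[symmetric] szG_nth_0[OF \<alpha>1])
        ultimately show ?thesis by (simp add: algebra_simps)
      qed
      have Gc: "phase_class d c l (2 ^ (l - 1)\<^sup>2) (\<lambda>j. fps_nth (szG \<alpha> (j + i)) l)"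
        if "1 \<le> l" "l \<le> m" for l
      proof -
        have "Suc (j + (i - Suc 0)) = j + i" for j using that i by simp
        moreover have "l - 1 < m" "l - 1 \<le> i - 1" using that i by auto
        then have "phase_class d c (Suc (l - 1)) (2 ^ (l - 1)\<^sup>2) (\<lambda>j. fps_nth (szG \<alpha> (j + Suc (i - 1))) (Suc (l - 1)))"
          using less.IH[of "l - 1"] by blast
        ultimately show ?thesis using that by simp
      qed
      have "phase_class d c m (2 ^ (m-1)\<^sup>2 + (\<Sum>l<m. 2 ^ (m-1)\<^sup>2))
          (\<lambda>j. fps_nth (szG \<alpha> (j + i)) m + (\<Sum>l<m. fps_nth (szRF \<alpha> (j + i)) l * fps_nth (szG \<alpha> (j + i)) (m - l)))"
      proof (intro phase_class.add phase_class_sum)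
        show "phase_class d c m (2 ^ (m-1)\<^sup>2) (\<lambda>j. fps_nth (szG \<alpha> (j + i)) m)"
          using Gc[of m] Suc by simp
      next
        fix l assume l: "l \<in> {..<m}"
        have "phase_class d c (l + (m - l)) (2 ^ l\<^sup>2 * 2 ^ (m - l - 1)\<^sup>2)
            (\<lambda>j. fps_nth (szRF \<alpha> (j + i)) l * fps_nth (szG \<alpha> (j + i)) (m - l))"
          using less.IH[of l] l i by (intro phase_class_mult Gc) auto
        moreover have "(2::real) ^ l\<^sup>2 * 2 ^ (m - l - 1)\<^sup>2 \<le> 2 ^ (m-1)\<^sup>2"
          using l by (intro pow2_sq_add) auto
        ultimately show "phase_class d c m (2 ^ (m-1)\<^sup>2)
            (\<lambda>j. fps_nth (szRF \<alpha> (j + i)) l * fps_nth (szG \<alpha> (j + i)) (m - l))"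
          using l by (auto intro: phase_class.mono)
      qed auto
      moreover have "2 ^ (m-1)\<^sup>2 + (\<Sum>l<m. 2 ^ (m-1)\<^sup>2) \<le> (2::real) ^ m\<^sup>2"
        using pow2_sq_step(1)[of m] Suc by (simp add: algebra_simps)
      ultimately show ?thesis unfolding eq by (rule phase_class.mono)
    qed
    have "phase_class d c (Suc m) (2 ^ m\<^sup>2) (\<lambda>j. fps_nth (szG \<alpha> (j + Suc i)) (Suc m))" if i: "m \<le> i" for i
    proof -
      have "fps_nth (szG \<alpha> (j + Suc i)) (Suc m) = ec (P (j + i)) * fps_nth (szRF \<alpha> (j + i)) m" for j
        using szG_rec(1)[of \<alpha> "j + i" "ec (P (j + i))", OF \<alpha>1 P(2)] by (simp add: mult.assoc)
      moreover have "phase_class d c (1 + m) (1 * 2 ^ m\<^sup>2) (\<lambda>j. ec (P (j + i)) * fps_nth (szRF \<alpha> (j + i)) m)"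
        using const_diff_shift[OF P(1), of i] by (intro phase_class_mult R i phase_class.phase) simp
      ultimately show ?thesis by simp
    qed
    with R show ?case by blast
  qed
  then show "phase_class d c m (2 ^ m\<^sup>2) (\<lambda>j. fps_nth (szRF \<alpha> (j + i)) m)"
    "phase_class d c (Suc m) (2 ^ m\<^sup>2) (\<lambda>j. fps_nth (szG \<alpha> (j + Suc i)) (Suc m))"
    using \<open>m \<le> i\<close> by auto
qed

text \<open>The same induction for the logarithmic derivative. Differentiation brings in a factor
  \<open>Suc m\<close>, absorbed by the second part of \<open>pow2_sq_step\<close>; the division by
  \<open>m\<close> that leads back to \<open>szL\<close> only lowers the weight.\<close>

lemma szL_phase_class:
  assumes \<alpha>: "\<And>i. norm (\<alpha> i) = \<kappa>" "\<kappa> < 1"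
    and P: "const_diff d c P" "\<And>j. \<alpha> (Suc j) = \<alpha> j * ec (P j)"
    and m: "1 \<le> m"
  shows "phase_class d c m (2 ^ m\<^sup>2) (\<lambda>j. fps_nth (szL \<alpha> (j + m)) m)"
proof -
  have \<alpha>1: "norm (\<alpha> i) < 1" for i using \<alpha> by simp
  have eq: "fps_nth (fps_deriv (szL \<alpha> n)) m = - (of_nat (Suc m) * fps_nth (szG \<alpha> n) (Suc m))
      + (\<Sum>l<m. fps_nth (fps_deriv (szL \<alpha> n)) l * fps_nth (szG \<alpha> n) (m - l))" for n m
  proof -
    have "fps_nth (fps_deriv (szL \<alpha> n) * (1 - szG \<alpha> n)) m = - (of_nat (Suc m) * fps_nth (szG \<alpha> n) (Suc m))"
      unfolding szG_rec(3)[OF \<alpha>1] by simp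
    moreover have "fps_nth (fps_deriv (szL \<alpha> n) * (1 - szG \<alpha> n)) m
        = fps_nth (fps_deriv (szL \<alpha> n)) m - fps_nth (fps_deriv (szL \<alpha> n) * szG \<alpha> n) m"
      by (simp add: algebra_simps)
    moreover have "fps_nth (fps_deriv (szL \<alpha> n) * szG \<alpha> n) m
        = (\<Sum>l<m. fps_nth (fps_deriv (szL \<alpha> n)) l * fps_nth (szG \<alpha> n) (m - l))"
      unfolding fps_mult_nth by (simp add: atLeast0AtMost lessThan_Suc_atMost[symmetric] szG_nth_0[OF \<alpha>1])
    ultimately show ?thesis by (simp add: algebra_simps)
  qed
  have main: "\<forall>i\<ge>Suc m. phase_class d c (Suc m) (2 ^ (Suc m)\<^sup>2) (\<lambda>j. fps_nth (fps_deriv (szL \<alpha> (j + i))) m)" for m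
  proof (induction m rule: less_induct)
    case (less m)
    show ?case
    proof (intro allI impI)
      fix i assume i: "Suc m \<le> i"
      have Gc: "phase_class d c l (2 ^ (l - 1)\<^sup>2) (\<lambda>j. fps_nth (szG \<alpha> (j + i)) l)"
        if "1 \<le> l" "l \<le> Suc m" for l
        using szRF_phase_class(2)[OF \<alpha> P, of "l - 1" "i - 1"] that i by simp
      have "phase_class d c (Suc m) (real (Suc m) * 2 ^ m\<^sup>2 + (\<Sum>l<m. 2 ^ m\<^sup>2))
          (\<lambda>j. (- of_nat (Suc m)) * fps_nth (szG \<alpha> (j + i)) (Suc m)
             + (\<Sum>l<m. fps_nth (fps_deriv (szL \<alpha> (j + i))) l * fps_nth (szG \<alpha> (j + i)) (m - l)))"
      proof (intro phase_class.add phase_class_sum)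
        show "phase_class d c (Suc m) (real (Suc m) * 2 ^ m\<^sup>2) (\<lambda>j. (- of_nat (Suc m)) * fps_nth (szG \<alpha> (j + i)) (Suc m))"
          using Gc[of "Suc m"] by (intro phase_class_cmult) (auto simp del: of_nat_Suc)
      next
        fix l assume l: "l \<in> {..<m}"
        have "phase_class d c (Suc l + (m - l)) (2 ^ (Suc l)\<^sup>2 * 2 ^ (m - l - 1)\<^sup>2)
            (\<lambda>j. fps_nth (fps_deriv (szL \<alpha> (j + i))) l * fps_nth (szG \<alpha> (j + i)) (m - l))"
          using less.IH[of l] l i by (intro phase_class_mult Gc) auto
        moreover have "(2::real) ^ (Suc l)\<^sup>2 * 2 ^ (m - l - 1)\<^sup>2 \<le> 2 ^ m\<^sup>2"
          using l by (intro pow2_sq_add) auto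
        ultimately show "phase_class d c (Suc m) (2 ^ m\<^sup>2)
            (\<lambda>j. fps_nth (fps_deriv (szL \<alpha> (j + i))) l * fps_nth (szG \<alpha> (j + i)) (m - l))"
          using l by (auto intro: phase_class.mono)
      qed auto
      moreover have "real (Suc m) * 2 ^ m\<^sup>2 + (\<Sum>l<m. 2 ^ m\<^sup>2) \<le> (2::real) ^ (Suc m)\<^sup>2"
        using pow2_sq_step(2)[of m] by (simp add: algebra_simps)
      ultimately show "phase_class d c (Suc m) (2 ^ (Suc m)\<^sup>2) (\<lambda>j. fps_nth (fps_deriv (szL \<alpha> (j + i))) m)"
        unfolding eq[of _ m] minus_mult_left by (rule phase_class.mono)
    qed
  qed
  obtain m' where m': "m = Suc m'" using m by (cases m) auto
  have "fps_nth (szL \<alpha> n) m = (1 / of_nat m) * fps_nth (fps_deriv (szL \<alpha> n)) m'" for n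
    using m' by (simp del: of_nat_Suc)
  moreover have "phase_class d c m (2 ^ m\<^sup>2) (\<lambda>j. (1 / of_nat m) * fps_nth (fps_deriv (szL \<alpha> (j + m))) m')"
  proof (rule phase_class_cmult)
    show "phase_class d c m (2 ^ m\<^sup>2) (\<lambda>j. fps_nth (fps_deriv (szL \<alpha> (j + m))) m')"
      using main[of m'] m' by blast
    have "norm (1 / complex_of_nat m) \<le> 1" using m by (simp add: norm_divide)
    then show "norm (1 / complex_of_nat m) * 2 ^ m\<^sup>2 \<le> 2 ^ m\<^sup>2"
      by (intro mult_left_le_one_le) auto
  qed
  ultimately show ?thesis by simp
qed

text \<open>Cauchy's estimate on the unit circle. The modulus of \<open>1 - szg\<close> lies between
  \<open>1 - \<kappa>\<close> and 2, so the real part of its logarithm is at most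
  \<open>1 - ln (1 - \<kappa>)\<close> in modulus, and the imaginary part is at most
  \<open>pi < 4\<close>; hence the 5.\<close>

lemma norm_szL_nth_le:
  assumes \<alpha>: "\<And>i. norm (\<alpha> i) = \<kappa>" "\<kappa> < 1"
  shows "norm (fps_nth (szL \<alpha> n) m) \<le> 5 - ln (1 - \<kappa>)"
proof -
  have \<alpha>1: "norm (\<alpha> i) < 1" for i using \<alpha> by simp
  let ?f = "\<lambda>z. Ln (1 - szg \<alpha> n z)"
  have bound: "norm (?f z) \<le> 5 - ln (1 - \<kappa>)" if z: "norm z \<le> 1" for z
  proof -
    let ?w = "1 - szg \<alpha> n z"
    have g: "norm (szg \<alpha> n z) \<le> \<kappa>" using norm_szg_le[of \<alpha> z n, OF \<alpha>1 z] \<alpha> by simp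
    have w0: "?w \<noteq> 0" by (rule one_minus_szg_nonzero[of \<alpha> z n, OF \<alpha>1 z])
    have lo: "1 - \<kappa> \<le> norm ?w" using g norm_triangle_ineq2[of 1 "szg \<alpha> n z"] by simp
    have hi: "norm ?w \<le> 2" using g norm_triangle_ineq4[of 1 "szg \<alpha> n z"] \<alpha>(2) by simp
    have "ln (1 - \<kappa>) \<le> ln (norm ?w)" using lo \<alpha>(2) w0 by (subst ln_le_cancel_iff) auto
    moreover have "ln (norm ?w) \<le> 1"
      using ln_le_minus_one[of "norm ?w"] w0 hi by simp
    moreover have "ln (1 - \<kappa>) \<le> 0" using \<alpha>(2) norm_ge_zero[of "\<alpha> 0"] \<alpha>(1)[of 0] by simp
    ultimately have re: "\<bar>Re (Ln ?w)\<bar> \<le> 1 - ln (1 - \<kappa>)" using w0 by (simp add: Re_Ln)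
    have im: "\<bar>Im (Ln ?w)\<bar> \<le> pi" using mpi_less_Im_Ln[OF w0] Im_Ln_le_pi[OF w0] by simp
    have "norm (Ln ?w) \<le> \<bar>Re (Ln ?w)\<bar> + \<bar>Im (Ln ?w)\<bar>" by (rule cmod_le)
    then show ?thesis using re im pi_less_4 by linarith
  qed
  have hol: "?f holomorphic_on cball 0 1" by (rule holomorphic_Ln_szg[OF \<alpha>1]) auto
  have "norm ((deriv ^^ m) ?f 0) \<le> fact m * (5 - ln (1 - \<kappa>)) / 1 ^ m"
    by (rule Cauchy_inequality[of _ _ 1])
       (use hol bound in \<open>auto intro: holomorphic_on_subset holomorphic_on_imp_continuous_on\<close>)
  then show ?thesis by (simp add: szL_def fps_expansion_def norm_divide field_simps)
qed

lemma sum_lessThan_add: "(\<Sum>j<m + k. f j) = (\<Sum>j<m. f j) + (\<Sum>j<k. f (j + m))"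
  for f :: "nat \<Rightarrow> complex"
  by (induction k) (simp_all add: add.commute add.left_commute)

text \<open>The logarithm of \<open>szp\<close> is expanded in powers of \<open>z\<close>.
  Coefficients up to order \<open>M\<close> are sums over time of \<open>phase_class\<close>
  sequences and are small by \<open>W\<close>; beyond \<open>M\<close> only Cauchy's estimate is
  used, and the factor \<open>r ^ M\<close> makes up for it.\<close>

lemma norm_szp_growth:
  assumes \<alpha>: "\<And>i. norm (\<alpha> i) = \<kappa>" "\<kappa> < 1"
    and P: "const_diff d c P" "\<And>j. \<alpha> (Suc j) = \<alpha> j * ec (P j)"
    and r: "norm z \<le> r" "r < 1" and "M \<le> N" "0 \<le> B"
    and W: "\<And>m P'. 1 \<le> m \<Longrightarrow> m \<le> M \<Longrightarrow> const_diff d (real m * c) P' \<Longrightarrow>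
        norm (\<Sum>j<N - m. ec (P' j)) \<le> B"
    and C: "C = 5 - ln (1 - \<kappa>)"
  shows "norm (szp \<alpha> N z) \<le> exp (real M * (real M * C + 2 ^ M\<^sup>2 * B) + real N * C * (r ^ M / (1 - r)))"
proof -
  have \<alpha>1: "norm (\<alpha> i) < 1" for i using \<alpha> by simp
  have r0: "0 \<le> r" using r(1) norm_ge_zero order_trans by blast
  have C0: "0 \<le> C" using order_trans[OF norm_ge_zero norm_szL_nth_le[OF \<alpha>]] C by simp
  define a where "a m = (\<Sum>j<N. fps_nth (szL \<alpha> j) m)" for m
  have "(\<lambda>m. \<Sum>j<N. fps_nth (szL \<alpha> j) m * z ^ m) sums (\<Sum>j<N. Ln (1 - szg \<alpha> j z))"
  proof (intro sums_sum)
    fix j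
    have "(\<lambda>z. Ln (1 - szg \<alpha> j z)) holomorphic_on ball 0 1"
      by (rule holomorphic_Ln_szg[OF \<alpha>1]) auto
    then show "(\<lambda>m. fps_nth (szL \<alpha> j) m * z ^ m) sums Ln (1 - szg \<alpha> j z)"
      using r by (intro has_fps_expansion_imp_sums_complex[where r = "ereal 1", OF szego_expansions(3)[of \<alpha> j, OF \<alpha>1]]) auto
  qed
  then have sums: "(\<lambda>m. a m * z ^ m) sums (\<Sum>j<N. Ln (1 - szg \<alpha> j z))"
    by (simp add: a_def sum_distrib_right)
  have trivial: "norm (\<Sum>j<n. fps_nth (szL \<alpha> j) m) \<le> real n * C" for n m
    using norm_szL_nth_le[OF \<alpha>] sum_norm_bound[of "{..<n}" "\<lambda>j. fps_nth (szL \<alpha> j) m" C] C by simp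
  \<comment> \<open>The first \<open>m\<close> times are not covered by
    \<open>szL_phase_class\<close>; bounding them trivially gives the term
    \<open>real M * C\<close>.\<close>
  have small: "norm (a m) \<le> real M * C + 2 ^ M\<^sup>2 * B" if m: "1 \<le> m" "m \<le> M" for m
  proof -
    obtain k where k: "N = m + k" using m \<open>M \<le> N\<close> by (metis le_Suc_ex order_trans)
    have "norm (\<Sum>j<k. fps_nth (szL \<alpha> (j + m)) m) \<le> 2 ^ m\<^sup>2 * B"
      using W[OF m] k \<open>0 \<le> B\<close>
      by (intro phase_class_bound[OF szL_phase_class[OF \<alpha> P m(1)]]) auto
    also have "\<dots> \<le> 2 ^ M\<^sup>2 * B" using m \<open>0 \<le> B\<close> by (intro mult_right_mono power_increasing power_mono) auto
    finally have 1: "norm (\<Sum>j<k. fps_nth (szL \<alpha> (j + m)) m) \<le> 2 ^ M\<^sup>2 * B" .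
    have "norm (\<Sum>j<m. fps_nth (szL \<alpha> j) m) \<le> real m * C" by (rule trivial)
    also have "\<dots> \<le> real M * C" using m C0 by (intro mult_right_mono) auto
    finally have 2: "norm (\<Sum>j<m. fps_nth (szL \<alpha> j) m) \<le> real M * C" .
    show ?thesis unfolding a_def k sum_lessThan_add using 1 2 norm_triangle_le add_mono by blast
  qed
  have pr: "norm z ^ n \<le> r ^ n" for n using r by (intro power_mono) auto
  have head: "norm (\<Sum>m<Suc M. a m * z ^ m) \<le> real M * (real M * C + 2 ^ M\<^sup>2 * B)"
  proof -
    have "a 0 = 0" by (simp add: a_def szL_nth_0[OF \<alpha>1])
    then have "(\<Sum>m<Suc M. a m * z ^ m) = (\<Sum>m\<in>{1..M}. a m * z ^ m)"
      by (intro sum.mono_neutral_right) (auto simp: not_le)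
    also have "norm \<dots> \<le> (\<Sum>m\<in>{1..M}. real M * C + 2 ^ M\<^sup>2 * B)"
    proof (intro order_trans[OF norm_sum] sum_mono)
      fix m assume m: "m \<in> {1..M}"
      have "norm z ^ m \<le> 1" using r by (intro power_le_one) auto
      then have "norm (a m) * norm z ^ m \<le> norm (a m) * 1" by (intro mult_left_mono) auto
      then show "norm (a m * z ^ m) \<le> real M * C + 2 ^ M\<^sup>2 * B"
        using small[of m] m by (simp add: norm_mult norm_power)
    qed
    finally show ?thesis by simp
  qed
  have tail_term: "norm (a (m + Suc M) * z ^ (m + Suc M)) \<le> real N * C * r ^ M * r ^ m" for m
  proof -
    have "norm z ^ (m + Suc M) \<le> r ^ (m + Suc M)" by (rule pr)
    also have "\<dots> \<le> r ^ (m + M)" using r0 r by (intro power_decreasing) auto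
    finally have "norm (a (m + Suc M)) * norm z ^ (m + Suc M) \<le> (real N * C) * r ^ (m + M)"
      using trivial[where n = N and m = "m + Suc M"] by (intro mult_mono) (auto simp: a_def C0)
    then show ?thesis by (simp add: norm_mult norm_power power_add mult_ac)
  qed
  have geo: "(\<lambda>m. real N * C * r ^ M * r ^ m) sums (real N * C * r ^ M * (1 / (1 - r)))"
    using r r0 by (intro sums_mult geometric_sums) auto
  have "norm (\<Sum>m. a (m + Suc M) * z ^ (m + Suc M)) \<le> (\<Sum>m. real N * C * r ^ M * r ^ m)"
    by (rule norm_suminf_le[OF tail_term sums_summable[OF geo]])
  then have tail: "norm (\<Sum>m. a (m + Suc M) * z ^ (m + Suc M)) \<le> real N * C * (r ^ M / (1 - r))"
    using sums_unique[OF geo] by simp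
  have split: "(\<Sum>j<N. Ln (1 - szg \<alpha> j z)) = (\<Sum>m. a (m + Suc M) * z ^ (m + Suc M)) + (\<Sum>m<Suc M. a m * z ^ m)"
    using suminf_split_initial_segment[OF sums_summable[OF sums], of "Suc M"] sums_unique[OF sums] by simp
  then have le: "norm (\<Sum>j<N. Ln (1 - szg \<alpha> j z))
      \<le> real M * (real M * C + 2 ^ M\<^sup>2 * B) + real N * C * (r ^ M / (1 - r))"
  proof -
    have "norm (\<Sum>j<N. Ln (1 - szg \<alpha> j z)) \<le> norm (\<Sum>m. a (m + Suc M) * z ^ (m + Suc M)) + norm (\<Sum>m<Suc M. a m * z ^ m)"
      unfolding split by (rule norm_triangle_ineq)
    also have "\<dots> \<le> real N * C * (r ^ M / (1 - r)) + real M * (real M * C + 2 ^ M\<^sup>2 * B)"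
      by (rule add_mono[OF tail head])
    finally show ?thesis by (simp only: add.commute)
  qed
  have z1: "norm z \<le> 1" using r by simp
  have "szp \<alpha> N z = (\<Prod>j<N. 1 - szg \<alpha> j z)" by (rule szp_eq_prod[of \<alpha>, OF \<alpha>1 z1])
  also have "\<dots> = exp (\<Sum>j<N. Ln (1 - szg \<alpha> j z))"
    using one_minus_szg_nonzero[of \<alpha> z, OF \<alpha>1 z1] by (simp add: exp_sum)
  finally have "norm (szp \<alpha> N z) = exp (Re (\<Sum>j<N. Ln (1 - szg \<alpha> j z)))" by (simp only: norm_exp_eq_Re)
  also have "\<dots> \<le> exp (norm (\<Sum>j<N. Ln (1 - szg \<alpha> j z)))" by (simp only: exp_le_cancel_iff complex_Re_le_cmod)
  also have "\<dots> \<le> exp (real M * (real M * C + 2 ^ M\<^sup>2 * B) + real N * C * (r ^ M / (1 - r)))"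
    using le by simp
  finally show ?thesis .
qed

text \<open>A Bernstein--Walsh argument: \<open>szs\<close> is a polynomial with the modulus of
  \<open>szp\<close> on the circle, and by reflection its values on the circle of radius
  \<open>1 / r\<close> are those of \<open>szp\<close> at radius \<open>r\<close>, divided by
  \<open>r ^ N\<close>. The maximum principle for \<open>szs\<close> does the rest.\<close>

lemma norm_szp_circle_le:
  assumes "0 < r" "r < 1" "norm z = 1" and K: "\<And>w. norm w \<le> r \<Longrightarrow> norm (szp \<alpha> N w) \<le> K"
  shows "norm (szp \<alpha> N z) \<le> K / r ^ N"
proof -
  have "norm (szs \<alpha> N z) \<le> K / r ^ N"
  proof (rule maximum_modulus_frontier[of "szs \<alpha> N" "cball 0 (1 / r)"])
    fix w :: complex assume "w \<in> frontier (cball 0 (1 / r))"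
    then have w: "norm w = 1 / r" by (simp add: frontier_cball dist_norm)
    then have w0: "w \<noteq> 0" using assms by auto
    have "norm (szp \<alpha> N (inverse (cnj w))) \<le> K"
      using w by (intro K) (simp add: norm_inverse)
    then have "(1 / r) ^ N * norm (szp \<alpha> N (inverse (cnj w))) \<le> (1 / r) ^ N * K"
      using assms by (intro mult_left_mono) auto
    then show "norm (szs \<alpha> N w) \<le> K / r ^ N"
      unfolding szs_szr_eq(1)[OF w0] by (simp add: norm_mult norm_power w power_divide)
  qed (use assms in \<open>auto intro!: szego_holomorphic holomorphic_on_imp_continuous_on simp: divide_simps\<close>)
  then show ?thesis unfolding szs_szr_circle(1)[OF assms(3)] using assms(3) by (simp add: norm_mult norm_power)
qed

text \<open>The mean value property of a harmonic function: \<open>szp\<close> is free of zeros in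
  the closed disc and equals 1 at the origin.\<close>

lemma mean_ln_norm_szp:
  assumes "\<And>i. norm (\<alpha> i) < 1"
  shows "((\<lambda>t. ln (norm (szp \<alpha> n (ec t)))) has_integral 0) {0..1}"
proof -
  have hol: "(\<lambda>z. \<Sum>j<n. Ln (1 - szg \<alpha> j z)) holomorphic_on cball 0 1"
    by (intro holomorphic_intros holomorphic_Ln_szg assms order_refl)
  have "((\<lambda>t. \<Sum>j<n. Ln (1 - szg \<alpha> j (ec t))) has_integral (\<Sum>j<n. Ln (1 - szg \<alpha> j 0))) {0..1}"
    using hol by (intro circle_mean_value[of "\<lambda>z. \<Sum>j<n. Ln (1 - szg \<alpha> j z)"])
       (auto intro: holomorphic_on_subset holomorphic_on_imp_continuous_on)
  from has_integral_Re[OF this] have "((\<lambda>t. Re (\<Sum>j<n. Ln (1 - szg \<alpha> j (ec t)))) has_integral 0) {0..1}"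
    by simp
  moreover have "Re (\<Sum>j<n. Ln (1 - szg \<alpha> j z)) = ln (norm (szp \<alpha> n z))" if z: "norm z \<le> 1" for z
  proof -
    have nz: "1 - szg \<alpha> j z \<noteq> 0" for j by (rule one_minus_szg_nonzero[of \<alpha> z, OF assms z])
    have "szp \<alpha> n z = (\<Prod>j<n. 1 - szg \<alpha> j z)" by (rule szp_eq_prod[of \<alpha>, OF assms z])
    also have "\<dots> = exp (\<Sum>j<n. Ln (1 - szg \<alpha> j z))" using nz by (simp add: exp_sum)
    finally have "norm (szp \<alpha> n z) = exp (Re (\<Sum>j<n. Ln (1 - szg \<alpha> j z)))" by (simp only: norm_exp_eq_Re)
    then show ?thesis by simp
  qed
  ultimately show ?thesis by simp
qed

section \<open>Growth of the transfer matrices off a small set\<close>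

lemma measure_ge_le_integral:
  fixes f :: "real \<Rightarrow> real"
  assumes f: "continuous_on {0..1} f" "\<And>t. t \<in> {0..1} \<Longrightarrow> 0 \<le> f t" "(f has_integral I) {0..1}" and c: "c > 0"
  shows "measure lebesgue {t \<in> {0..1}. c \<le> f t} \<le> I / c"
proof -
  let ?S = "{t \<in> {0..1}. c \<le> f t}"
  have "closed ?S" by (intro continuous_on_closed_Collect_le f) auto
  moreover have "bounded ?S" by (rule bounded_subset[of "{0..1}"]) auto
  ultimately have S: "?S \<in> lmeasurable" by (simp add: compact_eq_bounded_closed lmeasurable_compact)
  have "(indicat_real ?S has_integral (measure lebesgue ?S)) UNIV"
    using S by (simp only: lmeasurable_iff_has_integral)
  moreover have "(\<lambda>t. if t \<in> {0..1} then indicat_real ?S t else 0) = indicat_real ?S"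
    by (auto simp: indicator_def)
  ultimately have "(indicat_real ?S has_integral (measure lebesgue ?S)) {0..1}"
    using has_integral_restrict_UNIV[of "{0..1}" "indicat_real ?S"] by simp
  then have "((\<lambda>t. c * indicat_real ?S t) has_integral (c * measure lebesgue ?S)) {0..1}"
    by (rule has_integral_mult_right)
  then have "c * measure lebesgue ?S \<le> I"
    by (rule has_integral_le[OF _ f(3)]) (use f(2) in \<open>auto simp: indicator_def\<close>)
  then show ?thesis using c by (simp add: field_simps)
qed

lemma ldt_asymp:
  "eventually (\<lambda>x::real. ln x powr (1/3) \<ge> 5) at_top"
  "e > 0 \<Longrightarrow> eventually (\<lambda>x::real. x powr e \<ge> 2) at_top"
  "F > 0 \<Longrightarrow> eventually (\<lambda>x::real. sqrt x * ln x * F \<le> x / 2) at_top"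
  "eventually (\<lambda>x::real. ln x \<le> x ^ 4 / 2) at_top" "eventually (\<lambda>x::real. 2 * x * sqrt x \<le> x ^ 4 / 2) at_top"
  "eventually (\<lambda>x::real. x \<le> x ^ 4 / 2) at_top"
  "\<sigma> > 0 \<Longrightarrow> D > 0 \<Longrightarrow> eventually (\<lambda>x::real. ln x * exp (ln 2 * ln x powr (2/3)) * D * x powr (-\<sigma>) \<le> ln x powr (-1/6)) at_top"
  "C > 0 \<Longrightarrow> eventually (\<lambda>x::real. ln x * ln x * C / x ^ 4 \<le> ln x powr (-1/6)) at_top"
  by real_asymp+

text \<open>Weyl's inequality asks for a length above \<open>q * sqrt q\<close> and for multipliers
  below \<open>q\<close>. The length \<open>N = q ^ 4\<close> and a small power of \<open>q\<close>
  for \<open>H\<close> provide both.\<close>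

lemma norm_szp_circle_le_exp:
  fixes k :: nat and \<omega> :: real and l :: complex
  assumes k: "k \<ge> 2" and l: "norm l < 1" "0 < norm l"
  defines "\<alpha> \<equiv> \<lambda>n. l * ec (\<omega> * real n ^ k)"
  shows "\<exists>C > 0. \<exists>q0. \<forall>q\<ge>q0. \<forall>p::int. coprime p (int q) \<longrightarrow> \<bar>\<omega> - of_int p / real q\<bar> \<le> 1 / (real q)\<^sup>2 \<longrightarrow>
     (\<forall>z. norm z = 1 \<longrightarrow> norm (szp \<alpha> (q ^ 4) z) \<le> exp (C * ln (real q) powr (-1/6) * real (q ^ 4)))"
proof -
  define \<kappa> where "\<kappa> = norm l"
  have \<alpha>: "\<And>i. norm (\<alpha> i) = \<kappa>" "\<kappa> < 1" using l by (auto simp: \<alpha>_def \<kappa>_def norm_mult)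
  \<comment> \<open>The ratio of consecutive coefficients is the exponential of the first difference
    of the phase, so \<open>k = d + 2\<close> leads to Weyl sums of order
    \<open>Suc d\<close>.\<close>
  define P where "P j = \<omega> * real (Suc j) ^ k - \<omega> * real j ^ k" for j
  define c where "c = \<omega> * fact k"
  have "const_diff k c (\<lambda>j. \<omega> * real j ^ k)"
    unfolding c_def by (rule const_diff_cmult[OF const_diff_power])
  moreover obtain d where d: "k = Suc (Suc d)" using k by (metis add_2_eq_Suc le_Suc_ex)
  ultimately have P: "const_diff (Suc d) c P" unfolding P_def by simp
  have P2: "\<alpha> (Suc j) = \<alpha> j * ec (P j)" for j
    unfolding \<alpha>_def P_def mult.assoc cis_mult by (simp add: algebra_simps)
  define C0 where "C0 = 5 - ln (1 - \<kappa>)"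
  have C0: "0 \<le> C0" using order_trans[OF norm_ge_zero norm_szL_nth_le[OF \<alpha>]] by (simp add: C0_def)
  define s where "s = 1 / 2 ^ d * (1::real)"
  \<comment> \<open>Chosen so that \<open>e * d \<le> 1 / 2\<close>: then
    \<open>H ^ d \<le> sqrt x\<close>, and the factor \<open>m * fact k\<close> still leaves the
    multiplier below \<open>x / 2\<close>.\<close>
  define e where "e = 1 / (2 * real k)"
  define D where "D = 3 * 2 powr s"
  have pos: "s > 0" "e > 0" "D > 0" "e \<le> 1/4" using k by (auto simp: s_def e_def D_def divide_simps)
  define C where "C = 2 + C0 + 12 * (C0 + 1)"
  have "C > 0" using C0 by (simp add: C_def)
  have "eventually (\<lambda>x::real. x \<ge> exp 1 \<and> ln x powr (1/3) \<ge> 5 \<and> x powr e \<ge> 2 \<and> sqrt x * ln x * fact k \<le> x / 2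
    \<and> ln x \<le> x ^ 4 / 2 \<and> 2 * x * sqrt x \<le> x ^ 4 / 2 \<and> x \<le> x ^ 4 / 2
    \<and> ln x * exp (ln 2 * ln x powr (2/3)) * D * x powr (-(e * s)) \<le> ln x powr (-1/6)
    \<and> ln x * ln x * (C0 + 1) / x ^ 4 \<le> ln x powr (-1/6)) at_top"
    using pos C0 by (intro eventually_conj ldt_asymp eventually_ge_at_top) auto
  then obtain x0 :: real where x0: "\<And>x. x \<ge> x0 \<Longrightarrow> x \<ge> exp 1 \<and> ln x powr (1/3) \<ge> 5 \<and> x powr e \<ge> 2 \<and> sqrt x * ln x * fact k \<le> x / 2
    \<and> ln x \<le> x ^ 4 / 2 \<and> 2 * x * sqrt x \<le> x ^ 4 / 2 \<and> x \<le> x ^ 4 / 2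
    \<and> ln x * exp (ln 2 * ln x powr (2/3)) * D * x powr (-(e * s)) \<le> ln x powr (-1/6)
    \<and> ln x * ln x * (C0 + 1) / x ^ 4 \<le> ln x powr (-1/6)"
    unfolding eventually_at_top_linorder by blast
  show ?thesis
  proof (intro exI[of _ C] conjI exI[of _ "nat \<lceil>x0\<rceil>"] allI impI)
    fix q :: nat and p :: int and z :: complex
    assume q: "nat \<lceil>x0\<rceil> \<le> q" and cop: "coprime p (int q)" and app: "\<bar>\<omega> - of_int p / real q\<bar> \<le> 1 / (real q)\<^sup>2"
      and z: "norm z = 1"
    define x where "x = real q"
    have "x \<ge> x0" using q unfolding x_def by linarith
    note X = x0[OF this]
    define y where "y = ln x"
    have x1: "x \<ge> exp 1" using X by blast
    have xpos: "x > 0" using x1 by (meson exp_gt_zero less_le_trans)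
    have "exp 1 \<ge> (2::real)" using exp_ge_add_one_self[of 1] by simp
    then have x2: "x \<ge> 2" using x1 by linarith
    have y1: "y \<ge> 1" using x1 xpos unfolding y_def by (metis ln_exp ln_le_cancel_iff exp_gt_zero)
    \<comment> \<open>The cut-off is tied to the crude weights:
      \<open>2 ^ M\<^sup>2 \<le> exp (ln 2 * y powr (2/3))\<close>, which the saving
      \<open>x powr (- (e * s))\<close> beats.\<close>
    define M where "M = nat \<lfloor>y powr (1/3)\<rfloor>"
    define H where "H = nat \<lfloor>x powr e\<rfloor>"
    define N where "N = q ^ 4"
    have Nx: "real N = x ^ 4" by (simp add: N_def x_def)
    have y3: "y powr (1/3) \<ge> 5" using X by (simp add: y_def)
    have Mle: "real M \<le> y powr (1/3)" and Mge: "real M \<ge> y powr (1/3) / 2" and M4: "real M \<ge> 4"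
      using y3 unfolding M_def by linarith+
    have xe: "x powr e \<ge> 2" using X by blast
    have Hle: "real H \<le> x powr e" and Hge: "real H \<ge> x powr e / 2" and H1: "H \<ge> 1"
      using xe unfolding H_def by linarith+
    have My: "real M \<le> y"
      using Mle powr_mono[of "1/3" 1 y] y1 by simp
    have Hq: "real H \<le> sqrt x"
    proof -
      have "x powr e \<le> x powr (1/2)" using pos(4) x2 by (intro powr_mono) auto
      then show ?thesis using Hle xpos by (simp add: powr_half_sqrt)
    qed
    have N2: "real M \<le> real N / 2" using My X by (simp add: Nx y_def)
    have MN: "M \<le> N" using N2 by simp
    define B where "B = real N * (3 * (1 / real H) powr s)"
    have W: "norm (\<Sum>j<N - m. ec (P' j)) \<le> B" if m: "1 \<le> m" "m \<le> M" and P': "const_diff (Suc d) (real m * c) P'" for m P'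
    proof -
      define n where "n = N - m"
      have nN: "real n \<ge> real N / 2" "n \<le> N" using m N2 by (auto simp: n_def of_nat_diff)
      have Npos: "real N > 0" using xpos by (simp add: Nx)
      have n0: "real n > 0" using nN Npos by linarith
      have "norm (\<Sum>j<n. ec (P' j)) \<le> real n * (3 * (1 / real H) powr (1 / 2 ^ d))"
      proof (rule weyl_sum_aux[where \<delta> = "1 / (2 * x)"])
        show "1 / (1 / (2 * x) * real n) \<le> 1 / real H"
        proof -
          have "2 * x * real H \<le> 2 * x * sqrt x" using Hq xpos by simp
          also have "\<dots> \<le> real n" using X nN by (simp add: Nx)
          finally show ?thesis using H1 xpos n0 by (simp add: field_simps)
        qed
        show "real H / real n \<le> 1 / real H"
        proof -
          have "real H * real H \<le> sqrt x * sqrt x" using Hq xpos by (intro mult_mono) auto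
          also have "\<dots> \<le> real n" using X nN xpos by (simp add: Nx)
          finally show ?thesis using H1 n0 by (simp add: field_simps)
        qed
        fix D i :: int assume D: "1 \<le> D" "D \<le> int H ^ d"
        define E where "E = D * int m * fact k"
        have E1: "1 \<le> E"
        proof -
          have "0 < D * int m * fact k" using D m by simp
          then show ?thesis unfolding E_def by linarith
        qed
        have "real_of_int E = of_int D * real m * fact k" by (simp add: E_def)
        also have "\<dots> \<le> real H ^ d * y * fact k"
        proof -
          have "real_of_int D \<le> real_of_int (int H ^ d)" using D(2) of_int_le_iff by blast
          moreover have "real m \<le> y" using m My by linarith
          ultimately show ?thesis using D m by (intro mult_mono) auto
        qed
        also have "\<dots> \<le> sqrt x * y * fact k"
        proof -
          have "real H ^ d \<le> (x powr e) ^ d" using Hle by (intro power_mono) auto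
          also have "\<dots> = x powr (e * real d)" using xpos by (simp add: powr_realpow[symmetric] powr_powr)
          also have "\<dots> \<le> x powr (1/2)" using x2 d by (intro powr_mono) (auto simp: e_def field_simps)
          finally show ?thesis using xpos y1 by (intro mult_right_mono) (auto simp: powr_half_sqrt)
        qed
        also have "\<dots> \<le> x / 2" using X by (simp add: y_def)
        finally have E2: "real_of_int E \<le> x / 2" .
        have Eq: "E < int q" using E2 xpos unfolding x_def by linarith
        \<comment> \<open>Since \<open>1 \<le> E < q\<close> and \<open>p\<close> is coprime to
          \<open>q\<close>, the number \<open>E * p / q\<close> is at distance at least
          \<open>1 / q\<close> from the integers. Replacing \<open>p / q\<close> by
          \<open>\<omega>\<close> moves it by at most half of that.\<close>
        have nd: "\<not> int q dvd E * p"
        proof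
          assume "int q dvd E * p"
          then have "int q dvd E" using cop by (simp add: coprime_commute coprime_dvd_mult_left_iff)
          then show False using E1 Eq zdvd_imp_le by force
        qed
        have "E * p - i * int q \<noteq> 0"
        proof
          assume "E * p - i * int q = 0"
          then have "E * p = int q * i" by (simp add: mult.commute)
          then show False using nd by simp
        qed
        then have "1 \<le> \<bar>E * p - i * int q\<bar>" by linarith
        then have "1 \<le> \<bar>real_of_int (E * p - i * int q)\<bar>" by (metis of_int_1_le_iff of_int_abs)
        then have "1 / x \<le> \<bar>real_of_int (E * p - i * int q)\<bar> / x" using xpos by (intro divide_right_mono) auto
        also have "\<dots> = \<bar>real_of_int (E * p - i * int q) / x\<bar>" using xpos by simp
        also have "real_of_int (E * p - i * int q) / x = of_int E * (of_int p / x) - of_int i"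
          using xpos by (simp add: x_def field_simps)
        finally have "1 / x \<le> \<bar>of_int E * (of_int p / x) - of_int i\<bar>" .
        moreover have "\<bar>of_int E * \<omega> - of_int E * (of_int p / x)\<bar> \<le> 1 / (2 * x)"
        proof -
          have "\<bar>of_int E * \<omega> - of_int E * (of_int p / x)\<bar> = of_int E * \<bar>\<omega> - of_int p / x\<bar>"
            using E1 by (simp only: right_diff_distrib[symmetric] abs_mult)
          also have "\<dots> \<le> (x / 2) * (1 / x\<^sup>2)"
            using app E2 E1 xpos by (intro mult_mono) (auto simp: x_def)
          also have "\<dots> = 1 / (2 * x)" using xpos by (simp add: power2_eq_square)
          finally show ?thesis .
        qed
        moreover have "1 / x = 1 / (2 * x) + 1 / (2 * x)" by simp
        ultimately have "1 / (2 * x) \<le> \<bar>of_int E * \<omega> - of_int i\<bar>" by linarith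
        moreover have "of_int D * (real m * c) = of_int E * \<omega>" by (simp add: E_def c_def)
        ultimately show "1 / (2 * x) \<le> \<bar>of_int D * (real m * c) - of_int i\<bar>" by simp
      qed (use H1 n0 xpos P' in auto)
      also have "\<dots> \<le> B" unfolding B_def s_def using nN by (intro mult_mono) auto
      finally show ?thesis by (simp add: n_def)
    qed
    \<comment> \<open>Two errors compete: the tail \<open>r ^ M / (1 - r)\<close> wants
      \<open>r\<close> away from 1, while the return to the circle costs \<open>ln (1 / r)\<close>
      per step. For this \<open>r\<close> both are of order at most
      \<open>1 / sqrt M\<close>.\<close>
    define r where "r = 1 - 1 / sqrt (real M)"
    have sM: "sqrt (real M) \<ge> 2" using M4 by (metis real_sqrt_four real_sqrt_le_iff)
    have r: "1 / 2 \<le> r" "r < 1" using sM M4 by (auto simp: r_def divide_le_eq)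
    have r1: "1 - r = 1 / sqrt (real M)" by (simp add: r_def)
    have rM: "r ^ M / (1 - r) \<le> 2 / sqrt (real M)"
    proof -
      have "r \<le> exp (- (1 / sqrt (real M)))" using exp_ge_add_one_self[of "- (1 / sqrt (real M))"] by (simp add: r_def)
      then have "r ^ M \<le> exp (- (1 / sqrt (real M))) ^ M" using r by (intro power_mono) auto
      also have "\<dots> = exp (- (real M / sqrt (real M)))" by (simp add: exp_of_nat_mult[symmetric])
      also have "real M / sqrt (real M) = sqrt (real M)" by (simp add: real_div_sqrt)
      also have "exp (- sqrt (real M)) \<le> 2 / real M"
      proof -
        have "1 + sqrt (real M) + (sqrt (real M))\<^sup>2 / 2 \<le> exp (sqrt (real M))"
          by (rule exp_lower_Taylor_quadratic) simp
        then have "real M / 2 \<le> exp (sqrt (real M))" using sM by simp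
        then show ?thesis using M4 by (simp add: exp_minus field_simps)
      qed
      finally have "r ^ M \<le> 2 / real M" .
      then have "r ^ M / (1 - r) \<le> (2 / real M) / (1 - r)" using r by (intro divide_right_mono) auto
      also have "\<dots> = 2 * (sqrt (real M) / real M)" by (simp add: r1)
      also have "sqrt (real M) / real M = 1 / sqrt (real M)" using M4 by (simp add: sqrt_divide_self_eq inverse_eq_divide)
      finally show ?thesis by simp
    qed
    have lnr: "ln (1 / r) \<le> 2 / sqrt (real M)"
    proof -
      have "ln (1 / r) \<le> 1 / r - 1" using r by (intro ln_le_minus_one) auto
      also have "\<dots> = (1 - r) / r" using r by (simp add: field_simps)
      also have "\<dots> \<le> (1 - r) / (1 / 2)" using r by (intro divide_left_mono) auto
      finally show ?thesis by (simp add: r1)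
    qed
    define Y where "Y = y powr (-1/6)"
    have sMY: "1 / sqrt (real M) \<le> 2 * Y"
    proof -
      have "sqrt (y powr (1/3) / 2) \<le> sqrt (real M)" using Mge by simp
      moreover have "sqrt (y powr (1/3) / 2) = y powr (1/6) / sqrt 2"
        using y1 by (simp add: real_sqrt_divide powr_half_sqrt[symmetric] powr_powr)
      moreover have "sqrt 2 \<le> (2::real)" by (rule real_le_lsqrt) auto
      then have "y powr (1/6) / 2 \<le> y powr (1/6) / sqrt 2" by (intro divide_left_mono) auto
      ultimately have "y powr (1/6) / 2 \<le> sqrt (real M)" by linarith
      moreover have "y powr (1/6) > 0" using y1 by simp
      ultimately have "1 / sqrt (real M) \<le> 1 / (y powr (1/6) / 2)" by (intro divide_left_mono mult_pos_pos) (use sM M4 in auto)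
      then show ?thesis by (simp add: Y_def powr_minus field_simps)
    qed
    have T1: "real M * (real M * C0) \<le> (1 * Y) * real N"
    proof -
      have "real M * (real M * C0) \<le> y * (y * (C0 + 1))" using My C0 y1 by (intro mult_mono) auto
      also have "\<dots> = y * y * (C0 + 1) / x ^ 4 * real N" using xpos by (simp add: Nx)
      also have "\<dots> \<le> Y * real N" using X by (intro mult_right_mono) (auto simp: y_def Y_def)
      finally show ?thesis by simp
    qed
    have T2: "real M * (2 ^ M\<^sup>2 * B) \<le> (1 * Y) * real N"
    proof -
      have "(2::real) ^ n = exp (ln 2 * real n)" for n by (simp add: exp_of_nat2_mult)
      then have "(2::real) ^ M\<^sup>2 = exp (ln 2 * real (M\<^sup>2))" .
      also have "\<dots> \<le> exp (ln 2 * y powr (2/3))"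
      proof -
        have "real (M\<^sup>2) \<le> (y powr (1/3))\<^sup>2" using Mle by (simp add: power_mono)
        also have "\<dots> = y powr (2/3)" using y1 by (simp add: power2_eq_square powr_add[symmetric])
        finally show ?thesis by simp
      qed
      finally have a: "(2::real) ^ M\<^sup>2 \<le> exp (ln 2 * y powr (2/3))" .
      have "(1 / real H) powr s \<le> (2 * x powr (- e)) powr s"
      proof (rule powr_mono2)
        have "1 / real H \<le> 1 / (x powr e / 2)" using Hge xpos H1 by (intro divide_left_mono mult_pos_pos) auto
        then show "1 / real H \<le> 2 * x powr (- e)" by (simp add: powr_minus field_simps)
      qed (use pos in auto)
      also have "\<dots> = 2 powr s * x powr (- (e * s))" using xpos by (simp add: powr_mult powr_powr)
      finally have "B \<le> real N * (3 * (2 powr s * x powr (- (e * s))))"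
        unfolding B_def by (intro mult_left_mono) auto
      then have b: "B \<le> real N * (D * x powr (- (e * s)))" by (simp add: D_def)
      have B0: "0 \<le> B" by (simp add: B_def)
      have "real M * (2 ^ M\<^sup>2 * B) \<le> y * (exp (ln 2 * y powr (2/3)) * (real N * (D * x powr (- (e * s)))))"
        using My a b B0 y1 pos by (intro mult_mono) auto
      also have "\<dots> = (y * exp (ln 2 * y powr (2/3)) * D * x powr (-(e * s))) * real N" by simp
      also have "\<dots> \<le> Y * real N" using X by (intro mult_right_mono) (auto simp: y_def Y_def)
      finally show ?thesis by simp
    qed
    have T3: "real N * C0 * (r ^ M / (1 - r)) \<le> (4 * C0 * Y) * real N"
    proof -
      have "r ^ M / (1 - r) \<le> 4 * Y" using rM sMY by simp
      then have "(real N * C0) * (r ^ M / (1 - r)) \<le> (real N * C0) * (4 * Y)" using C0 by (intro mult_left_mono) auto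
      then show ?thesis by (simp add: mult_ac)
    qed
    let ?K = "exp (real M * (real M * C0 + 2 ^ M\<^sup>2 * B) + real N * C0 * (r ^ M / (1 - r)))"
    have "norm (szp \<alpha> N z) \<le> ?K / r ^ N"
    proof (rule norm_szp_circle_le)
      fix w :: complex assume "norm w \<le> r"
      then show "norm (szp \<alpha> N w) \<le> ?K"
        using r MN W by (intro norm_szp_growth[OF \<alpha> P P2]) (auto simp: C0_def B_def)
    qed (use r z in auto)
    also have "?K / r ^ N = exp (real M * (real M * C0 + 2 ^ M\<^sup>2 * B) + real N * C0 * (r ^ M / (1 - r)) + real N * ln (1 / r))"
    proof -
      have "1 / r ^ N = exp (real N * ln (1 / r))" using r by (simp add: exp_of_nat_mult power_divide)
      then show ?thesis by (simp add: exp_add divide_inverse)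
    qed
    also have "\<dots> \<le> exp (C * ln (real q) powr (-1/6) * real (q ^ 4))"
    proof -
      have "ln (1 / r) \<le> 4 * Y" using lnr sMY by simp
      then have "real N * ln (1 / r) \<le> real N * (4 * Y)" by (intro mult_left_mono) auto
      then have "real M * (real M * C0 + 2 ^ M\<^sup>2 * B) + real N * C0 * (r ^ M / (1 - r)) + real N * ln (1 / r)
        \<le> (1 * Y) * real N + (1 * Y) * real N + (4 * C0 * Y) * real N + (4 * Y) * real N"
        using T1 T2 T3 by (simp add: algebra_simps)
      \<comment> \<open>The losses stem from the early times, the Weyl sums, the Taylor tail and the
        return to the circle.\<close>
      also have "\<dots> = (2 + 4 * C0 + 4) * (Y * real N)" by (simp add: algebra_simps)
      also have "\<dots> \<le> C * (Y * real N)"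
        using C0 by (intro mult_right_mono) (auto simp: C_def Y_def)
      finally show ?thesis by (simp add: Y_def y_def x_def N_def mult.assoc)
    qed
    finally show "norm (szp \<alpha> (q ^ 4) z) \<le> exp (C * ln (real q) powr (-1/6) * real (q ^ 4))"
      by (simp add: N_def)
  qed (use \<open>C > 0\<close> in auto)
qed

text \<open>The gap \<open>f\<close> between the uniform upper bound and
  \<open>ln (norm (szp \<alpha> N z))\<close> is nonnegative, and its integral is that upper bound
  because the logarithm has mean 0. Chebyshev's inequality then turns the one-sided bound into a
  lower bound off a small set.\<close>

lemma small_szp_measure:
  fixes k :: nat and \<omega> :: real and l :: complex
  assumes k: "k \<ge> 2" and l: "norm l < 1" "0 < norm l" and L: "L > 0"
  defines "\<alpha> \<equiv> \<lambda>n. l * ec (\<omega> * real n ^ k)"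
  shows "\<exists>C > 0. \<exists>q0. \<forall>q\<ge>q0. \<forall>p::int. coprime p (int q) \<longrightarrow> \<bar>\<omega> - of_int p / real q\<bar> \<le> 1 / (real q)\<^sup>2 \<longrightarrow>
     measure lebesgue {t \<in> {0..1}. norm (szp \<alpha> (q ^ 4) (ec t)) \<le> exp (- (L * real (q ^ 4)))} \<le> C * ln (real q) powr (-1/6)"
proof -
  have \<alpha>: "norm (\<alpha> i) < 1" for i using l by (simp add: \<alpha>_def norm_mult)
  obtain C q0 where C: "C > 0" "\<And>q p z. q \<ge> q0 \<Longrightarrow> coprime p (int q) \<Longrightarrow> \<bar>\<omega> - of_int p / real q\<bar> \<le> 1 / (real q)\<^sup>2 \<Longrightarrow>
     norm z = 1 \<Longrightarrow> norm (szp \<alpha> (q ^ 4) z) \<le> exp (C * ln (real q) powr (-1/6) * real (q ^ 4))"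
    using norm_szp_circle_le_exp[OF k l, of \<omega>] unfolding \<alpha>_def by blast
  show ?thesis
  proof (intro exI[of _ "C / L"] conjI exI[of _ "max 1 q0"] allI impI)
    fix q :: nat and p :: int
    assume q: "max 1 q0 \<le> q" and cop: "coprime p (int q)" and app: "\<bar>\<omega> - of_int p / real q\<bar> \<le> 1 / (real q)\<^sup>2"
    define N where "N = q ^ 4"
    define Y where "Y = ln (real q) powr (-1/6)"
    define f where "f t = C * Y * real N - ln (norm (szp \<alpha> N (ec t)))" for t
    have Npos: "real N > 0" using q by (simp add: N_def)
    have nz: "szp \<alpha> N (ec t) \<noteq> 0" for t by (rule szp_nonzero[of \<alpha>, OF \<alpha>]) simp
    have cf: "continuous_on {0..1} f"
      unfolding f_def by (intro continuous_intros) (use nz in auto)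
    have "measure lebesgue {t \<in> {0..1}. L * real N \<le> f t} \<le> (C * Y * real N) / (L * real N)"
    proof (rule measure_ge_le_integral[OF cf])
      fix t :: real
      have "norm (szp \<alpha> N (ec t)) \<le> exp (C * Y * real N)"
        unfolding N_def Y_def using q by (intro C(2)[of q p] cop app) auto
      then have "ln (norm (szp \<alpha> N (ec t))) \<le> ln (exp (C * Y * real N))" using nz by (subst ln_le_cancel_iff) auto
      then show "0 \<le> f t" by (simp add: f_def)
    next
      have "((\<lambda>t::real. C * Y * real N) has_integral (C * Y * real N)) {0..1}"
        using has_integral_const_real[of "C * Y * real N" 0 1] by simp
      from has_integral_diff[OF this mean_ln_norm_szp[of \<alpha>, OF \<alpha>]]
      show "(f has_integral (C * Y * real N)) {0..1}" by (simp add: f_def[abs_def])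
    qed (use L Npos in auto)
    moreover have "measure lebesgue {t \<in> {0..1}. norm (szp \<alpha> N (ec t)) \<le> exp (- (L * real N))}
        \<le> measure lebesgue {t \<in> {0..1}. L * real N \<le> f t}"
    proof (rule measure_mono_fmeasurable)
      show "{t \<in> {0..1}. norm (szp \<alpha> N (ec t)) \<le> exp (- (L * real N))} \<subseteq> {t \<in> {0..1}. L * real N \<le> f t}"
      proof (safe, goal_cases)
        case (1 t)
        then have "ln (norm (szp \<alpha> N (ec t))) \<le> ln (exp (- (L * real N)))" using nz by (subst ln_le_cancel_iff) auto
        moreover have "0 \<le> C * Y * real N" using C(1) by (simp add: Y_def)
        ultimately show ?case by (simp add: f_def)
      qed
      have "closed {t \<in> {0..1}. norm (szp \<alpha> N (ec t)) \<le> exp (- (L * real N))}"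
        by (intro continuous_on_closed_Collect_le continuous_intros)
      then show "{t \<in> {0..1}. norm (szp \<alpha> N (ec t)) \<le> exp (- (L * real N))} \<in> sets lebesgue" by simp
      have "closed {t \<in> {0..1}. L * real N \<le> f t}"
        by (intro continuous_on_closed_Collect_le continuous_intros cf)
      moreover have "bounded {t \<in> {0..1}. L * real N \<le> f t}" by (rule bounded_subset[of "{0..1}"]) auto
      ultimately show "{t \<in> {0..1}. L * real N \<le> f t} \<in> lmeasurable"
        by (simp add: compact_eq_bounded_closed lmeasurable_compact)
    qed
    moreover have "(C * Y * real N) / (L * real N) = C / L * Y" using Npos L by simp
    ultimately have "measure lebesgue {t \<in> {0..1}. norm (szp \<alpha> N (ec t)) \<le> exp (- (L * real N))} \<le> C / L * Y"
      by linarith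
    then show "measure lebesgue {t \<in> {0..1}. norm (szp \<alpha> (q ^ 4) (ec t)) \<le> exp (- (L * real (q ^ 4)))}
        \<le> C / L * ln (real q) powr (-1/6)"
      by (simp only: N_def Y_def)
  qed (use C(1) L in auto)
qed

section \<open>Growth near periodic phases\<close>

text \<open>A step is the isometry \<open>(u, v) \<mapsto> (u, z * v)\<close> minus a map that
  scales all norms by \<open>norm a\<close>.\<close>

lemma szego_step_norm:
  fixes u v a z :: complex
  assumes "norm z = 1"
  shows "norm (u - a * z * v, z * v - cnj a * u) \<le> (1 + norm a) * norm (u, v)"
    and "norm (u - a * z * v, z * v - cnj a * u) \<ge> (1 - norm a) * norm (u, v)"
    and "norm (a * z * v, cnj a * u) = norm a * norm (u, v)"
proof -
  have 1: "norm (u, z * v) = norm (u, v)" by (simp add: norm_Pair norm_mult assms)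
  have "norm (a * z * v, cnj a * u) = sqrt ((norm a)\<^sup>2 * ((norm u)\<^sup>2 + (norm v)\<^sup>2))"
    by (simp add: norm_Pair norm_mult assms power_mult_distrib algebra_simps)
  then show 2: "norm (a * z * v, cnj a * u) = norm a * norm (u, v)"
    by (simp add: real_sqrt_mult norm_Pair)
  have 3: "(u - a * z * v, z * v - cnj a * u) = (u, z * v) - (a * z * v, cnj a * u)" by simp
  show "norm (u - a * z * v, z * v - cnj a * u) \<le> (1 + norm a) * norm (u, v)"
    unfolding 3 using norm_triangle_ineq4[of "(u, z * v)" "(a * z * v, cnj a * u)"] 1 2
    by (simp add: algebra_simps)
  show "norm (u - a * z * v, z * v - cnj a * u) \<ge> (1 - norm a) * norm (u, v)"
    unfolding 3 using norm_triangle_ineq2[of "(u, z * v)" "(a * z * v, cnj a * u)"] 1 2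
    by (simp add: algebra_simps)
qed

lemma szego_norm_bounds:
  assumes "norm z = 1" "\<And>i. norm (\<alpha> i) = \<kappa>" "\<kappa> < 1"
  shows "norm (szego \<alpha> z w n) \<le> 2 ^ n * norm w" "(1 - \<kappa>) ^ n * norm w \<le> norm (szego \<alpha> z w n)"
proof -
  have "norm (szego \<alpha> z w n) \<le> 2 ^ n * norm w \<and> (1 - \<kappa>) ^ n * norm w \<le> norm (szego \<alpha> z w n)"
  proof (induction n)
    case (Suc n)
    obtain u v where uv: "szego \<alpha> z w n = (u, v)" by fastforce
    have "norm (szego \<alpha> z w (Suc n)) \<le> (1 + \<kappa>) * norm (u, v)"
      using szego_step_norm(1)[OF assms(1), of u "\<alpha> n" v] assms(2) by (simp add: uv)
    also have "\<dots> \<le> 2 * (2 ^ n * norm w)" using Suc uv assms(3) by (intro mult_mono) auto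
    finally have 1: "norm (szego \<alpha> z w (Suc n)) \<le> 2 ^ Suc n * norm w" by simp
    have "(1 - \<kappa>) ^ Suc n * norm w = (1 - \<kappa>) * ((1 - \<kappa>) ^ n * norm w)" by simp
    also have "\<dots> \<le> (1 - \<kappa>) * norm (u, v)" using Suc uv assms(3) by (intro mult_left_mono) auto
    also have "\<dots> \<le> norm (szego \<alpha> z w (Suc n))"
      using szego_step_norm(2)[OF assms(1), where a = "\<alpha> n" and u = u and v = v] assms(2) by (simp add: uv)
    finally show ?case using 1 by simp
  qed simp
  then show "norm (szego \<alpha> z w n) \<le> 2 ^ n * norm w" "(1 - \<kappa>) ^ n * norm w \<le> norm (szego \<alpha> z w n)" by auto
qed

text \<open>The exponential loss is affordable: this is applied over one period of length about
  \<open>sqrt a\<close>, for coefficients that differ by about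
  \<open>exp (- (c * a))\<close>.\<close>

lemma szego_perturbation:
  assumes "norm z = 1" "\<And>i. norm (\<alpha> i) = \<kappa>" "\<And>i. norm (\<beta> i) = \<kappa>" "\<kappa> < 1"
    and \<eta>: "\<And>i. i < n \<Longrightarrow> norm (\<alpha> i - \<beta> i) \<le> \<eta>"
  shows "norm (szego \<alpha> z w n - szego \<beta> z w n) \<le> real n * 2 ^ n * \<eta> * norm w"
  using \<eta>
proof (induction n)
  case (Suc n)
  obtain u v where uv: "szego \<alpha> z w n = (u, v)" by fastforce
  obtain u' v' where uv': "szego \<beta> z w n = (u', v')" by fastforce
  have \<eta>0: "0 \<le> \<eta>" using Suc.prems[of n] norm_ge_zero order_trans by blast
  have "szego \<alpha> z w (Suc n) - szego \<beta> z w (Suc n)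
      = ((u - u') - \<alpha> n * z * (v - v'), z * (v - v') - cnj (\<alpha> n) * (u - u'))
        - ((\<alpha> n - \<beta> n) * z * v', cnj (\<alpha> n - \<beta> n) * u')"
    by (simp add: uv uv' algebra_simps)
  then have "norm (szego \<alpha> z w (Suc n) - szego \<beta> z w (Suc n))
      \<le> (1 + \<kappa>) * norm (u - u', v - v') + norm (\<alpha> n - \<beta> n) * norm (u', v')"
    using norm_triangle_ineq4[of "((u - u') - \<alpha> n * z * (v - v'), z * (v - v') - cnj (\<alpha> n) * (u - u'))" "((\<alpha> n - \<beta> n) * z * v', cnj (\<alpha> n - \<beta> n) * u')"]
      szego_step_norm(1)[OF assms(1), of "u - u'" "\<alpha> n" "v - v'"] szego_step_norm(3)[OF assms(1), of "\<alpha> n - \<beta> n" v' u'] assms(2)[of n]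
    by simp
  also have "\<dots> \<le> 2 * (real n * 2 ^ n * \<eta> * norm w) + \<eta> * (2 ^ n * norm w)"
  proof (intro add_mono mult_mono)
    show "norm (u - u', v - v') \<le> real n * 2 ^ n * \<eta> * norm w" using Suc by (simp add: uv uv')
    show "norm (\<alpha> n - \<beta> n) \<le> \<eta>" using Suc.prems by simp
    show "norm (u', v') \<le> 2 ^ n * norm w"
      using szego_norm_bounds(1)[of z \<beta> \<kappa> w n] assms uv' by simp
  qed (use assms \<eta>0 in auto)
  also have "\<dots> \<le> real (Suc n) * 2 ^ Suc n * \<eta> * norm w"
    using \<eta>0 by (simp add: algebra_simps)
  finally show ?case .
qed simp

definition cscale :: "complex \<Rightarrow> complex \<times> complex \<Rightarrow> complex \<times> complex" where
  "cscale c w = (c * fst w, c * snd w)"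

lemma norm_cscale: "norm (cscale c w) = norm c * norm w"
proof -
  have "norm (cscale c w) = sqrt ((norm c)\<^sup>2 * ((norm (fst w))\<^sup>2 + (norm (snd w))\<^sup>2))"
    by (simp add: cscale_def norm_Pair norm_mult power_mult_distrib algebra_simps)
  then show ?thesis by (simp add: real_sqrt_mult norm_prod_def)
qed

text \<open>The error adds 1 to the weight of each of the two earlier terms and the unimodular
  \<open>\<delta>\<close> another 1. Together with \<open>three_term_lower\<close> this ties the
  rate of growth to \<open>norm \<tau>\<close> up to the additive constant 3, with no eigenvalue
  analysis.\<close>

lemma three_term_upper:
  assumes rec: "\<And>i. Suc (Suc i) \<le> n \<Longrightarrow> norm (v (Suc (Suc i)) - cscale \<tau> (v (Suc i)) + cscale \<delta> (v i)) \<le> norm (v (Suc i)) + norm (v i)"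
    and "norm \<delta> = 1" "norm (v 0) \<le> K" "norm (v 1) \<le> K" "0 \<le> K"
  shows "i \<le> n \<Longrightarrow> norm (v i) \<le> (norm \<tau> + 3) ^ i * K"
proof (induction i rule: less_induct)
  case (less i)
  let ?X = "norm \<tau> + 3"
  consider "i = 0" | "i = 1" | j where "i = Suc (Suc j)" by (metis One_nat_def not0_implies_Suc)
  then show ?case
  proof cases
    case 2
    have "1 * K \<le> ?X * K" using assms by (intro mult_right_mono) auto
    then show ?thesis using 2 assms by simp
  next
    case (3 j)
    have "norm ((v (Suc (Suc j)) - cscale \<tau> (v (Suc j)) + cscale \<delta> (v j)) + (cscale \<tau> (v (Suc j)) - cscale \<delta> (v j)))
        \<le> norm (v (Suc (Suc j)) - cscale \<tau> (v (Suc j)) + cscale \<delta> (v j)) + (norm (cscale \<tau> (v (Suc j))) + norm (cscale \<delta> (v j)))"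
      by (rule order_trans[OF norm_triangle_ineq add_left_mono[OF norm_triangle_ineq4]])
    moreover have "(v (Suc (Suc j)) - cscale \<tau> (v (Suc j)) + cscale \<delta> (v j)) + (cscale \<tau> (v (Suc j)) - cscale \<delta> (v j)) = v i"
      using 3 by simp
    ultimately have "norm (v i) \<le> (norm \<tau> + 1) * norm (v (Suc j)) + 2 * norm (v j)"
      using rec[of j] 3 less.prems assms(2) by (simp add: norm_cscale algebra_simps)
    also have "\<dots> \<le> (norm \<tau> + 1) * (?X ^ Suc j * K) + 2 * (?X ^ j * K)"
      using less.IH[of j] less.IH[of "Suc j"] 3 less.prems by (intro add_mono mult_left_mono) auto
    also have "\<dots> \<le> (norm \<tau> + 1) * (?X ^ Suc j * K) + 2 * (?X ^ Suc j * K)"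
    proof -
      have "1 * (?X ^ j * K) \<le> ?X * (?X ^ j * K)" using assms by (intro mult_right_mono) auto
      then show ?thesis by simp
    qed
    also have "\<dots> = ?X ^ i * K" using 3 by (simp add: algebra_simps)
    finally show ?thesis .
  qed (use assms in auto)
qed

text \<open>From \<open>norm \<tau> \<ge> 4\<close> on, norms that do not decrease once never
  decrease again, and the older term can be absorbed into the newer one. Growth therefore persists
  at the rate given by the trace.\<close>

lemma three_term_lower:
  assumes rec: "\<And>i. Suc (Suc i) \<le> n \<Longrightarrow> norm (v (Suc (Suc i)) - cscale \<tau> (v (Suc i)) + cscale \<delta> (v i)) \<le> norm (v (Suc i)) + norm (v i)"
    and "norm \<delta> = 1" "norm (v 0) \<le> norm (v 1)" "norm \<tau> \<ge> 4"
  shows "Suc i \<le> n \<Longrightarrow> norm (v i) \<le> norm (v (Suc i)) \<and> (norm \<tau> - 3) ^ i * norm (v 1) \<le> norm (v (Suc i))"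
proof (induction i)
  case (Suc i)
  have "norm (v (Suc (Suc i)) + cscale \<delta> (v i) - (v (Suc (Suc i)) - cscale \<tau> (v (Suc i)) + cscale \<delta> (v i)))
      \<le> norm (v (Suc (Suc i))) + norm (cscale \<delta> (v i)) + norm (v (Suc (Suc i)) - cscale \<tau> (v (Suc i)) + cscale \<delta> (v i))"
    by (rule order_trans[OF norm_triangle_ineq4 add_right_mono[OF norm_triangle_ineq]])
  moreover have "v (Suc (Suc i)) + cscale \<delta> (v i) - (v (Suc (Suc i)) - cscale \<tau> (v (Suc i)) + cscale \<delta> (v i)) = cscale \<tau> (v (Suc i))"
    by simp
  ultimately have "norm \<tau> * norm (v (Suc i)) \<le> norm (v (Suc (Suc i))) + 2 * norm (v i) + norm (v (Suc i))"
    using rec[of i] Suc.prems assms(2) by (simp add: norm_cscale)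
  then have 1: "(norm \<tau> - 3) * norm (v (Suc i)) \<le> norm (v (Suc (Suc i)))"
    using Suc by (simp add: algebra_simps)
  have "1 * norm (v (Suc i)) \<le> (norm \<tau> - 3) * norm (v (Suc i))"
    using assms(4) by (intro mult_right_mono) auto
  moreover have "(norm \<tau> - 3) ^ Suc i * norm (v 1) \<le> (norm \<tau> - 3) * norm (v (Suc i))"
    using Suc assms(4) by (simp add: mult.assoc mult_left_mono)
  ultimately show ?case using 1 by linarith
qed (use assms in auto)

lemma ec_int: "ec (of_int i) = 1"
  by (metis cis_multiple_2pi Ints_of_int)

lemma norm_ec_diff_le: "norm (ec x - ec y) \<le> 2 * pi * \<bar>x - y\<bar>"
proof -
  have "norm (cis (2*pi*x) - cis (2*pi*y)) \<le> \<bar>2*pi*x - 2*pi*y\<bar>"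
  proof -
    have "cis (2*pi*x) - cis (2*pi*y) = cis (2*pi*y) * (cis (2*pi*x - 2*pi*y) - 1)"
      by (simp add: cis_mult right_diff_distrib)
    then have "norm (cis (2*pi*x) - cis (2*pi*y)) = norm (cis (2*pi*x - 2*pi*y) - 1)"
      by (simp only: norm_mult norm_cis mult_1_left)
    also have "\<dots> = norm (exp (\<i> * of_real (2*pi*x - 2*pi*y)) - 1)" by (simp only: cis_conv_exp)
    also have "\<dots> \<le> \<bar>2*pi*x - 2*pi*y\<bar>" unfolding dist_exp_i_1 using abs_sin_x_le_abs_x[of "(2*pi*x - 2*pi*y) / 2"] by simp
    finally show ?thesis .
  qed
  also have "\<dots> = 2 * pi * \<bar>x - y\<bar>" by (simp add: right_diff_distrib[symmetric] abs_mult)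
  finally show ?thesis .
qed

text \<open>Since \<open>b\<close> divides \<open>(i * b + j) ^ k - j ^ k\<close>, the rational
  phase is exactly periodic; only the approximation error, magnified by the \<open>k\<close>-th
  power, remains.\<close>

lemma near_periodic:
  fixes p :: int
  assumes "b > 0" "\<bar>\<omega> - of_int p / real b\<bar> \<le> \<epsilon>" "i * b + j \<le> n"
  shows "norm (ec (\<omega> * real (i * b + j) ^ k) - ec (of_int p / real b * real j ^ k)) \<le> 2 * pi * (\<epsilon> * real n ^ k)"
proof -
  have "int b dvd int (i * b + j) - int j" by simp
  then have "int b dvd int (i * b + j) ^ k - int j ^ k"
    by (metis dvd_trans power_diff_sumr2 dvd_triv_left)
  then obtain s where s: "int (i * b + j) ^ k - int j ^ k = int b * s" by (auto simp: dvd_def)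
  then have "real_of_int (int (i * b + j) ^ k - int j ^ k) = real_of_int (int b * s)" by simp
  then have s': "real (i * b + j) ^ k = real j ^ k + real b * of_int s" by simp
  have "of_int p / real b * real (i * b + j) ^ k = of_int p / real b * real j ^ k + of_int (p * s)"
    unfolding s' using assms(1) by (simp add: field_simps)
  then have "ec (of_int p / real b * real (i * b + j) ^ k) = ec (of_int p / real b * real j ^ k) * ec (of_int (p * s))"
    by (simp only: cis_mult distrib_left)
  then have e: "ec (of_int p / real b * real j ^ k) = ec (of_int p / real b * real (i * b + j) ^ k)"
    by (simp only: ec_int mult_1_right)
  have "norm (ec (\<omega> * real (i * b + j) ^ k) - ec (of_int p / real b * real (i * b + j) ^ k))
      \<le> 2 * pi * \<bar>\<omega> * real (i * b + j) ^ k - of_int p / real b * real (i * b + j) ^ k\<bar>"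
    by (rule norm_ec_diff_le)
  also have "\<dots> = 2 * pi * (\<bar>\<omega> - of_int p / real b\<bar> * real (i * b + j) ^ k)"
    by (simp only: left_diff_distrib[symmetric] abs_mult abs_of_nonneg of_nat_0_le_iff zero_le_power)
  also have "\<dots> \<le> 2 * pi * (\<epsilon> * real n ^ k)"
  proof (intro mult_left_mono mult_mono power_mono)
    show "real (i * b + j) \<le> real n" using assms(3) by (rule of_nat_mono)
    show "0 \<le> \<epsilon>" using assms(2) by linarith
  qed (use assms in auto)
  finally show ?thesis unfolding e .
qed

lemma szego_cscale: "szego \<alpha> z (cscale c w) n = cscale c (szego \<alpha> z w n)"
  by (induction n) (simp_all add: cscale_def algebra_simps)

lemma szego_cayley_hamilton:
  "szego \<beta> z (szego \<beta> z w n) n - cscale (szp \<beta> n z + szs \<beta> n z) (szego \<beta> z w n)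
     + cscale (z ^ n * of_real (\<Prod>i<n. 1 - (norm (\<beta> i))\<^sup>2)) w = 0"
proof -
  obtain u v where w: "w = (u, v)" by fastforce
  show ?thesis
    unfolding szego_det[symmetric] w szego_eq cscale_def by (simp add: algebra_simps zero_prod_def)
qed

lemma szego_diff: "szego \<alpha> z w n - szego \<alpha> z w' n = szego \<alpha> z (w - w') n"
proof -
  obtain u v where w: "w = (u, v)" by fastforce
  obtain u' v' where w': "w' = (u', v')" by fastforce
  show ?thesis unfolding w w' by (simp add: szego_eq algebra_simps)
qed

text \<open>One period of length \<open>b\<close> acts almost as a fixed matrix, so by Cayley--Hamilton the normalised iterates
  almost satisfy a three-term recursion whose only unknown is the trace.\<close>

lemma szego_three_term:
  fixes w :: "complex \<times> complex"
  assumes z: "norm z = 1" and \<alpha>: "\<And>i. norm (\<alpha> i) = \<kappa>" and \<beta>: "\<And>i. norm (\<beta> i) = \<kappa>" and \<kappa>: "\<kappa> < 1"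
    and \<rho>: "\<rho> > 0" "\<rho>\<^sup>2 = 1 - \<kappa>\<^sup>2" and b: "b > 0"
    and near: "\<And>j. j < b \<Longrightarrow> norm (\<alpha> (i * b + j) - \<beta> j) \<le> \<eta>" "\<And>j. j < b \<Longrightarrow> norm (\<alpha> (Suc i * b + j) - \<beta> j) \<le> \<eta>"
    and small: "3 * (2 / \<rho>) ^ b * (real b * (2 / \<rho>) ^ b * \<eta>) \<le> 1"
  defines "v \<equiv> \<lambda>i. cscale (of_real (1 / \<rho> ^ (i * b))) (szego \<alpha> z w (i * b))"
  shows "norm (v (Suc (Suc i)) - cscale ((szp \<beta> b z + szs \<beta> b z) / of_real (\<rho> ^ b)) (v (Suc i)) + cscale (z ^ b) (v i))
    \<le> norm (v (Suc i)) + norm (v i)"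
proof -
  define B where "B = (2 / \<rho>) ^ b"
  define e where "e = real b * B * \<eta>"
  have \<eta>0: "0 \<le> \<eta>" using near(1)[of 0] b norm_ge_zero order_trans by blast
  have \<kappa>0: "0 \<le> \<kappa>" using \<alpha>[of 0] norm_ge_zero by metis
  have "\<rho>\<^sup>2 \<le> 1\<^sup>2" using \<rho> by simp
  then have "\<rho> \<le> 1" by (rule power2_le_imp_le) simp
  then have B1: "1 \<le> B" unfolding B_def using \<rho> by (intro one_le_power) (simp add: field_simps)
  have e0: "0 \<le> e" using B1 \<eta>0 by (simp add: e_def)
  have small': "3 * B * e \<le> 1" using small by (simp add: B_def e_def)
  define P where "P w = cscale (of_real (1 / \<rho> ^ b)) (szego \<beta> z w b)" for w
  define X where "X i w = cscale (of_real (1 / \<rho> ^ b)) (szego (\<lambda>j. \<alpha> (i * b + j)) z w b)" for i w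
  define \<tau> where "\<tau> = (szp \<beta> b z + szs \<beta> b z) / of_real (\<rho> ^ b)"
  have vS: "v (Suc i) = X i (v i)" for i
  proof -
    have "szego \<alpha> z w (Suc i * b) = szego (\<lambda>j. \<alpha> (i * b + j)) z (szego \<alpha> z w (i * b)) b"
      using szego_add[of \<alpha> z w "i * b" b] by (simp add: add.commute)
    then show ?thesis unfolding v_def X_def szego_cscale
      by (simp add: cscale_def power_add mult.assoc)
  qed
  have PX: "norm (X i' w - P w) \<le> e * norm w" if "\<And>j. j < b \<Longrightarrow> norm (\<alpha> (i' * b + j) - \<beta> j) \<le> \<eta>" for i' w
  proof -
    have "X i' w - P w = cscale (of_real (1 / \<rho> ^ b)) (szego (\<lambda>j. \<alpha> (i' * b + j)) z w b - szego \<beta> z w b)"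
      by (simp add: X_def P_def cscale_def right_diff_distrib)
    then have "norm (X i' w - P w) = 1 / \<rho> ^ b * norm (szego (\<lambda>j. \<alpha> (i' * b + j)) z w b - szego \<beta> z w b)"
      using \<rho> by (simp only: norm_cscale norm_of_real) simp
    also have "\<dots> \<le> 1 / \<rho> ^ b * (real b * 2 ^ b * \<eta> * norm w)"
      using \<rho> by (intro mult_left_mono szego_perturbation[OF z _ \<beta> \<kappa>] that) (auto simp: \<alpha>)
    also have "\<dots> = e * norm w" by (simp add: e_def B_def power_divide)
    finally show ?thesis .
  qed
  have Pn: "norm (P w) \<le> B * norm w" for w
  proof -
    have "norm (P w) = 1 / \<rho> ^ b * norm (szego \<beta> z w b)" using \<rho> by (simp add: P_def norm_cscale norm_divide norm_power)
    also have "\<dots> \<le> 1 / \<rho> ^ b * (2 ^ b * norm w)"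
      using \<rho> by (intro mult_left_mono szego_norm_bounds(1)[OF z \<beta> \<kappa>]) auto
    finally show ?thesis by (simp add: B_def power_divide)
  qed
  have sz: "norm (fst w) \<le> norm w" "norm (snd w) \<le> norm w" for w :: "complex \<times> complex"
    using norm_fst_le[of "fst w" "snd w"] norm_snd_le[of "snd w" "fst w"] by simp_all
  have "norm (szp \<beta> b z) \<le> 2 ^ b" "norm (szs \<beta> b z) \<le> 2 ^ b"
    using szego_norm_bounds(1)[of z \<beta> \<kappa> "(1,0)" b, OF z \<beta> \<kappa>] szego_norm_bounds(1)[of z \<beta> \<kappa> "(0,1)" b, OF z \<beta> \<kappa>]
      sz(1)[of "szego \<beta> z (1,0) b"] sz(2)[of "szego \<beta> z (0,1) b"]
    by (auto simp: szp_def szs_def norm_Pair)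
  then have "norm (szp \<beta> b z + szs \<beta> b z) \<le> 2 * 2 ^ b" using norm_triangle_ineq[of "szp \<beta> b z" "szs \<beta> b z"] by linarith
  then have \<tau>: "norm \<tau> \<le> 2 * B"
    using \<rho> by (simp add: \<tau>_def norm_divide norm_power B_def power_divide divide_right_mono)
  have CH: "P (P w) - cscale \<tau> (P w) + cscale (z ^ b) w = 0" for w
  proof -
    have D: "(\<Prod>i<b. 1 - (norm (\<beta> i))\<^sup>2) = \<rho> ^ b * \<rho> ^ b"
      unfolding \<beta> \<rho>(2)[symmetric] by (simp add: power2_eq_square power_mult_distrib)
    have "P (P w) - cscale \<tau> (P w) + cscale (z ^ b) w
      = cscale (of_real (1 / (\<rho> ^ b * \<rho> ^ b))) (szego \<beta> z (szego \<beta> z w b) b - cscale (szp \<beta> b z + szs \<beta> b z) (szego \<beta> z w b)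
     + cscale (z ^ b * of_real (\<rho> ^ b * \<rho> ^ b)) w)"
      unfolding P_def szego_cscale \<tau>_def using \<rho>(1)
      by (simp add: cscale_def prod_eq_iff field_simps)
    also have "\<dots> = 0" using szego_cayley_hamilton[of \<beta> z w b] unfolding D by (simp add: cscale_def zero_prod_def)
    finally show ?thesis .
  qed
  let ?x = "v i" and ?y = "v (Suc i)"
  \<comment> \<open>The defects of two consecutive periods against the exactly periodic map
    \<open>P\<close>. Expanding the recursion around \<open>P (P ?x)\<close> leaves only these,
    since the main part vanishes by Cayley--Hamilton.\<close>
  let ?E = "?y - P ?x" and ?F = "v (Suc (Suc i)) - P ?y"
  have E: "norm ?E \<le> e * norm ?x" using PX[OF near(1)] vS[of i] by simp
  have F: "norm ?F \<le> e * norm ?y" using PX[OF near(2)] vS[of "Suc i"] by simp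
  have "P ?E = P ?y - P (P ?x)"
    unfolding P_def szego_diff[symmetric] by (simp add: cscale_def right_diff_distrib)
  then have "v (Suc (Suc i)) - cscale \<tau> ?y + cscale (z ^ b) ?x = ?F + P ?E - cscale \<tau> ?E + (P (P ?x) - cscale \<tau> (P ?x) + cscale (z ^ b) ?x)"
    by (simp add: cscale_def prod_eq_iff algebra_simps)
  also have "\<dots> = ?F + P ?E - cscale \<tau> ?E" unfolding CH by simp
  also have "norm \<dots> \<le> norm ?F + norm (P ?E) + norm (cscale \<tau> ?E)"
    by (rule order_trans[OF norm_triangle_ineq4 add_right_mono[OF norm_triangle_ineq]])
  also have "\<dots> \<le> e * norm ?y + B * (e * norm ?x) + (2 * B) * (e * norm ?x)"
  proof (intro add_mono F)
    show "norm (P ?E) \<le> B * (e * norm ?x)" using Pn[of ?E] E B1 by (meson mult_left_mono order_trans zero_le_one)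
    show "norm (cscale \<tau> ?E) \<le> 2 * B * (e * norm ?x)" unfolding norm_cscale using \<tau> E B1 by (intro mult_mono) auto
  qed
  also have "\<dots> = e * norm ?y + (3 * B * e) * norm ?x" by (simp add: algebra_simps)
  also have "\<dots> \<le> 1 * norm ?y + 1 * norm ?x"
  proof (intro add_mono mult_right_mono small')
    have "1 * e \<le> 3 * B * e" using B1 e0 by (intro mult_right_mono) auto
    then show "e \<le> 1" using small' by simp
  qed auto
  finally show ?thesis by (simp add: \<tau>_def)
qed

lemma norm_szp_ge:
  assumes "norm z = 1" "\<And>i. norm (\<alpha> i) = \<kappa>" "\<rho> > 0" "\<rho>\<^sup>2 = 1 - \<kappa>\<^sup>2"
  shows "\<rho> ^ n \<le> norm (szp \<alpha> n z)"
proof -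
  have "(\<rho> ^ n)\<^sup>2 = (1 - \<kappa>\<^sup>2) ^ n" by (simp add: assms(4)[symmetric] power_mult[symmetric] mult.commute)
  also have "\<dots> = (norm (szp \<alpha> n z))\<^sup>2 - (norm (szq \<alpha> n z))\<^sup>2"
    unfolding szp_szq_circle[OF assms(1)] by (simp add: assms(2))
  finally have "(\<rho> ^ n)\<^sup>2 \<le> (norm (szp \<alpha> n z))\<^sup>2" by simp
  then show ?thesis by (rule power2_le_imp_le) simp
qed

lemma norm_szego_le_szp:
  assumes "norm z = 1" "\<And>i. norm (\<alpha> i) < 1"
  shows "norm (szp \<alpha> n z) \<le> norm (szego \<alpha> z (1, 0) n)" "norm (szego \<alpha> z (1, 0) n) \<le> 2 * norm (szp \<alpha> n z)"
proof -
  have e: "szego \<alpha> z (1, 0) n = (szp \<alpha> n z, szq \<alpha> n z)" by (simp add: szp_def szq_def)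
  show "norm (szp \<alpha> n z) \<le> norm (szego \<alpha> z (1, 0) n)" unfolding e by (rule norm_fst_le)
  have "norm (szq \<alpha> n z) \<le> norm (szp \<alpha> n z)" using szq_less_szp[of \<alpha> z n, OF assms(2)] assms(1) by simp
  moreover have "norm (szp \<alpha> n z, szq \<alpha> n z) \<le> norm (szp \<alpha> n z) + norm (szq \<alpha> n z)"
    unfolding norm_Pair by (rule sqrt_sum_squares_le_sum) auto
  ultimately show "norm (szego \<alpha> z (1, 0) n) \<le> 2 * norm (szp \<alpha> n z)" unfolding e by linarith
qed

lemma periodic_asymp:
  assumes "c > 0" "g > 0" "A > 0"
  shows "eventually (\<lambda>x::real. 3 * exp (3 * x * A) * (3 * x * exp (3 * x * A) * (2 * pi * (exp (- (c * x\<^sup>2)) * x powr K))) \<le> 1) at_top"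
    "eventually (\<lambda>x::real. 6 * A / x \<le> g / 2) at_top" "eventually (\<lambda>x::real. 3 \<le> x * (g / 2)) at_top"
    "eventually (\<lambda>x::real. 3 \<le> x ^ 3) at_top"
  using assms by - real_asymp+

text \<open>Growth over the \<open>a div b\<close> periods up to \<open>a\<close> bounds the trace
  from below, and the same trace governs the \<open>a\<^sup>2 div b\<close> periods up to
  \<open>a\<^sup>2\<close>. Incomplete periods lower the rate by order \<open>b / a\<close>, the
  additive constants of the three-term recursion by order \<open>1 / b\<close>; taking
  \<open>b\<close> of order \<open>sqrt a\<close> balances the two.\<close>

lemma periodic_growth:
  fixes k :: nat and \<omega> :: real and l :: complex
  assumes l: "norm l < 1" "0 < norm l" and c: "c > 0" and g0: "g0 > 0" and \<rho>: "\<rho> > 0" "\<rho>\<^sup>2 = 1 - (norm l)\<^sup>2"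
  defines "\<alpha> \<equiv> \<lambda>n. l * ec (\<omega> * real n ^ k)"
  shows "\<exists>C > 0. \<exists>a0. \<forall>a\<ge>a0. \<forall>b (p::int) z g. sqrt (real a) \<le> real b \<longrightarrow> real b \<le> 3 * sqrt (real a) \<longrightarrow>
     \<bar>\<omega> - of_int p / real b\<bar> \<le> exp (- (c * real a)) \<longrightarrow> norm z = 1 \<longrightarrow> g0 \<le> g \<longrightarrow>
     \<rho> ^ a * exp (g * real a) \<le> norm (szp \<alpha> a z) \<longrightarrow>
     \<rho> ^ (a\<^sup>2) * exp ((g - C / sqrt (real a)) * real (a\<^sup>2)) \<le> norm (szp \<alpha> (a\<^sup>2) z)"
proof -
  define \<kappa> where "\<kappa> = norm l"
  have \<alpha>: "norm (\<alpha> i) = \<kappa>" for i by (simp add: \<alpha>_def \<kappa>_def norm_mult)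
  have \<kappa>: "\<kappa> < 1" "0 < \<kappa>" using l by (auto simp: \<kappa>_def)
  have \<alpha>1: "norm (\<alpha> i) < 1" for i using \<alpha> \<kappa> by simp
  have \<rho>\<kappa>: "\<rho>\<^sup>2 = 1 - \<kappa>\<^sup>2" using \<rho> by (simp add: \<kappa>_def)
  have "\<rho>\<^sup>2 \<le> 1\<^sup>2" using \<rho> by simp
  then have \<rho>1: "\<rho> \<le> 1" by (rule power2_le_imp_le) simp
  define A1 where "A1 = ln (2 / \<rho>)"
  have eA1: "2 / \<rho> = exp A1" using \<rho> by (simp add: A1_def)
  have A1: "0 < A1" unfolding A1_def using \<rho> \<rho>1 by (intro ln_gt_zero) (simp add: field_simps)
  define A2 where "A2 = - ln (1 - \<kappa>)"
  have A2: "0 \<le> A2" "1 - \<kappa> = exp (- A2)" using \<kappa> by (auto simp: A2_def)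
  \<comment> \<open>\<open>6 * A1\<close> comes from lowering \<open>g\<close> to \<open>g'\<close>,
    1 from the loss per period, another \<open>6 * A1\<close> from two periods given up in counting,
    and \<open>3 * A2\<close> from the last incomplete block, where each step may shrink norms by
    \<open>1 - \<kappa>\<close>.\<close>
  define C where "C = 12 * A1 + 1 + 3 * A2"
  have C0: "C > 0" using A1 A2 by (simp add: C_def)
  have "eventually (\<lambda>x::real. (1 \<le> x \<and> 3 \<le> x ^ 3) \<and> 3 * exp (3 * x * A1) * (3 * x * exp (3 * x * A1) * (2 * pi * (exp (- (c * x\<^sup>2)) * x powr (real (4 * k))))) \<le> 1
     \<and> 6 * A1 / x \<le> g0 / 2 \<and> 3 \<le> x * (g0 / 2)) at_top"
    using c g0 A1 by (intro eventually_conj periodic_asymp eventually_ge_at_top)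
  then obtain x0 where x0: "\<And>x::real. x0 \<le> x \<Longrightarrow> (1 \<le> x \<and> 3 \<le> x ^ 3) \<and> 3 * exp (3 * x * A1) * (3 * x * exp (3 * x * A1) * (2 * pi * (exp (- (c * x\<^sup>2)) * x powr (real (4 * k))))) \<le> 1
     \<and> 6 * A1 / x \<le> g0 / 2 \<and> 3 \<le> x * (g0 / 2)"
    unfolding eventually_at_top_linorder by blast
  show ?thesis
  proof (intro exI[of _ C] conjI exI[of _ "nat \<lceil>\<bar>x0\<bar> ^ 2\<rceil>"] allI impI C0)
    fix a b :: nat and p :: int and z :: complex and g :: real
    assume a: "nat \<lceil>\<bar>x0\<bar> ^ 2\<rceil> \<le> a" and b: "sqrt (real a) \<le> real b" "real b \<le> 3 * sqrt (real a)"
      and app: "\<bar>\<omega> - of_int p / real b\<bar> \<le> exp (- (c * real a))" and z: "norm z = 1" and g: "g0 \<le> g"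
      and growth: "\<rho> ^ a * exp (g * real a) \<le> norm (szp \<alpha> a z)"
    define s where "s = sqrt (real a)"
    have "\<bar>x0\<bar> ^ 2 \<le> real a" using a by linarith
    then have "\<bar>x0\<bar> \<le> s" unfolding s_def by (rule real_le_rsqrt)
    then have "x0 \<le> s" by simp
    note X = x0[OF this]
    have s1: "1 \<le> s" using X by blast
    have as: "real a = s * s" by (simp add: s_def)
    have bs: "s \<le> real b" "real b \<le> 3 * s" using b by (auto simp: s_def)
    have b0: "b > 0" using bs s1 by (cases b) auto
    define \<beta> where "\<beta> j = l * ec (of_int p / real b * real j ^ k)" for j
    have \<beta>: "norm (\<beta> i) = \<kappa>" for i by (simp add: \<beta>_def \<kappa>_def norm_mult)
    define \<eta> where "\<eta> = 2 * pi * (exp (- (c * real a)) * real (a\<^sup>2) ^ k)"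
    have near: "norm (\<alpha> (i * b + j) - \<beta> j) \<le> \<eta>" if "i * b + j \<le> a\<^sup>2" for i j
    proof -
      have "norm (\<alpha> (i * b + j) - \<beta> j) = norm l * norm (ec (\<omega> * real (i * b + j) ^ k) - ec (of_int p / real b * real j ^ k))"
        unfolding \<alpha>_def \<beta>_def right_diff_distrib[symmetric] norm_mult ..
      also have "\<dots> \<le> 1 * \<eta>"
        unfolding \<eta>_def using l by (intro mult_mono near_periodic[OF b0 app that]) auto
      finally show ?thesis by simp
    qed
    have small: "3 * (2 / \<rho>) ^ b * (real b * (2 / \<rho>) ^ b * \<eta>) \<le> 1"
    proof -
      have e1: "(2 / \<rho>) ^ b \<le> exp (3 * s * A1)"
        unfolding eA1 exp_of_nat_mult[symmetric] using bs A1 by simp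
      have e2: "\<eta> = 2 * pi * (exp (- (c * s\<^sup>2)) * s powr (real (4 * k)))"
      proof -
        have "real (a\<^sup>2) ^ k = (s ^ 4) ^ k" by (simp add: as power2_eq_square power4_eq_xxxx mult.assoc)
        also have "\<dots> = s powr (real (4 * k))" using s1 by (subst powr_realpow) (auto simp: power_mult)
        finally show ?thesis by (simp add: \<eta>_def as power2_eq_square)
      qed
      have \<eta>0: "0 \<le> \<eta>" by (simp add: \<eta>_def)
      have "3 * (2 / \<rho>) ^ b * (real b * (2 / \<rho>) ^ b * \<eta>)
        \<le> 3 * exp (3 * s * A1) * (3 * s * exp (3 * s * A1) * \<eta>)"
        using e1 bs \<eta>0 \<rho> s1 by (intro mult_mono) auto
      also have "\<dots> \<le> 1" unfolding e2 using X by blast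
      finally show ?thesis .
    qed
    define v where "v i = cscale (of_real (1 / \<rho> ^ (i * b))) (szego \<alpha> z (1, 0) (i * b))" for i
    define \<tau> where "\<tau> = (szp \<beta> b z + szs \<beta> b z) / of_real (\<rho> ^ b)"
    have nv: "norm (v i) = norm (szego \<alpha> z (1, 0) (i * b)) / \<rho> ^ (i * b)" for i
      using \<rho> by (simp add: v_def norm_cscale norm_divide norm_power)
    define n m where "n = a div b" and "m = a\<^sup>2 div b"
    have rec: "norm (v (Suc (Suc i)) - cscale \<tau> (v (Suc i)) + cscale (z ^ b) (v i)) \<le> norm (v (Suc i)) + norm (v i)"
      if i: "Suc (Suc i) \<le> m" for i
    proof -
      have "Suc (Suc i) * b \<le> m * b" using i by (intro mult_right_mono) auto
      also have "\<dots> \<le> a\<^sup>2" by (simp add: m_def)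
      finally have ib: "Suc (Suc i) * b \<le> a\<^sup>2" .
      show ?thesis unfolding v_def \<tau>_def
        using ib by (intro szego_three_term[where \<kappa> = \<kappa> and \<eta> = \<eta>] z \<alpha> \<beta> \<kappa>(1) \<rho>(1) \<rho>\<kappa> b0 near small) auto
    qed
    have v0: "norm (v 0) = 1" by (simp add: nv norm_Pair)
    have v1: "1 \<le> norm (v 1)" "norm (v 1) \<le> exp (real b * A1)"
    proof -
      have "\<rho> ^ b \<le> norm (szego \<alpha> z (1, 0) b)"
        using norm_szp_ge[of z \<alpha> \<kappa> \<rho> b, OF z \<alpha> \<rho>(1) \<rho>\<kappa>] norm_szego_le_szp(1)[of z \<alpha> b, OF z \<alpha>1] by linarith
      then show "1 \<le> norm (v 1)" using \<rho> by (simp add: nv)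
      have "norm (szego \<alpha> z (1, 0) b) \<le> 2 ^ b" using szego_norm_bounds(1)[of z \<alpha> \<kappa> "(1,0)" b, OF z \<alpha> \<kappa>(1)] by (simp add: norm_Pair)
      then have "norm (v 1) \<le> (2 / \<rho>) ^ b" using \<rho> by (simp add: nv power_divide divide_right_mono)
      then show "norm (v 1) \<le> exp (real b * A1)" unfolding eA1 exp_of_nat_mult .
    qed
    have eb: "1 \<le> exp (real b * A1)" using A1 by simp
    have a1: "1 \<le> real a" using s1 unfolding as by (metis mult_mono' mult_1 zero_le_one)
    have "n \<le> m" unfolding n_def m_def using a1 by (intro div_le_mono) (simp add: power2_eq_square)
    define X where "X = norm \<tau> + 3"
    have X3: "X \<ge> 3" by (simp add: X_def)
    have vn: "norm (v n) \<le> X ^ n * exp (real b * A1)"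
      unfolding X_def using three_term_upper[of m v \<tau> "z ^ b" "exp (real b * A1)" n, OF rec] v0 v1 eb \<open>n \<le> m\<close> z
      by (simp add: norm_power)
    define \<Lambda> where "\<Lambda> = ln X"
    have \<Lambda>0: "\<Lambda> > 0" "X = exp \<Lambda>" using X3 by (auto simp: \<Lambda>_def)
    have gA: "g * real a \<le> 2 * (real b * A1) + real n * \<Lambda>"
    proof -
      have an: "a = n * b + a mod b" by (simp add: n_def)
      have "norm (szego \<alpha> z (1, 0) a) \<le> 2 ^ (a mod b) * norm (szego \<alpha> z (1, 0) (n * b))"
        by (subst an, subst szego_add, rule szego_norm_bounds(1)[OF z \<alpha> \<kappa>(1)])
      also have "\<dots> = 2 ^ (a mod b) * (\<rho> ^ (n * b) * norm (v n))" using \<rho> by (simp add: nv)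
      finally have "\<rho> ^ a * exp (g * real a) \<le> 2 ^ (a mod b) * (\<rho> ^ (n * b) * norm (v n))"
        using growth norm_szego_le_szp(1)[of z \<alpha> a, OF z \<alpha>1] by linarith
      also have "2 ^ (a mod b) = \<rho> ^ (a mod b) * (2 / \<rho>) ^ (a mod b)" using \<rho> by (simp add: power_divide)
      also have "\<rho> ^ (a mod b) * (2 / \<rho>) ^ (a mod b) * (\<rho> ^ (n * b) * norm (v n)) = \<rho> ^ (n * b + a mod b) * ((2 / \<rho>) ^ (a mod b) * norm (v n))"
        by (simp add: power_add)
      also have "\<rho> ^ (n * b + a mod b) = \<rho> ^ a" using an by simp
      finally have "exp (g * real a) \<le> (2 / \<rho>) ^ (a mod b) * norm (v n)" using \<rho> by simp
      also have "\<dots> \<le> exp (real b * A1) * (X ^ n * exp (real b * A1))"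
      proof (intro mult_mono vn)
        have "real (a mod b) * A1 \<le> real b * A1" using b0 A1 by (intro mult_right_mono) (auto simp: less_imp_le)
        then show "(2 / \<rho>) ^ (a mod b) \<le> exp (real b * A1)" unfolding eA1 exp_of_nat_mult[symmetric] by simp
      qed auto
      also have "\<dots> = exp (2 * (real b * A1) + real n * \<Lambda>)"
        unfolding \<Lambda>0(2) exp_of_nat_mult[symmetric] by (simp add: exp_add[symmetric])
      finally show ?thesis by simp
    qed
    \<comment> \<open>Discounts the incomplete block \<open>a mod b\<close> and the initial period,
      each worth at most \<open>real b * A1\<close>.\<close>
    define g' where "g' = g - 2 * (real b * A1) / real a"
    have g': "g0 / 2 \<le> g'" "g' \<le> g"
    proof -
      have "2 * (real b * A1) / real a \<le> 2 * (3 * s * A1) / real a"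
        using bs A1 a1 by (intro divide_right_mono) auto
      also have "\<dots> = 6 * A1 / s" using s1 by (simp add: as)
      also have "\<dots> \<le> g0 / 2" using X by blast
      finally show "g0 / 2 \<le> g'" using g by (simp add: g'_def)
      show "g' \<le> g" using A1 by (simp add: g'_def)
    qed
    have \<Lambda>g: "real b * g' \<le> \<Lambda>"
    proof -
      have "real n \<le> real a / real b" unfolding n_def by (rule of_nat_div_le_of_nat)
      then have "real n * \<Lambda> \<le> real a / real b * \<Lambda>" using \<Lambda>0 by (intro mult_right_mono) auto
      then have "g * real a - 2 * (real b * A1) \<le> real a / real b * \<Lambda>" using gA by linarith
      moreover have "g * real a - 2 * (real b * A1) = real a * g'" using a1 by (simp add: g'_def field_simps)
      ultimately have "real b * (real a * g') \<le> real b * (real a / real b * \<Lambda>)" by (intro mult_left_mono) auto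
      then have "real a * (real b * g') \<le> real a * \<Lambda>" using b0 by (simp add: mult_ac)
      then show ?thesis using a1 by simp
    qed
    have bg: "3 \<le> real b * g'"
    proof -
      have "3 \<le> s * (g0 / 2)" using X by blast
      also have "\<dots> \<le> real b * g'" using bs g' g0 s1 by (intro mult_mono) auto
      finally show ?thesis .
    qed
    \<comment> \<open>This gives \<open>norm \<tau> - 3 = X - 6 \<ge> X / 2\<close>, so passing from
      the upper to the lower bound costs only \<open>ln 2 \<le> 1\<close> per period.\<close>
    have X12: "12 \<le> X"
    proof -
      have "(12::real) \<le> exp 3"
      proof -
        have "(2.5::real) \<le> exp 1" using exp_lower_Taylor_quadratic[of 1] by simp
        then have "(2.5::real) ^ 3 \<le> exp 1 ^ 3" by (intro power_mono) auto
        moreover have "exp 1 ^ 3 = exp (3::real)" using exp_of_nat_mult[of 3 "1::real"] by simp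
        ultimately show ?thesis by (simp add: power3_eq_cube)
      qed
      also have "\<dots> \<le> exp \<Lambda>" using bg \<Lambda>g by simp
      finally show ?thesis using \<Lambda>0 by simp
    qed
    have mb: "real (a\<^sup>2) / real b - 1 \<le> real m"
    proof -
      have "a\<^sup>2 = m * b + a\<^sup>2 mod b" by (simp add: m_def)
      then have "a\<^sup>2 \<le> m * b + b" using b0 by (metis add_left_mono less_imp_le mod_less_divisor)
      then have "real (a\<^sup>2) \<le> real (m * b + b)" by (rule of_nat_mono)
      then show ?thesis using b0 by (simp add: field_simps)
    qed
    have m1: "1 \<le> m"
    proof -
      have "b \<le> a\<^sup>2 \<or> a\<^sup>2 < b" by linarith
      moreover have "real b \<le> real (a\<^sup>2)"
      proof -
        have "3 * s \<le> s * s * s * s" using X s1 by (simp add: power3_eq_cube)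
        then show ?thesis using bs by (simp add: as power2_eq_square)
      qed
      ultimately have "b \<le> a\<^sup>2" by simp
      then show ?thesis unfolding m_def using b0 by (simp add: div_greater_zero_iff Suc_le_eq)
    qed
    have vm: "exp ((real m - 1) * (real b * g' - 1)) \<le> norm (v m)"
    proof -
      have "real b * g' - 1 \<le> \<Lambda> - ln 2" using \<Lambda>g ln_le_minus_one[of 2] by simp
      then have "exp (real b * g' - 1) \<le> exp (\<Lambda> - ln 2)" by simp
      also have "\<dots> = X / 2" using \<Lambda>0 by (simp add: exp_diff)
      also have "\<dots> \<le> norm \<tau> - 3" using X12 by (simp add: X_def)
      finally have "exp (real b * g' - 1) ^ (m - 1) \<le> (norm \<tau> - 3) ^ (m - 1)" by (intro power_mono) auto
      then have "exp ((real m - 1) * (real b * g' - 1)) \<le> (norm \<tau> - 3) ^ (m - 1) * 1"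
        using m1 by (simp add: exp_of_nat_mult[symmetric] of_nat_diff)
      also have "\<dots> \<le> (norm \<tau> - 3) ^ (m - 1) * norm (v 1)" using v1 X12 by (intro mult_left_mono) (auto simp: X_def)
      also have "\<dots> \<le> norm (v (Suc (m - 1)))"
        using three_term_lower[of m v \<tau> "z ^ b" "m - 1", OF rec] v0 v1 X12 m1 z by (simp add: X_def norm_power)
      finally show ?thesis using m1 by simp
    qed
    have low: "\<rho> ^ (a\<^sup>2) * (exp (- (real b * A2)) * norm (v m)) \<le> 2 * norm (szp \<alpha> (a\<^sup>2) z)"
    proof -
      have an: "a\<^sup>2 = m * b + a\<^sup>2 mod b" by (simp add: m_def)
      have "exp (- (real b * A2)) \<le> exp (- (real (a\<^sup>2 mod b) * A2))"
        using b0 A2 by (simp add: mult_right_mono less_imp_le)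
      also have "\<dots> = (1 - \<kappa>) ^ (a\<^sup>2 mod b)" unfolding A2(2) exp_of_nat_mult[symmetric] by simp
      finally have 1: "exp (- (real b * A2)) \<le> (1 - \<kappa>) ^ (a\<^sup>2 mod b)" .
      have 2: "\<rho> ^ (a\<^sup>2) \<le> \<rho> ^ (m * b)" using \<rho> \<rho>1 by (intro power_decreasing) (auto simp: m_def)
      have "\<rho> ^ (a\<^sup>2) * (exp (- (real b * A2)) * norm (v m)) \<le> \<rho> ^ (m * b) * ((1 - \<kappa>) ^ (a\<^sup>2 mod b) * norm (v m))"
        using 1 2 \<rho> \<kappa> by (intro mult_mono) auto
      also have "\<dots> = (1 - \<kappa>) ^ (a\<^sup>2 mod b) * norm (szego \<alpha> z (1, 0) (m * b))" using \<rho> by (simp add: nv)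
      also have "\<dots> \<le> norm (szego (\<lambda>i. \<alpha> (m * b + i)) z (szego \<alpha> z (1, 0) (m * b)) (a\<^sup>2 mod b))"
        by (rule szego_norm_bounds(2)[OF z \<alpha> \<kappa>(1)])
      also have "\<dots> = norm (szego \<alpha> z (1, 0) (a\<^sup>2))" unfolding szego_add[symmetric] an[symmetric] ..
      also have "\<dots> \<le> 2 * norm (szp \<alpha> (a\<^sup>2) z)" by (rule norm_szego_le_szp(2)[of z \<alpha>, OF z \<alpha>1])
      finally show ?thesis .
    qed
    have gA1: "g \<le> A1"
    proof -
      have "norm (szp \<alpha> a z) \<le> 2 ^ a"
        using norm_szego_le_szp(1)[of z \<alpha> a, OF z \<alpha>1] szego_norm_bounds(1)[of z \<alpha> \<kappa> "(1,0)" a, OF z \<alpha> \<kappa>(1)] by (simp add: norm_Pair)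
      then have "\<rho> ^ a * exp (g * real a) \<le> \<rho> ^ a * (2 / \<rho>) ^ a" using growth \<rho> by (simp add: power_divide)
      then have "exp (g * real a) \<le> exp (real a * A1)" using \<rho> unfolding eA1 exp_of_nat_mult[symmetric] by simp
      then show ?thesis using a1 by (simp add: mult.commute)
    qed
    have key: "(g - C / s) * real (a\<^sup>2) \<le> - (real b * A2) + (real m - 1) * (real b * g' - 1) - 1"
    proof -
      have aa: "real (a\<^sup>2) = real a * (s * s)" by (simp add: as power2_eq_square)
      have "(real (a\<^sup>2) / real b - 2) * (real b * g' - 1) \<le> (real m - 1) * (real b * g' - 1)"
        using mb bg by (intro mult_right_mono) auto
      moreover have "(real (a\<^sup>2) / real b - 2) * (real b * g' - 1) = real (a\<^sup>2) * g' - real (a\<^sup>2) / real b - 2 * (real b * g') + 2"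
        using b0 by (simp add: field_simps)
      moreover have "real (a\<^sup>2) * g' = real (a\<^sup>2) * g - 2 * real a * (real b * A1)"
        using a1 by (simp add: g'_def power2_eq_square field_simps)
      moreover have "2 * real a * (real b * A1) \<le> 2 * real a * (3 * s * A1)"
        using bs A1 by (intro mult_left_mono mult_right_mono) auto
      moreover have "real (a\<^sup>2) / real b \<le> real (a\<^sup>2) / s" using bs s1 by (intro divide_left_mono) auto
      moreover have "real (a\<^sup>2) / s = real a * s" unfolding aa using s1 by simp
      moreover have "2 * (real b * g') \<le> 2 * (3 * s * A1)" using bs g' gA1 bg g0 A1 s1 by (intro mult_left_mono mult_mono) auto
      moreover have "1 * (2 * (3 * s * A1)) \<le> real a * (2 * (3 * s * A1))" using a1 A1 s1 by (intro mult_right_mono) auto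
      moreover have "real b * A2 \<le> 3 * s * A2" using bs A2 by (intro mult_right_mono) auto
      moreover have "1 * (3 * s * A2) \<le> real a * (3 * s * A2)" using a1 A2 s1 by (intro mult_right_mono) auto
      moreover have "(g - C / s) * real (a\<^sup>2) = real (a\<^sup>2) * g - C * (real a * s)"
        unfolding aa using s1 by (simp add: field_simps)
      moreover have "C * (real a * s) = 2 * real a * (3 * s * A1) + real a * s + real a * (2 * (3 * s * A1)) + real a * (3 * s * A2)"
        by (simp add: C_def algebra_simps)
      ultimately show ?thesis by linarith
    qed
    have "2 \<le> exp (1::real)" using exp_ge_add_one_self[of 1] by simp
    have "exp ((g - C / s) * real (a\<^sup>2)) \<le> exp (- (real b * A2) + (real m - 1) * (real b * g' - 1) - 1)" using key by simp
    also have "\<dots> = exp (- (real b * A2)) * exp ((real m - 1) * (real b * g' - 1)) / exp 1" by (simp only: exp_add exp_diff)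
    also have "\<dots> \<le> exp (- (real b * A2)) * norm (v m) / 2"
      using vm \<open>2 \<le> exp 1\<close> by (intro frac_le mult_left_mono) auto
    finally have "\<rho> ^ (a\<^sup>2) * exp ((g - C / s) * real (a\<^sup>2)) \<le> \<rho> ^ (a\<^sup>2) * (exp (- (real b * A2)) * norm (v m) / 2)"
      using \<rho> by (intro mult_left_mono) auto
    also have "\<dots> \<le> norm (szp \<alpha> (a\<^sup>2) z)" using low by simp
    finally show "\<rho> ^ (a\<^sup>2) * exp ((g - C / sqrt (real a)) * real (a\<^sup>2)) \<le> norm (szp \<alpha> (a\<^sup>2) z)"
      by (simp add: s_def)
  qed
qed

section \<open>Chains of scales\<close>

text \<open>Growth at a quarter of the typical rate \<open>- ln \<rho>\<close>, plus a margin \<open>a powr (-1/4)\<close> that pays for the losses in later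
  steps \<open>a \<mapsto> a\<^sup>2\<close>.\<close>

definition good_scale :: "(nat \<Rightarrow> complex) \<Rightarrow> real \<Rightarrow> nat \<Rightarrow> real \<Rightarrow> bool" where
  "good_scale \<alpha> \<rho> a t \<longleftrightarrow> \<rho> ^ a * exp ((- ln \<rho> / 4 + real a powr (-1/4)) * real a) \<le> norm (szp \<alpha> a (ec t))"

lemma chain_asymp:
  assumes "(L::real) > 0"
  shows "eventually (\<lambda>x::real. x powr (-1/4) \<le> L / 4) at_top"
    using assms by real_asymp
lemma chain_asymp2:
  "eventually (\<lambda>x::real. (C + 1) / sqrt x \<le> x powr (-1/4)) at_top"
    by real_asymp
lemma chain_asymp3:
  assumes "c > 0"
  shows "eventually (\<lambda>x::real. x\<^sup>2 \<le> exp (c * x)) at_top" "eventually (\<lambda>x::real. exp (c / 8 * x) + 1 \<le> exp (c / 4 * x)) at_top"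
    using assms by - real_asymp+

text \<open>Dirichlet's theorem with denominators up to about \<open>exp (c / 4 * a)\<close> leaves
  two cases. A denominator \<open>q \<ge> sqrt a\<close> gives growth afresh at
  \<open>q ^ 4\<close>, at the price of an exceptional set. A smaller one approximates so well that
  a multiple of it near \<open>sqrt a\<close> serves as the period in
  \<open>periodic_growth\<close>.\<close>

lemma chain_step:
  fixes k :: nat and \<omega> :: real and l :: complex
  assumes k: "k \<ge> 2" and l: "norm l < 1" "0 < norm l" and c: "c > 0" and \<rho>: "\<rho> > 0" "\<rho>\<^sup>2 = 1 - (norm l)\<^sup>2"
  defines "\<alpha> \<equiv> \<lambda>n. l * ec (\<omega> * real n ^ k)"
  shows "\<exists>C > 0. \<exists>a0. (\<forall>a\<ge>a0. \<exists>a' B. a\<^sup>2 \<le> a' \<and> real a' \<le> exp (c * real a) \<and> closed B \<and> B \<subseteq> {0..1} \<and>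
      measure lebesgue B \<le> C * ln (real a) powr (-1/6) \<and>
      (\<forall>t\<in>{0..1} - B. good_scale \<alpha> \<rho> a t \<longrightarrow> good_scale \<alpha> \<rho> a' t)) \<and>
     (\<forall>q\<ge>a0. \<forall>p::int. coprime p (int q) \<longrightarrow> \<bar>\<omega> - of_int p / real q\<bar> \<le> 1 / (real q)\<^sup>2 \<longrightarrow>
       (\<exists>B. closed B \<and> B \<subseteq> {0..1} \<and> measure lebesgue B \<le> C * ln (real q) powr (-1/6) \<and>
         (\<forall>t\<in>{0..1} - B. good_scale \<alpha> \<rho> (q ^ 4) t)))"
proof -
  define L where "L = - ln \<rho>"
  have "\<rho>\<^sup>2 < 1\<^sup>2" using \<rho> l by simp
  then have "\<rho> < 1" by (rule power_less_imp_less_base) simp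
  then have L: "L > 0" "\<rho> = exp (- L)" using \<rho> by (auto simp: L_def)
  have \<alpha>: "norm (\<alpha> i) < 1" for i using l by (simp add: \<alpha>_def norm_mult)
  \<comment> \<open>Typically \<open>szp\<close> has modulus near 1, so the normalised entry grows
    at rate \<open>L\<close>. Giving away \<open>L / 2\<close> leaves room for the rate
    \<open>L / 4\<close> and a margin of at most \<open>L / 4\<close> in
    \<open>good_scale\<close>.\<close>
  have "L / 2 > 0" using L by simp
  from small_szp_measure[OF k l this, of \<omega>]
  obtain C1 q0 where C1: "C1 > 0" and ld: "\<And>q p. q \<ge> q0 \<Longrightarrow> coprime p (int q) \<Longrightarrow> \<bar>\<omega> - of_int p / real q\<bar> \<le> 1 / (real q)\<^sup>2 \<Longrightarrow>
     measure lebesgue {t \<in> {0..1}. norm (szp \<alpha> (q ^ 4) (ec t)) \<le> exp (- (L / 2 * real (q ^ 4)))} \<le> C1 * ln (real q) powr (-1/6)"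
    unfolding \<alpha>_def by blast
  have "c / 8 > 0" "L / 4 > 0" using c L by auto
  from periodic_growth[OF l this \<rho>, of \<omega> k]
  obtain C2 a1 where C2: "C2 > 0" and pg: "\<And>a b p z g. a \<ge> a1 \<Longrightarrow> sqrt (real a) \<le> real b \<Longrightarrow> real b \<le> 3 * sqrt (real a) \<Longrightarrow>
     \<bar>\<omega> - of_int p / real b\<bar> \<le> exp (- (c / 8 * real a)) \<Longrightarrow> norm z = 1 \<Longrightarrow> L / 4 \<le> g \<Longrightarrow>
     \<rho> ^ a * exp (g * real a) \<le> norm (szp \<alpha> a z) \<Longrightarrow>
     \<rho> ^ (a\<^sup>2) * exp ((g - C2 / sqrt (real a)) * real (a\<^sup>2)) \<le> norm (szp \<alpha> (a\<^sup>2) z)"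
    unfolding \<alpha>_def by metis
  have "eventually (\<lambda>x::real. (1 \<le> x \<and> x powr (-1/4) \<le> L / 4) \<and> (C2 + 1) / sqrt x \<le> x powr (-1/4) \<and>
      x\<^sup>2 \<le> exp (c * x) \<and> exp (c / 8 * x) + 1 \<le> exp (c / 4 * x)) at_top"
    using L c by (intro eventually_conj chain_asymp chain_asymp2 chain_asymp3 eventually_ge_at_top) auto
  then obtain x0 where x0: "\<And>x::real. x0 \<le> x \<Longrightarrow> (1 \<le> x \<and> x powr (-1/4) \<le> L / 4) \<and> (C2 + 1) / sqrt x \<le> x powr (-1/4) \<and>
      x\<^sup>2 \<le> exp (c * x) \<and> exp (c / 8 * x) + 1 \<le> exp (c / 4 * x)"
    unfolding eventually_at_top_linorder by blast
  define a0 where "a0 = Max {q0\<^sup>2, a1, nat \<lceil>x0\<rceil>, 4}"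
  have a0: "q0\<^sup>2 \<le> a0" "a1 \<le> a0" "nat \<lceil>x0\<rceil> \<le> a0" "4 \<le> a0" unfolding a0_def by (intro Max_ge; simp)+
  have q0a: "q0 \<le> a0" using a0(1) by (cases "q0 = 0") (auto simp: power2_eq_square intro: order_trans[of q0 "q0 * q0"])
  have fresh: "closed B \<and> B \<subseteq> {0..1} \<and> measure lebesgue B \<le> C1 * ln (real q) powr (-1/6) \<and>
         (\<forall>t\<in>{0..1} - B. good_scale \<alpha> \<rho> (q ^ 4) t)"
    if q: "q0 \<le> q" "x0 \<le> real (q ^ 4)" and cop: "coprime p (int q)" and app: "\<bar>\<omega> - of_int p / real q\<bar> \<le> 1 / (real q)\<^sup>2"
      and B: "B = {t \<in> {0..1}. norm (szp \<alpha> (q ^ 4) (ec t)) \<le> exp (- (L / 2 * real (q ^ 4)))}" for q p B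
  proof (intro conjI ballI)
    show "closed B" unfolding B by (intro continuous_on_closed_Collect_le continuous_intros) auto
    show "B \<subseteq> {0..1}" by (auto simp: B)
    show "measure lebesgue B \<le> C1 * ln (real q) powr (-1/6)" unfolding B by (rule ld[OF q(1) cop app])
    fix t assume "t \<in> {0..1} - B"
    then have t: "exp (- (L / 2 * real (q ^ 4))) < norm (szp \<alpha> (q ^ 4) (ec t))" by (auto simp: B)
    have "\<rho> ^ (q ^ 4) * exp ((L / 4 + real (q ^ 4) powr (-1/4)) * real (q ^ 4))
        = exp ((- L + L / 4 + real (q ^ 4) powr (-1/4)) * real (q ^ 4))"
      unfolding L(2) by (simp add: exp_of_nat_mult[symmetric] exp_add[symmetric] algebra_simps)
    also have "\<dots> \<le> exp ((- L / 2) * real (q ^ 4))"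
      unfolding exp_le_cancel_iff using x0[OF q(2)] L by (intro mult_right_mono) auto
    finally show "good_scale \<alpha> \<rho> (q ^ 4) t" using t by (simp add: good_scale_def L_def)
  qed
  define C where "C = 2 * C1"
  show ?thesis
  proof (rule exI[of _ C], rule conjI, goal_cases)
    case 1
    show ?case using C1 by (simp add: C_def)
  next
    case 2
    show ?case
    proof (rule exI[of _ a0], intro conjI allI impI, goal_cases)
    case (2 q p)
    then have q: "a0 \<le> q" and cop: "coprime p (int q)" and app: "\<bar>\<omega> - of_int p / real q\<bar> \<le> 1 / (real q)\<^sup>2" by auto
    have "x0 \<le> real q" using q a0(3) by linarith
    also have "real q \<le> real (q ^ 4)" using q a0(4) by (simp add: self_le_power)
    finally have "x0 \<le> real (q ^ 4)" .
    then obtain B where "closed B \<and> B \<subseteq> {0..1} \<and> measure lebesgue B \<le> C1 * ln (real q) powr (-1/6) \<and>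
         (\<forall>t\<in>{0..1} - B. good_scale \<alpha> \<rho> (q ^ 4) t)"
      using fresh[OF _ _ cop app refl] q q0a by (meson order_trans)
    moreover have "C1 * ln (real q) powr (-1/6) \<le> C * ln (real q) powr (-1/6)"
      using C1 by (intro mult_right_mono) (auto simp: C_def)
    ultimately show ?case by (meson order_trans)
  next
    case (1 a)
    then have a: "a0 \<le> a" by simp
    have xa: "x0 \<le> real a" using a a0(3) by linarith
    note X = x0[OF xa]
    have a1: "1 \<le> real a" using X by blast
    define s where "s = sqrt (real a)"
    have ss: "s * s = real a" by (simp add: s_def)
    have a4: "4 \<le> a" using a a0 by linarith
    have s2: "2 \<le> s" unfolding s_def using a4 by (intro real_le_rsqrt) auto
    have q0s: "real q0 \<le> s" unfolding s_def using a a0(1) by (intro real_le_rsqrt) (metis of_nat_le_iff of_nat_power order_trans)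
    \<comment> \<open>The quarter in the exponent keeps \<open>q ^ 4\<close> below
      \<open>exp (c * a)\<close>, the limit for the next scale.\<close>
    define Q where "Q = nat \<lfloor>exp (c / 4 * real a)\<rfloor>"
    have Q: "exp (c / 8 * real a) \<le> real Q" "real Q \<le> exp (c / 4 * real a)"
    proof -
      show "real Q \<le> exp (c / 4 * real a)" unfolding Q_def by (rule of_nat_floor) simp
      show "exp (c / 8 * real a) \<le> real Q" using X unfolding Q_def by linarith
    qed
    have "0 < real Q" using Q(1) by (meson exp_gt_zero less_le_trans)
    then have "Q > 0" by simp
    then obtain h k' where hk: "coprime h k'" "0 < k'" "k' \<le> int Q" "\<bar>of_int k' * \<omega> - of_int h\<bar> < 1 / real Q"
      by (rule Dirichlet_approx_coprime)
    define q where "q = nat k'"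
    have q: "0 < q" "q \<le> Q" "int q = k'" using hk by (auto simp: q_def)
    have app0: "\<bar>\<omega> - of_int h / real q\<bar> \<le> 1 / (real q * real Q)"
    proof -
      have rk: "real_of_int k' = real q" using q(3) by (metis of_int_of_nat_eq)
      have "\<bar>\<omega> - of_int h / real q\<bar> = \<bar>(real q * \<omega> - of_int h) / real q\<bar>" using q by (simp add: field_simps)
      also have "\<dots> = \<bar>real q * \<omega> - of_int h\<bar> / real q" by simp
      also have "\<dots> \<le> (1 / real Q) / real q" using hk(4) q(1) rk by (intro divide_right_mono) auto
      finally show ?thesis by (simp add: mult.commute)
    qed
    show ?case
    proof (cases "s \<le> real q")
      case True
      have aq: "a \<le> q\<^sup>2"
      proof -
        have "real a \<le> real q * real q" unfolding ss[symmetric] using True s2 by (intro mult_mono) auto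
        then show ?thesis by (metis of_nat_le_iff of_nat_mult power2_eq_square)
      qed
      have "1 / (real q * real Q) \<le> 1 / (real q)\<^sup>2"
        using q by (auto simp: power2_eq_square intro!: divide_left_mono)
      then have app: "\<bar>\<omega> - of_int h / real q\<bar> \<le> 1 / (real q)\<^sup>2" using app0 by linarith
      have q4: "a\<^sup>2 \<le> q ^ 4" using power_mono[OF aq, of 2] by (simp add: power_mult[symmetric])
      have "a \<le> a\<^sup>2" using a4 by (simp add: power2_eq_square)
      then have xq: "x0 \<le> real (q ^ 4)" using xa q4 by (meson of_nat_le_iff order_trans)
      have q0q: "q0 \<le> q" using True q0s by linarith
      have cop: "coprime h (int q)" using hk(1) q(3) by simp
      obtain B where B: "closed B" "B \<subseteq> {0..1}" "measure lebesgue B \<le> C1 * ln (real q) powr (-1/6)"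
         "\<forall>t\<in>{0..1} - B. good_scale \<alpha> \<rho> (q ^ 4) t"
        using fresh[OF q0q xq cop app refl] by (elim conjE) (rule that)
      have "ln (real q) powr (-1/6) \<le> 2 * ln (real a) powr (-1/6)"
      proof -
        have "ln (real a) \<le> ln (real (q\<^sup>2))" using aq a4 q(1) by (subst ln_le_cancel_iff) auto
        then have le: "ln (real a) / 2 \<le> ln (real q)" using q by (simp add: ln_realpow)
        have la: "0 < ln (real a)" using a4 by (intro ln_gt_zero) auto
        have "ln (real q) powr (-1/6) \<le> (ln (real a) / 2) powr (-1/6)"
          using le la by (intro powr_mono2') auto
        also have "\<dots> = ln (real a) powr (-1/6) * 2 powr (1/6)" using la by (simp add: powr_divide powr_minus field_simps)
        also have "\<dots> \<le> ln (real a) powr (-1/6) * 2" using powr_mono[of "1/6" 1 "2::real"] by (intro mult_left_mono) auto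
        finally show ?thesis by simp
      qed
      then have "C1 * ln (real q) powr (-1/6) \<le> C1 * (2 * ln (real a) powr (-1/6))" using C1 by (intro mult_left_mono) auto
      then have mB: "measure lebesgue B \<le> C * ln (real a) powr (-1/6)" using B(3) by (simp add: C_def)
      have "real (q ^ 4) \<le> real Q ^ 4" using q by (simp add: power_mono)
      also have "\<dots> \<le> exp (c / 4 * real a) ^ 4" using Q by (intro power_mono) auto
      also have "\<dots> = exp (c * real a)" by (simp add: exp_of_nat_mult[symmetric])
      finally show ?thesis using q4 B mB by blast
    next
      case False
      \<comment> \<open>A multiple of \<open>q\<close> is again a period; the first one not below
        \<open>s\<close> is at most \<open>s + q\<close>, hence less than
        \<open>2 * s\<close>.\<close>
      define m where "m = nat \<lceil>s / real q\<rceil>"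
      define b where "b = q * m"
      have m: "s / real q \<le> real m" "real m \<le> s / real q + 1" using s2 q unfolding m_def by (auto simp: of_nat_nat)
      have b: "s \<le> real b" "real b \<le> s + real q" using m q(1) by (auto simp: b_def field_simps)
      have m0: "m > 0" using b s2 by (cases m) (auto simp: b_def)
      have "of_int (h * int m) / real b = of_int h / real q" using m0 q by (simp add: b_def)
      moreover have "1 / (real q * real Q) \<le> exp (- (c / 8 * real a))"
      proof -
        have "1 / (real q * real Q) \<le> 1 / real Q" using q \<open>0 < real Q\<close> by (intro divide_left_mono) auto
        also have "\<dots> \<le> 1 / exp (c / 8 * real a)" using Q \<open>0 < real Q\<close> by (intro divide_left_mono) auto
        finally show ?thesis by (simp add: exp_minus inverse_eq_divide)
      qed
      ultimately have app: "\<bar>\<omega> - of_int (h * int m) / real b\<bar> \<le> exp (- (c / 8 * real a))" using app0 by simp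
      define g where "g = L / 4 + real a powr (-1/4)"
      have "good_scale \<alpha> \<rho> (a\<^sup>2) t" if "good_scale \<alpha> \<rho> a t" for t
      proof -
        have "\<rho> ^ a * exp (g * real a) \<le> norm (szp \<alpha> a (ec t))" using that by (simp add: good_scale_def g_def L_def)
        then have 1: "\<rho> ^ (a\<^sup>2) * exp ((g - C2 / s) * real (a\<^sup>2)) \<le> norm (szp \<alpha> (a\<^sup>2) (ec t))"
          unfolding s_def using a a0 b False app by (intro pg[of a b "h * int m"]) (auto simp: s_def g_def)
        have "real (a\<^sup>2) powr (-1/4) = 1 / s"
        proof -
          have "real (a\<^sup>2) = real a powr 2" using a1 by simp
          then have "real (a\<^sup>2) powr (-1/4) = (real a powr 2) powr (-1/4)" by (simp only:)
          also have "\<dots> = real a powr (- (1/2))" unfolding powr_powr by simp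
          also have "\<dots> = 1 / s" by (simp add: powr_minus powr_half_sqrt s_def inverse_eq_divide)
          finally show ?thesis .
        qed
        moreover have "(C2 + 1) / s \<le> real a powr (-1/4)" using X by (simp add: s_def)
        \<comment> \<open>The old margin \<open>a powr (-1/4)\<close> pays both for the loss
          \<open>C2 / s\<close> and for the new margin, which is \<open>1 / s\<close>.\<close>
        ultimately have "L / 4 + real (a\<^sup>2) powr (-1/4) \<le> g - C2 / s" by (simp add: g_def add_divide_distrib)
        then have "(L / 4 + real (a\<^sup>2) powr (-1/4)) * real (a\<^sup>2) \<le> (g - C2 / s) * real (a\<^sup>2)" by (intro mult_right_mono) auto
        then have "\<rho> ^ (a\<^sup>2) * exp ((L / 4 + real (a\<^sup>2) powr (-1/4)) * real (a\<^sup>2)) \<le> \<rho> ^ (a\<^sup>2) * exp ((g - C2 / s) * real (a\<^sup>2))"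
          using \<rho> by (intro mult_left_mono) auto
        then show ?thesis using 1 by (simp add: good_scale_def L_def)
      qed
      moreover have "real (a\<^sup>2) \<le> exp (c * real a)" using X by simp
      moreover have "0 \<le> C * ln (real a) powr (-1/6)" using C1 by (simp add: C_def)
      ultimately show ?thesis by (intro exI[of _ "a\<^sup>2"] exI[of _ "{}"]) auto
    qed
    qed
  qed
qed

lemma chain_powr_tendsto: "((\<lambda>x::real. K * ln x powr (-1/6)) \<longlongrightarrow> 0) at_top"
  by real_asymp

text \<open>Each step at least squares the scale, so \<open>ln (a j)\<close> doubles and the
  exceptional measures decay geometrically with ratio \<open>2 powr (-1/6)\<close>. Irrationality
  supplies arbitrarily large denominators to start from, which makes their total as small as
  desired.\<close>

theorem scale_chain:
  fixes k :: nat and \<omega> :: real and l :: complex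
  assumes k: "k \<ge> 2" and \<omega>: "\<omega> \<notin> \<rat>" and l: "norm l < 1" "0 < norm l" and c: "c > 0" and \<rho>: "\<rho> > 0" "\<rho>\<^sup>2 = 1 - (norm l)\<^sup>2"
    and \<epsilon>: "\<epsilon> > 0"
  defines "\<alpha> \<equiv> \<lambda>n. l * ec (\<omega> * real n ^ k)"
  obtains a :: "nat \<Rightarrow> nat" and B :: "nat \<Rightarrow> real set"
  where "K \<le> a 0" "\<forall>j. (a j)\<^sup>2 \<le> a (Suc j)" "\<forall>j. real (a (Suc j)) \<le> exp (c * real (a j))"
    "\<forall>j. closed (B j)" "\<forall>j. B j \<subseteq> {0..1}" "\<forall>n. (\<Sum>j<n. measure lebesgue (B j)) \<le> \<epsilon>"
    "\<forall>t\<in>{0..1}. (\<forall>i. t \<notin> B i) \<longrightarrow> (\<forall>j. good_scale \<alpha> \<rho> (a j) t)"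
proof -
  obtain C a0 where C: "C > 0"
    and step: "\<forall>a\<ge>a0. \<exists>a' B. a\<^sup>2 \<le> a' \<and> real a' \<le> exp (c * real a) \<and> closed B \<and> B \<subseteq> {0..1} \<and>
      measure lebesgue B \<le> C * ln (real a) powr (-1/6) \<and>
      (\<forall>t\<in>{0..1} - B. good_scale \<alpha> \<rho> a t \<longrightarrow> good_scale \<alpha> \<rho> a' t)"
    and base: "\<forall>q\<ge>a0. \<forall>p::int. coprime p (int q) \<longrightarrow> \<bar>\<omega> - of_int p / real q\<bar> \<le> 1 / (real q)\<^sup>2 \<longrightarrow>
       (\<exists>B. closed B \<and> B \<subseteq> {0..1} \<and> measure lebesgue B \<le> C * ln (real q) powr (-1/6) \<and>
         (\<forall>t\<in>{0..1} - B. good_scale \<alpha> \<rho> (q ^ 4) t))"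
    using chain_step[OF k l c \<rho>, of \<omega>, folded \<alpha>_def] by (elim exE conjE) (rule that)
  obtain f F where fF: "\<And>a. a0 \<le> a \<Longrightarrow> a\<^sup>2 \<le> f a \<and> real (f a) \<le> exp (c * real a) \<and> closed (F a) \<and> F a \<subseteq> {0..1} \<and>
      measure lebesgue (F a) \<le> C * ln (real a) powr (-1/6) \<and>
      (\<forall>t\<in>{0..1} - F a. good_scale \<alpha> \<rho> a t \<longrightarrow> good_scale \<alpha> \<rho> (f a) t)"
    using step by metis
  define r where "r = (2::real) powr (-1/6)"
  have r: "0 < r" "r < 1" unfolding r_def using powr_less_mono[of "-1/6" 0 "2::real"] by auto
  have "eventually (\<lambda>x::real. C * (1 + 1 / (1 - r)) * ln x powr (-1/6) < \<epsilon>) at_top"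
    using chain_powr_tendsto \<epsilon> by (rule order_tendstoD(2))
  then obtain x0 where x0: "\<And>x::real. x0 \<le> x \<Longrightarrow> C * (1 + 1 / (1 - r)) * ln x powr (-1/6) < \<epsilon>"
    unfolding eventually_at_top_linorder by blast
  have "infinite (approx_set \<omega>)" using \<omega> rational_iff_finite_approx_set by blast
  then obtain h k' where hk: "(h, k') \<in> approx_set \<omega>" "int (Max {a0, K, nat \<lceil>x0\<rceil>, 2}) < k'"
    using infinite_approx_set by blast
  define q where "q = nat k'"
  have k'0: "0 < k'" using hk(2) by (smt (verit) of_nat_0_le_iff)
  then have qk: "int q = k'" by (simp add: q_def)
  have "Max {a0, K, nat \<lceil>x0\<rceil>, 2} < q" using hk(2) qk by linarith
  then have mx: "a0 < q" "K < q" "nat \<lceil>x0\<rceil> < q" "2 < q" by simp_all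
  have q: "a0 \<le> q" "K \<le> q" "nat \<lceil>x0\<rceil> \<le> q" "2 \<le> q" by (rule less_imp_le, rule mx)+
  have "coprime h (int q)" "\<bar>\<omega> - of_int h / real q\<bar> \<le> 1 / (real q)\<^sup>2"
    using hk(1) qk by (auto simp: approx_set_def)
  from base[rule_format, OF q(1) this] obtain B0 where B0: "closed B0" "B0 \<subseteq> {0..1}" "measure lebesgue B0 \<le> C * ln (real q) powr (-1/6)"
      "\<forall>t\<in>{0..1} - B0. good_scale \<alpha> \<rho> (q ^ 4) t" by (elim exE conjE) (rule that)
  define a where "a j = (f ^^ j) (q ^ 4)" for j
  define B where "B j = (case j of 0 \<Rightarrow> B0 | Suc i \<Rightarrow> F (a i))" for j
  have a_Suc: "a (Suc j) = f (a j)" for j by (simp add: a_def)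
  have q4: "q \<le> q ^ 4" using q by (simp add: self_le_power)
  have a_ge: "q \<le> a j" for j
  proof (induction j)
    case 0 then show ?case using q4 by (simp add: a_def)
  next
    case (Suc j)
    have "a j \<le> (a j)\<^sup>2" using Suc q by (simp add: power2_eq_square)
    also have "\<dots> \<le> f (a j)" using fF[of "a j"] Suc q by auto
    finally show ?case using Suc a_Suc by simp
  qed
  have a0j: "a0 \<le> a j" for j using a_ge[of j] q by linarith
  have lnq: "0 < ln (real q)" using q by (intro ln_gt_zero) auto
  have ln_a: "2 ^ j * ln (real q) \<le> ln (real (a j))" for j
  proof (induction j)
    case 0
    have "ln (real q) \<le> ln (real (q ^ 4))" using q q4 by (subst ln_le_cancel_iff) (auto simp del: of_nat_power)
    then show ?case by (simp add: a_def)
  next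
    case (Suc j)
    have ap: "0 < a j" using a_ge[of j] q by linarith
    have fp: "0 < f (a j)" using fF[OF a0j, of j] ap by (metis less_le_trans zero_less_power)
    have "2 ^ Suc j * ln (real q) \<le> 2 * ln (real (a j))" using Suc by simp
    also have "\<dots> = ln (real ((a j)\<^sup>2))" using ap by (simp add: ln_realpow)
    also have "\<dots> \<le> ln (real (f (a j)))" using fF[OF a0j, of j] ap fp by (subst ln_le_cancel_iff) (auto simp del: of_nat_power)
    finally show ?case by (simp add: a_Suc)
  qed
  have mF: "measure lebesgue (F (a j)) \<le> C * ln (real q) powr (-1/6) * r ^ j" for j
  proof -
    have "ln (real (a j)) powr (-1/6) \<le> (2 ^ j * ln (real q)) powr (-1/6)"
      using ln_a[of j] lnq by (intro powr_mono2') auto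
    also have "\<dots> = (2 ^ j) powr (-1/6) * ln (real q) powr (-1/6)" using lnq by (intro powr_mult)
    also have "(2 ^ j) powr (-1/6) = r ^ j"
      unfolding r_def by (simp add: powr_realpow[symmetric] powr_powr mult.commute)
    finally have "C * ln (real (a j)) powr (-1/6) \<le> C * (r ^ j * ln (real q) powr (-1/6))" using C by (intro mult_left_mono) auto
    moreover have "measure lebesgue (F (a j)) \<le> C * ln (real (a j)) powr (-1/6)" using fF[OF a0j, of j] by blast
    ultimately have "measure lebesgue (F (a j)) \<le> C * (r ^ j * ln (real q) powr (-1/6))" by linarith
    then show ?thesis by (simp only: mult_ac)
  qed
  have sumB: "(\<Sum>j<n. measure lebesgue (B j)) \<le> \<epsilon>" for n
  proof -
    have "(\<Sum>j<n. measure lebesgue (B j)) \<le> (\<Sum>j<Suc n. measure lebesgue (B j))" by simp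
    also have "\<dots> = measure lebesgue B0 + (\<Sum>j<n. measure lebesgue (F (a j)))"
      by (subst sum.lessThan_Suc_shift) (simp add: B_def)
    also have "\<dots> \<le> C * ln (real q) powr (-1/6) + C * ln (real q) powr (-1/6) * (1 / (1 - r))"
    proof (rule add_mono[OF B0(3)])
      have "(\<Sum>j<n. measure lebesgue (F (a j))) \<le> (\<Sum>j<n. C * ln (real q) powr (-1/6) * r ^ j)" by (intro sum_mono mF)
      also have "\<dots> = C * ln (real q) powr (-1/6) * (\<Sum>j<n. r ^ j)" by (simp add: sum_distrib_left)
      also have "\<dots> \<le> C * ln (real q) powr (-1/6) * (1 / (1 - r))"
      proof (rule mult_left_mono)
        have "(\<Sum>j<n. r ^ j) = (1 - r ^ n) / (1 - r)" using r by (simp add: sum_gp_strict)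
        also have "\<dots> \<le> 1 / (1 - r)" using r by (intro divide_right_mono) auto
        finally show "(\<Sum>j<n. r ^ j) \<le> 1 / (1 - r)" .
      qed (use C in auto)
      finally show "(\<Sum>j<n. measure lebesgue (F (a j))) \<le> C * ln (real q) powr (-1/6) * (1 / (1 - r))" .
    qed
    also have "\<dots> = C * (1 + 1 / (1 - r)) * ln (real q) powr (-1/6)" by (simp add: algebra_simps)
    also have "\<dots> < \<epsilon>"
    proof (rule x0)
      show "x0 \<le> real q" using real_nat_ceiling_ge[of x0] q(3) by (meson of_nat_le_iff order_trans)
    qed
    finally show ?thesis by simp
  qed
  have good: "good_scale \<alpha> \<rho> (a j) t" if t: "t \<in> {0..1}" "\<And>i. t \<notin> B i" for t j
  proof (induction j)
    case 0
    then show ?case using B0(4) t(1) t(2)[of 0] by (simp add: a_def B_def)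
  next
    case (Suc j)
    then show ?case using fF[OF a0j, of j] t(1) t(2)[of "Suc j"] by (simp add: a_Suc B_def)
  qed
  show thesis
  proof (rule that[of a B])
    show "K \<le> a 0" using a_ge[of 0] q by linarith
    show "\<forall>j. (a j)\<^sup>2 \<le> a (Suc j)" "\<forall>j. real (a (Suc j)) \<le> exp (c * real (a j))"
      using fF[OF a0j] by (auto simp: a_Suc)
    show "\<forall>j. closed (B j)" "\<forall>j. B j \<subseteq> {0..1}"
      using fF[OF a0j] B0 by (auto simp: B_def split: nat.split)
  qed (use sumB good in auto)
qed

section \<open>Poisson integrals and resonances\<close>

text \<open>The initial direction in \<open>szY\<close> is \<open>ec (- x)\<close>, whereas
  Poisson's formula is stated for \<open>ec x\<close>.\<close>

lemma has_integral_ec_reflect: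
  assumes "((\<lambda>x. f (ec x)) has_integral I) {0..1}"
  shows "((\<lambda>x. f (ec (- x))) has_integral I) {0..1}"
proof -
  have "((\<lambda>x. f (ec ((-1) *\<^sub>R x + 1))) has_integral (1 / (\<bar>-1\<bar> ^ DIM(real))) *\<^sub>R I)
      ((\<lambda>x. (1 / (-1)) *\<^sub>R x + -((1 / (-1)) *\<^sub>R 1)) ` cbox (0::real) 1)"
    using assms by (intro has_integral_affinity) auto
  moreover have "(\<lambda>x. (1 / (-1)) *\<^sub>R x + -((1 / (-1)) *\<^sub>R 1)) ` cbox (0::real) 1 = {0..1}"
    using image_affinity_atLeastAtMost[of "-1" 1 0 "1::real"] by simp
  moreover have "ec ((-1) *\<^sub>R x + 1) = ec (- x)" for x :: real
    using cis_divide[of "2 * pi" "2 * pi * x"] cis_divide[of 0 "2 * pi * x"] by (simp add: right_diff_distrib)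
  ultimately show ?thesis by simp
qed

text \<open>The maximum principle for \<open>szr / szp\<close>: on the circle \<open>szr\<close> has
  the modulus of \<open>szq\<close>, which \<open>szq_less_szp\<close> controls.\<close>

lemma szr_le_szp:
  assumes "\<And>i. norm (\<alpha> i) < 1" "norm z \<le> 1"
  shows "norm (szr \<alpha> n z) \<le> norm (szp \<alpha> n z)"
proof -
  have nz: "szp \<alpha> n w \<noteq> 0" if "norm w \<le> 1" for w by (rule szp_nonzero[of \<alpha>, OF assms(1) that])
  have hol: "(\<lambda>w. szr \<alpha> n w / szp \<alpha> n w) holomorphic_on cball 0 1"
    using nz by (intro holomorphic_intros szego_holomorphic) auto
  have "norm (szr \<alpha> n z / szp \<alpha> n z) \<le> 1"
  proof (rule maximum_modulus_frontier[of "\<lambda>w. szr \<alpha> n w / szp \<alpha> n w" "cball 0 1"])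
    fix w :: complex assume "w \<in> frontier (cball 0 1)"
    then have w: "norm w = 1" by (simp add: frontier_cball dist_norm)
    have "norm (szr \<alpha> n w) = norm (szq \<alpha> n w)" unfolding szs_szr_circle(2)[OF w] by (simp add: norm_mult norm_power w)
    also have "\<dots> \<le> norm (szp \<alpha> n w)" using szq_less_szp[of \<alpha> w n, OF assms(1)] w by simp
    finally show "norm (szr \<alpha> n w / szp \<alpha> n w) \<le> 1" using nz[of w] w by (simp add: norm_divide divide_simps)
  qed (use hol assms in \<open>auto intro: holomorphic_on_subset holomorphic_on_imp_continuous_on\<close>)
  then show ?thesis using nz[OF assms(2)] by (simp add: norm_divide divide_simps)
qed

lemma szr_at_0 [simp]: "szr \<alpha> n 0 = 0"
  by (induction n) (simp_all add: szr_Suc)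

definition szD :: "(nat \<Rightarrow> complex) \<Rightarrow> nat \<Rightarrow> real" where
  "szD \<alpha> n = (\<Prod>i<n. 1 - (norm (\<alpha> i))\<^sup>2)"

lemma szD_pos: "(\<And>i. norm (\<alpha> i) < 1) \<Longrightarrow> szD \<alpha> n > 0"
  unfolding szD_def by (intro prod_pos) (simp add: power_less_one_iff abs_square_less_1)

text \<open>The indefinite form is nonpositive at the initial vector \<open>(V, 1)\<close> and keeps
  its sign; the denominator cannot vanish because
  \<open>norm (szq \<alpha> n z) < norm (szs \<alpha> n z)\<close> on the circle.\<close>

lemma moebius_szego:
  assumes \<alpha>: "\<And>i. norm (\<alpha> i) < 1" and z: "norm z = 1" and V: "norm V \<le> 1"
  shows "V * szq \<alpha> n z + szs \<alpha> n z \<noteq> 0"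
    and "norm (V * szp \<alpha> n z + szr \<alpha> n z) \<le> norm (V * szq \<alpha> n z + szs \<alpha> n z)"
proof -
  have qp: "norm (szq \<alpha> n z) < norm (szp \<alpha> n z)" using szq_less_szp[of \<alpha> z n, OF \<alpha>] z by simp
  have s: "norm (szs \<alpha> n z) = norm (szp \<alpha> n z)" unfolding szs_szr_circle(1)[OF z] by (simp add: norm_mult norm_power z)
  have "norm (V * szq \<alpha> n z) \<le> 1 * norm (szq \<alpha> n z)" unfolding norm_mult using V by (intro mult_right_mono) auto
  then show "V * szq \<alpha> n z + szs \<alpha> n z \<noteq> 0"
    using qp s norm_triangle_ineq[of "V * szq \<alpha> n z + szs \<alpha> n z" "- (V * szq \<alpha> n z)"] by auto
  have "(norm (V * szp \<alpha> n z + szr \<alpha> n z))\<^sup>2 - (norm (V * szq \<alpha> n z + szs \<alpha> n z))\<^sup>2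
      = (\<Prod>i<n. 1 - (norm (\<alpha> i))\<^sup>2) * ((norm V)\<^sup>2 - 1)"
    using szego_norm_diff[OF z, of \<alpha> "(V, 1)" n] by (simp add: szego_eq)
  also have "\<dots> \<le> 0"
    using V szD_pos[of \<alpha> n, OF \<alpha>] by (intro mult_nonneg_nonpos) (auto simp: szD_def power_le_one)
  finally show "norm (V * szp \<alpha> n z + szr \<alpha> n z) \<le> norm (V * szq \<alpha> n z + szs \<alpha> n z)"
    by (intro power2_le_imp_le[of "norm (V * szp \<alpha> n z + szr \<alpha> n z)"]) auto
qed

text \<open>The density \<open>szD \<alpha> N / \<bar>Y\<bar>\<^sup>2\<close> is the Poisson kernel of the zero of the first component.\<close>

lemma szego_Poisson:
  fixes N :: nat
  assumes \<alpha>: "\<And>i. norm (\<alpha> i) < 1" and z: "norm z = 1"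
    and G: "continuous_on (cball 0 1) G" "G holomorphic_on ball 0 1"
  defines "\<zeta> \<equiv> - szr \<alpha> N z / szp \<alpha> N z"
  shows "((\<lambda>x. G (ec x) * of_real (szD \<alpha> N / (norm (snd (szego \<alpha> z (ec x, 1) N)))\<^sup>2)) has_integral G \<zeta>) {0..1}"
    and "norm \<zeta> < 1"
proof -
  let ?p = "szp \<alpha> N z" and ?q = "szq \<alpha> N z" and ?r = "szr \<alpha> N z" and ?s = "szs \<alpha> N z"
  have p0: "?p \<noteq> 0" using szp_nonzero[of \<alpha> z N, OF \<alpha>] z by simp
  have z0: "z \<noteq> 0" using z by auto
  have "norm ?r = norm ?q" unfolding szs_szr_circle(2)[OF z] by (simp add: norm_mult norm_power z)
  also have "\<dots> < norm ?p" using szq_less_szp[of \<alpha> z N, OF \<alpha>] z by simp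
  finally show \<zeta>1: "norm \<zeta> < 1" using p0 by (simp add: \<zeta>_def norm_divide)
  define D where "D = complex_of_real (szD \<alpha> N)"
  have det: "?p * ?s - ?q * ?r = z ^ N * D" unfolding D_def szD_def by (rule szego_det)
  have D0: "D \<noteq> 0" using szD_pos[of \<alpha> N, OF \<alpha>] by (simp add: D_def)
  \<comment> \<open>Designed so that \<open>F V * V / (V - \<zeta>)\<close> is \<open>G V\<close>
    times the density for \<open>V\<close> on the circle; Cauchy's formula at \<open>\<zeta>\<close>
    then produces \<open>F \<zeta> = G \<zeta>\<close>.\<close>
  define F where "F V = G V * (z ^ N * D) / (?p * (V * ?q + ?s))" for V
  have nz: "V * ?q + ?s \<noteq> 0" if "norm V \<le> 1" for V by (rule moebius_szego(1)[of \<alpha>, OF \<alpha> z that])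
  have "((\<lambda>t. F (ec t) * ec t / (ec t - \<zeta>)) has_integral F \<zeta>) {0..1}"
  proof (rule circle_Cauchy_integral[OF _ _ \<zeta>1])
    show "continuous_on (cball 0 1) F" unfolding F_def using nz p0 by (intro continuous_intros G) auto
    show "F holomorphic_on ball 0 1" unfolding F_def using nz p0 by (intro holomorphic_intros G) auto
  qed
  moreover have "F \<zeta> = G \<zeta>"
  proof -
    have "?p * (\<zeta> * ?q + ?s) = z ^ N * D" unfolding det[symmetric] \<zeta>_def using p0 by (simp add: field_simps)
    then show ?thesis using z0 D0 by (simp add: F_def)
  qed
  moreover have "F (ec t) * ec t / (ec t - \<zeta>) = G (ec t) * of_real (szD \<alpha> N / (norm (snd (szego \<alpha> z (ec t, 1) N)))\<^sup>2)" for t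
  proof -
    let ?V = "ec t"
    let ?Y = "?V * ?q + ?s" and ?X = "?V * ?p + ?r"
    have Vc: "?V * cnj ?V = 1" by (simp add: complex_norm_square[symmetric])
    have zc: "z ^ N * cnj z ^ N = 1" unfolding power_mult_distrib[symmetric] by (simp add: complex_norm_square[symmetric] z)
    \<comment> \<open>On the circle the two components are conjugate up to a unimodular factor,
      which turns \<open>X * Y\<close> into the squared modulus of \<open>Y\<close>.\<close>
    have XY: "?X = ?V * z ^ N * cnj ?Y"
    proof -
      have "?V * z ^ N * cnj ?Y = (?V * cnj ?V) * (z ^ N * cnj ?q) + ?V * (z ^ N * cnj z ^ N) * ?p"
        unfolding szs_szr_circle(1)[OF z] by (simp add: algebra_simps)
      then show ?thesis unfolding Vc zc szs_szr_circle(2)[OF z] by simp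
    qed
    have Y0: "?Y \<noteq> 0" by (rule nz) simp
    have "?p * (?V - \<zeta>) = ?X" using p0 by (simp add: \<zeta>_def field_simps)
    then have "F ?V * ?V / (?V - \<zeta>) = G ?V * (z ^ N * D) * ?V / (?X * ?Y)"
      unfolding F_def by (simp add: mult_ac)
    also have "\<dots> = G ?V * (D / (?Y * cnj ?Y))"
      unfolding XY using z0 by simp
    also have "?Y * cnj ?Y = of_real ((norm ?Y)\<^sup>2)" by (rule complex_norm_square[symmetric])
    also have "?Y = snd (szego \<alpha> z (?V, 1) N)" by (simp add: szego_eq)
    finally show ?thesis by (simp add: D_def)
  qed
  ultimately show "((\<lambda>x. G (ec x) * of_real (szD \<alpha> N / (norm (snd (szego \<alpha> z (ec x, 1) N)))\<^sup>2)) has_integral G \<zeta>) {0..1}"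
    by simp
qed

text \<open>With the normalisation by determinants this is the size of the transfer matrix from
  \<open>a\<close> to \<open>a + m\<close> times the growth factor of the second component. A
  moderate resonance thus forces the solution to shrink when the matrix is large. This is the
  typical case, since the density \<open>szD / \<bar>Y\<bar>\<^sup>2\<close> favours phases with a
  small second component.\<close>

definition resonance :: "(nat \<Rightarrow> complex) \<Rightarrow> nat \<Rightarrow> nat \<Rightarrow> complex \<Rightarrow> complex \<Rightarrow> real" where
  "resonance \<alpha> a m z V = norm (szp (\<lambda>i. \<alpha> (a + i)) m z) * norm (snd (szego \<alpha> z (V, 1) (a + m)))
      / (norm (snd (szego \<alpha> z (V, 1) a)) * szD (\<lambda>i. \<alpha> (a + i)) m)"

text \<open>The square root maps the right half plane into the sector of arguments up to pi/4, where
  the real part controls the modulus. In the half plane itself it does not, which is why the root of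
  the resonance is integrated.\<close>

lemma sqrt_norm_le_Re_csqrt:
  assumes "Re w > 0" shows "sqrt (norm w) \<le> sqrt 2 * Re (csqrt w)"
proof -
  have "sqrt 2 * Re (csqrt w) = sqrt (norm w + Re w)"
    by (simp add: real_sqrt_mult[symmetric])
  then show ?thesis using assms by simp
qed

lemma Re_inverse_one_minus_pos:
  assumes "norm (w::complex) < 1" shows "Re (1 / (1 - w)) > 0"
proof -
  have "Re (1 - w) > 0" using complex_Re_le_cmod[of w] assms by simp
  then have "Re (inverse (1 - w)) > 0"
    unfolding inverse_complex.simps by (intro divide_pos_pos add_pos_nonneg) auto
  then show ?thesis by (simp add: inverse_eq_divide)
qed

text \<open>With \<open>h w = csqrt (1 / (1 - w))\<close> and \<open>Y V\<close> the direction at time \<open>a + m\<close>, the resonance is \<open>\<bar>h (\<beta> * Y V)\<bar>\<^sup>2\<close>. For fixed \<open>z\<close> the Poisson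
  integral over \<open>V\<close> evaluates \<open>h (\<beta> * Y V)\<close> at \<open>h (\<beta> * f)\<close> for a Schur function \<open>f\<close> with \<open>f 0 = 0\<close>, so that
  averaging over \<open>z\<close> gives \<open>h 0 = 1\<close>.\<close>

lemma resonance_mean:
  assumes \<alpha>: "\<And>i. norm (\<alpha> i) < 1" and N: "a + m \<le> N"
  obtains g :: "complex \<Rightarrow> complex \<Rightarrow> real" and I :: "complex \<Rightarrow> real"
  where "\<And>z V. norm z = 1 \<Longrightarrow> norm V = 1 \<Longrightarrow> sqrt (resonance \<alpha> a m z V) \<le> sqrt 2 * g z V"
    "\<And>z V. norm z = 1 \<Longrightarrow> norm V = 1 \<Longrightarrow> 0 \<le> g z V"
    "\<And>z. norm z = 1 \<Longrightarrow> ((\<lambda>x. g z (ec x) * (szD \<alpha> N / (norm (snd (szego \<alpha> z (ec x, 1) N)))\<^sup>2)) has_integral I z) {0..1}"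
    "((\<lambda>t. I (ec t)) has_integral 1) {0..1}"
proof -
  define \<alpha>' where "\<alpha>' = (\<lambda>i. \<alpha> (a + i))"
  have \<alpha>': "norm (\<alpha>' i) < 1" for i using \<alpha> by (simp add: \<alpha>'_def)
  define n where "n = a + m"
  define \<alpha>'' where "\<alpha>'' = (\<lambda>i. \<alpha> (n + i))"
  have \<alpha>'': "norm (\<alpha>'' i) < 1" for i using \<alpha> by (simp add: \<alpha>''_def)
  obtain M where M: "N = n + M" using N by (metis n_def le_Suc_ex)
  define \<beta> where "\<beta> z = szq \<alpha>' m z / szp \<alpha>' m z" for z
  have \<beta>1: "norm (\<beta> z) < 1" if "norm z \<le> 1" for z
    using szq_less_szp[of \<alpha>' z m, OF \<alpha>' that] szp_nonzero[of \<alpha>' z m, OF \<alpha>' that] by (simp add: \<beta>_def norm_divide)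
  define Y where "Y z V = (V * szp \<alpha> n z + szr \<alpha> n z) / (V * szq \<alpha> n z + szs \<alpha> n z)" for z V
  have Y1: "norm (Y z V) \<le> 1" if "norm z = 1" "norm V \<le> 1" for z V
    using moebius_szego[of \<alpha>, OF \<alpha> that, of n] by (simp add: Y_def norm_divide divide_simps)
  define h where "h w = csqrt (1 / (1 - w))" for w
  have hpos: "Re (1 / (1 - w)) > 0" "1 - w \<noteq> 0" if "norm w < 1" for w :: complex
    using Re_inverse_one_minus_pos[OF that] that by auto
  have hnp: "1 / (1 - w) \<notin> \<real>\<^sub>\<le>\<^sub>0" if "norm w < 1" for w :: complex
    using hpos[OF that] by (auto simp: complex_nonpos_Reals_iff)
  have \<beta>Y: "norm (\<beta> z * Y z V) < 1" if "norm z = 1" "norm V \<le> 1" for z V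
  proof -
    have "norm (\<beta> z) * norm (Y z V) \<le> norm (\<beta> z) * 1" using Y1[OF that] by (intro mult_left_mono) auto
    then show ?thesis using \<beta>1[of z] that by (simp add: norm_mult)
  qed
  \<comment> \<open>The direction at time \<open>n\<close> that the block from \<open>n\<close> to
    \<open>N\<close> sends to a vanishing first component.\<close>
  define f where "f z = - szr \<alpha>'' M z / szp \<alpha>'' M z" for z
  have f1: "norm (f z) \<le> 1" if "norm z \<le> 1" for z
    using szr_le_szp[of \<alpha>'' z M, OF \<alpha>'' that] szp_nonzero[of \<alpha>'' z M, OF \<alpha>'' that] by (simp add: f_def norm_divide divide_simps)
  have \<beta>f: "norm (\<beta> z * f z) < 1" if "norm z \<le> 1" for z
  proof -
    have "norm (\<beta> z) * norm (f z) \<le> norm (\<beta> z) * 1" using f1[OF that] by (intro mult_left_mono) auto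
    then show ?thesis using \<beta>1[of z] that by (simp add: norm_mult)
  qed
  show thesis
  proof (rule that[of "\<lambda>z V. Re (h (\<beta> z * Y z V))" "\<lambda>z. Re (h (\<beta> z * f z))"])
    fix z V :: complex assume z: "norm z = 1" and V: "norm V = 1"
    have w: "norm (\<beta> z * Y z V) < 1" using \<beta>Y z V by simp
    show "0 \<le> Re (h (\<beta> z * Y z V))" unfolding h_def by (rule Re_csqrt)
    obtain X' Y' where Xa: "szego \<alpha> z (V, 1) a = (X', Y')" by fastforce
    have Y'0: "Y' \<noteq> 0" using moebius_szego(1)[of \<alpha> z V a, OF \<alpha> z] V Xa by (simp add: szego_eq)
    have p0: "szp \<alpha>' m z \<noteq> 0" using szp_nonzero[of \<alpha>' z m, OF \<alpha>'] z by simp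
    have z0: "z \<noteq> 0" using z by auto
    have n: "szego \<alpha> z (V, 1) n = szego \<alpha>' z (X', Y') m" unfolding n_def szego_add Xa \<alpha>'_def ..
    define X'' Y'' where "X'' = X' * szp \<alpha>' m z + Y' * szr \<alpha>' m z" and "Y'' = X' * szq \<alpha>' m z + Y' * szs \<alpha>' m z"
    have n1: "szego \<alpha> z (V, 1) n = (X'', Y'')" unfolding n unfolding szego_eq X''_def Y''_def ..
    have YXY: "Y z V = X'' / Y''" using n1 by (simp add: szego_eq Y_def)
    have Y''0: "Y'' \<noteq> 0" using moebius_szego(1)[of \<alpha> z V n, OF \<alpha> z] V n1 by (simp add: szego_eq)
    have D0: "szD \<alpha>' m > 0" by (rule szD_pos[of \<alpha>', OF \<alpha>'])
    \<comment> \<open>This combination eliminates \<open>X'\<close> and leaves \<open>Y'\<close>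
      times the determinant, as in Cramer's rule.\<close>
    have "szp \<alpha>' m z * Y'' - szq \<alpha>' m z * X'' = Y' * (szp \<alpha>' m z * szs \<alpha>' m z - szq \<alpha>' m z * szr \<alpha>' m z)"
      by (simp add: X''_def Y''_def algebra_simps)
    also have "\<dots> = Y' * (z ^ m * of_real (szD \<alpha>' m))" unfolding szego_det szD_def ..
    finally have det': "szp \<alpha>' m z * Y'' - szq \<alpha>' m z * X'' = Y' * (z ^ m * of_real (szD \<alpha>' m))" .
    have "1 - \<beta> z * Y z V = (szp \<alpha>' m z * Y'' - szq \<alpha>' m z * X'') / (szp \<alpha>' m z * Y'')"
      using p0 Y''0 unfolding \<beta>_def YXY by (simp add: diff_divide_distrib)
    then have "1 - \<beta> z * Y z V = Y' * (z ^ m * of_real (szD \<alpha>' m)) / (szp \<alpha>' m z * Y'')"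
      unfolding det' .
    then have "norm (1 / (1 - \<beta> z * Y z V)) = resonance \<alpha> a m z V"
      using D0 by (simp add: resonance_def norm_divide norm_mult norm_power z Xa n1[unfolded n_def] \<alpha>'_def[symmetric])
    then show "sqrt (resonance \<alpha> a m z V) \<le> sqrt 2 * Re (h (\<beta> z * Y z V))"
      unfolding h_def using sqrt_norm_le_Re_csqrt[OF hpos(1)[OF w]] by simp
  next
    fix z :: complex assume z: "norm z = 1"
    define G where "G V = h (\<beta> z * Y z V)" for V
    have nz: "V * szq \<alpha> n z + szs \<alpha> n z \<noteq> 0" if "norm V \<le> 1" for V by (rule moebius_szego(1)[of \<alpha>, OF \<alpha> z that])
    have holG: "G holomorphic_on cball 0 1"
      unfolding G_def h_def Y_def
    proof (intro holomorphic_intros)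
      fix V :: complex assume V: "V \<in> cball 0 1"
      then show "V * szq \<alpha> n z + szs \<alpha> n z \<noteq> 0" using nz by simp
      have "norm (\<beta> z * Y z V) < 1" using \<beta>Y z V by simp
      from hnp[OF this] hpos(2)[OF this] show "1 / (1 - \<beta> z * ((V * szp \<alpha> n z + szr \<alpha> n z) / (V * szq \<alpha> n z + szs \<alpha> n z))) \<notin> \<real>\<^sub>\<le>\<^sub>0"
        "1 - \<beta> z * ((V * szp \<alpha> n z + szr \<alpha> n z) / (V * szq \<alpha> n z + szs \<alpha> n z)) \<noteq> 0" by (simp_all add: Y_def)
    qed
    define \<zeta> where "\<zeta> = - szr \<alpha> N z / szp \<alpha> N z"
    have GG: "((\<lambda>x. G (ec x) * of_real (szD \<alpha> N / (norm (snd (szego \<alpha> z (ec x, 1) N)))\<^sup>2)) has_integral G \<zeta>) {0..1}"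
      unfolding \<zeta>_def
      by (rule szego_Poisson(1)[of \<alpha>, OF \<alpha> z]) (use holG in \<open>auto intro: holomorphic_on_subset holomorphic_on_imp_continuous_on\<close>)
    have Rr: "Re (w * of_real c) = Re w * c" for w c by simp
    from has_integral_Re[OF GG] have 1: "((\<lambda>x. Re (G (ec x)) * (szD \<alpha> N / (norm (snd (szego \<alpha> z (ec x, 1) N)))\<^sup>2)) has_integral Re (G \<zeta>)) {0..1}"
      by (simp only: Rr)
    have \<zeta>1: "norm \<zeta> < 1" unfolding \<zeta>_def using szego_Poisson(2)[of \<alpha> z "\<lambda>_. 1" N, OF \<alpha> z] by simp
    \<comment> \<open>The phase \<open>\<zeta>\<close> is the one whose first component vanishes at
      \<open>N\<close>. Seen from time \<open>n\<close> this depends on the later coefficients only,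
      so the Poisson integral becomes the real part of a function holomorphic in \<open>z\<close>,
      ready for the second mean value.\<close>
    have "Y z \<zeta> = f z"
    proof -
      obtain X' Y' where X: "szego \<alpha> z (\<zeta>, 1) n = (X', Y')" by fastforce
      have Y'0: "Y' \<noteq> 0" using nz[of \<zeta>] \<zeta>1 X by (simp add: szego_eq)
      have P0: "szp \<alpha>'' M z \<noteq> 0" using szp_nonzero[of \<alpha>'' z M, OF \<alpha>''] z by simp
      have pN0: "szp \<alpha> N z \<noteq> 0" using szp_nonzero[of \<alpha> z N, OF \<alpha>] z by simp
      have "szego \<alpha> z (\<zeta>, 1) N = szego \<alpha>'' z (X', Y') M" unfolding M szego_add X \<alpha>''_def ..
      then have "\<zeta> * szp \<alpha> N z + szr \<alpha> N z = X' * szp \<alpha>'' M z + Y' * szr \<alpha>'' M z" by (simp add: szego_eq)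
      moreover have "\<zeta> * szp \<alpha> N z + szr \<alpha> N z = 0" using pN0 by (simp add: \<zeta>_def)
      ultimately have "X' * szp \<alpha>'' M z = - (Y' * szr \<alpha>'' M z)" by (simp add: add_eq_0_iff2)
      then have "X' / Y' = - szr \<alpha>'' M z / szp \<alpha>'' M z" using Y'0 P0 by (simp add: field_simps)
      then show ?thesis using X by (simp add: Y_def f_def szego_eq)
    qed
    then show "((\<lambda>x. Re (h (\<beta> z * Y z (ec x))) * (szD \<alpha> N / (norm (snd (szego \<alpha> z (ec x, 1) N)))\<^sup>2)) has_integral Re (h (\<beta> z * f z))) {0..1}"
      using 1 by (simp add: G_def)
  next
    have holF: "(\<lambda>z. h (\<beta> z * f z)) holomorphic_on cball 0 1"
      unfolding h_def \<beta>_def f_def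
    proof (intro holomorphic_intros szego_holomorphic)
      fix z :: complex assume z: "z \<in> cball 0 1"
      show "szp \<alpha>' m z \<noteq> 0" "szp \<alpha>'' M z \<noteq> 0"
        using szp_nonzero[of \<alpha>' z m, OF \<alpha>'] szp_nonzero[of \<alpha>'' z M, OF \<alpha>''] z by auto
      have "norm (\<beta> z * f z) < 1" using \<beta>f z by simp
      from hnp[OF this] hpos(2)[OF this] show "1 / (1 - szq \<alpha>' m z / szp \<alpha>' m z * (- szr \<alpha>'' M z / szp \<alpha>'' M z)) \<notin> \<real>\<^sub>\<le>\<^sub>0"
        "1 - szq \<alpha>' m z / szp \<alpha>' m z * (- szr \<alpha>'' M z / szp \<alpha>'' M z) \<noteq> 0" by (simp_all add: \<beta>_def f_def)
    qed
    have "((\<lambda>t. h (\<beta> (ec t) * f (ec t))) has_integral h (\<beta> 0 * f 0)) {0..1}"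
      by (rule circle_mean_value[of "\<lambda>z. h (\<beta> z * f z)"]) (use holF in \<open>auto intro: holomorphic_on_subset holomorphic_on_imp_continuous_on\<close>)
    from has_integral_Re[OF this] show "((\<lambda>t. Re (h (\<beta> (ec t) * f (ec t)))) has_integral 1) {0..1}"
      by (simp add: f_def h_def)
  qed
qed

section \<open>Tail bound for the random spectral parameter\<close>

text \<open>By \<open>Phi_szY\<close> this is the monic orthogonal polynomial of
  \<open>\<mu> x\<close> at \<open>ec t\<close>. The sign of \<open>x\<close> arises because the
  initial vector \<open>(V, 1)\<close> multiplies the coefficients by \<open>cnj V\<close>.\<close>

definition szY :: "(nat \<Rightarrow> complex) \<Rightarrow> nat \<Rightarrow> real \<Rightarrow> real \<Rightarrow> complex" where
  "szY \<alpha> n t x = snd (szego \<alpha> (ec t) (ec (- x), 1) n)"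

definition szdens :: "(nat \<Rightarrow> complex) \<Rightarrow> nat \<Rightarrow> real \<Rightarrow> real \<Rightarrow> real" where
  "szdens \<alpha> N t x = szD \<alpha> N / (norm (szY \<alpha> N t x))\<^sup>2"

text \<open>The joint law of \<open>(t, x)\<close>, where \<open>x\<close> is uniform and \<open>ec t\<close> follows the \<open>N\<close>-th Bernstein--Szego approximant of the
  measure \<open>\<mu> x\<close>.\<close>

definition nuN :: "(nat \<Rightarrow> complex) \<Rightarrow> nat \<Rightarrow> (real \<times> real) measure" where
  "nuN \<alpha> N = density lborel (\<lambda>(t, x). ennreal (szdens \<alpha> N t x) * indicator {0..1} x * indicator {0..1} t)"

lemma szY_eq: "szY \<alpha> n t x = ec (- x) * szq \<alpha> n (ec t) + szs \<alpha> n (ec t)"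
  by (simp add: szY_def szego_eq)

lemma szY_nonzero: "(\<And>i. norm (\<alpha> i) < 1) \<Longrightarrow> szY \<alpha> n t x \<noteq> 0"
  using moebius_szego(1)[of \<alpha> "ec t" "ec (- x)" n] by (simp add: szY_eq)

lemma continuous_on_szY [continuous_intros]:
  assumes "continuous_on A f" "continuous_on A g"
  shows "continuous_on A (\<lambda>p. szY \<alpha> n (f p) (g p))"
proof -
  have 1: "continuous_on A (\<lambda>p. ec (f p))" "continuous_on A (\<lambda>p. ec (- g p))"
    unfolding cis_conv_exp by (intro continuous_intros assms)+
  show ?thesis unfolding szY_eq by (intro continuous_intros 1)
qed

lemma fst_snd_borel [measurable]:
  "fst \<in> borel_measurable (borel :: (real \<times> real) measure)" "snd \<in> borel_measurable (borel :: (real \<times> real) measure)"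
  by (intro borel_measurable_continuous_onI continuous_intros)+

lemma szY_measurable [measurable]: "(\<lambda>p. szY \<alpha> n (fst p) (snd p)) \<in> borel_measurable borel"
  by (intro borel_measurable_continuous_onI continuous_intros)

lemma szdens_measurable [measurable]: "(\<lambda>p. szdens \<alpha> n (fst p) (snd p)) \<in> borel_measurable borel"
  unfolding szdens_def by measurable

lemma sets_nuN [simp, measurable_cong]: "sets (nuN \<alpha> N) = sets borel"
  by (simp add: nuN_def)

lemma space_nuN [simp]: "space (nuN \<alpha> N) = UNIV"
  by (simp add: nuN_def)

lemma nn_integral_nuN:
  assumes f [measurable]: "f \<in> borel_measurable borel"
  shows "(\<integral>\<^sup>+p. f p \<partial>nuN \<alpha> N) = (\<integral>\<^sup>+t. (\<integral>\<^sup>+x. ennreal (szdens \<alpha> N t x) * f (t, x) * indicator {0..1} x \<partial>lborel) * indicator {0..1} t \<partial>lborel)"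
proof -
  let ?d = "\<lambda>p. ennreal (szdens \<alpha> N (fst p) (snd p)) * indicator {0..1} (snd p) * indicator {0..1} (fst p)"
  have [measurable]: "?d \<in> borel_measurable borel" by measurable
  have "(\<integral>\<^sup>+p. f p \<partial>nuN \<alpha> N) = (\<integral>\<^sup>+p. ?d p * f p \<partial>lborel)"
    unfolding nuN_def case_prod_beta by (subst nn_integral_density) auto
  also have "\<dots> = (\<integral>\<^sup>+p. ?d p * f p \<partial>(lborel \<Otimes>\<^sub>M lborel))" by (simp only: lborel_prod)
  also have "\<dots> = (\<integral>\<^sup>+t. \<integral>\<^sup>+x. ?d (t, x) * f (t, x) \<partial>lborel \<partial>lborel)"
  proof (rule lborel.nn_integral_fst[symmetric])
    have "(\<lambda>p. ?d p * f p) \<in> borel_measurable (lborel :: (real \<times> real) measure)" by measurable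
    then show "(\<lambda>p. ?d p * f p) \<in> borel_measurable (lborel \<Otimes>\<^sub>M lborel)" by (simp only: lborel_prod)
  qed
  also have "\<dots> = (\<integral>\<^sup>+t. (\<integral>\<^sup>+x. ennreal (szdens \<alpha> N t x) * f (t, x) * indicator {0..1} x \<partial>lborel) * indicator {0..1} t \<partial>lborel)"
    by (intro nn_integral_cong) (auto simp: indicator_def mult_ac)
  finally show ?thesis .
qed

text \<open>Poisson's formula for the constant function 1: for each fixed \<open>t\<close> the
  density is a probability density in the phase.\<close>

lemma nn_integral_szdens:
  assumes \<alpha>: "\<And>i. norm (\<alpha> i) < 1"
  shows "(\<integral>\<^sup>+x. ennreal (szdens \<alpha> N t x) * indicator {0..1} x \<partial>lborel) = 1"
proof -
  have "((\<lambda>x. 1 * of_real (szD \<alpha> N / (norm (snd (szego \<alpha> (ec t) (ec x, 1) N)))\<^sup>2)) has_integral (1::complex)) {0..1}"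
    by (rule szego_Poisson(1)[of \<alpha> "ec t" "\<lambda>_. 1" N, OF \<alpha>]) auto
  from has_integral_Re[OF this]
  have "((\<lambda>x. (\<lambda>V. szD \<alpha> N / (norm (snd (szego \<alpha> (ec t) (V, 1) N)))\<^sup>2) (ec x)) has_integral 1) {0..1}" by simp
  then have "((\<lambda>x. szD \<alpha> N / (norm (snd (szego \<alpha> (ec t) (ec (- x), 1) N)))\<^sup>2) has_integral 1) {0..1}"
    by (rule has_integral_ec_reflect)
  then have "((\<lambda>x. szdens \<alpha> N t x) has_integral 1) {0..1}" by (simp add: szdens_def szY_def)
  from nn_integral_has_integral_lebesgue'[OF _ this] show ?thesis
    using szD_pos[of \<alpha> N, OF \<alpha>] by (simp add: szdens_def)
qed

text \<open>Averaging over the phase makes \<open>t\<close> uniform. The Lebesgue-small exceptional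
  sets of the growth estimates are therefore small for every \<open>nuN\<close>, uniformly in
  \<open>N\<close>.\<close>

lemma nuN_marginal:
  assumes \<alpha>: "\<And>i. norm (\<alpha> i) < 1" and B: "B \<in> sets borel"
  shows "emeasure (nuN \<alpha> N) (B \<times> UNIV) = emeasure lborel (B \<inter> {0..1})"
proof -
  have [measurable]: "B \<in> sets borel" by fact
  have S: "B \<times> UNIV \<in> sets (borel :: (real \<times> real) measure)"
    by (rule borel_Times) (use B in auto)
  then have [measurable]: "(\<lambda>p. indicator (B \<times> UNIV) p :: ennreal) \<in> borel_measurable (borel :: (real \<times> real) measure)" by simp
  have "emeasure (nuN \<alpha> N) (B \<times> UNIV) = (\<integral>\<^sup>+p. indicator (B \<times> UNIV) p \<partial>nuN \<alpha> N)"
    using S by simp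
  also have "\<dots> = (\<integral>\<^sup>+t. (\<integral>\<^sup>+x. indicator B t * (ennreal (szdens \<alpha> N t x) * indicator {0..1} x) \<partial>lborel) * indicator {0..1} t \<partial>lborel)"
    by (subst nn_integral_nuN) (auto intro!: nn_integral_cong simp: indicator_def)
  also have "\<dots> = (\<integral>\<^sup>+t. indicator (B \<inter> {0..1}) t \<partial>lborel)"
  proof (intro nn_integral_cong)
    fix t :: real
    have [measurable]: "(\<lambda>x. ennreal (szdens \<alpha> N t x)) \<in> borel_measurable borel"
      using measurable_compose[OF _ szdens_measurable[of \<alpha> N], of "\<lambda>x. (t, x)" borel] by simp
    show "(\<integral>\<^sup>+x. indicator B t * (ennreal (szdens \<alpha> N t x) * indicator {0..1} x) \<partial>lborel) * indicator {0..1} t = indicator (B \<inter> {0..1}) t"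
      by (subst nn_integral_cmult) (auto simp: nn_integral_szdens[of \<alpha>, OF \<alpha>] indicator_inter_arith)
  qed
  also have "\<dots> = emeasure lborel (B \<inter> {0..1})" using B by simp
  finally show ?thesis .
qed

lemma emeasure_nuN_UNIV: "(\<And>i. norm (\<alpha> i) < 1) \<Longrightarrow> emeasure (nuN \<alpha> N) UNIV = 1"
  using nuN_marginal[of \<alpha> UNIV N] by (simp flip: UNIV_Times_UNIV)

section \<open>Probability of resonances\<close>

lemma resonance_measurable [measurable]:
  "(\<lambda>p. resonance \<alpha> a m (ec (fst p)) (ec (- snd p))) \<in> borel_measurable (borel :: (real \<times> real) measure)"
proof -
  have [measurable]: "(\<lambda>p::real \<times> real. szp \<beta> m (ec (fst p))) \<in> borel_measurable borel" for \<beta>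
    unfolding cis_conv_exp by (intro borel_measurable_continuous_onI continuous_intros)
  show ?thesis
    unfolding resonance_def szY_def[symmetric] by measurable
qed

lemma resonance_nonneg: "(\<And>i. norm (\<alpha> i) < 1) \<Longrightarrow> 0 \<le> resonance \<alpha> a m z V"
  unfolding resonance_def using szD_pos[of "\<lambda>i. \<alpha> (a + i)" m]
  by (intro divide_nonneg_nonneg mult_nonneg_nonneg) (auto intro: less_imp_le)

text \<open>Integrating first over \<open>x\<close> and then over \<open>t\<close> uses the two mean
  values of \<open>resonance_mean\<close> in turn. The bound is the same for all \<open>a\<close>,
  \<open>m\<close> and \<open>N\<close>.\<close>

lemma nuN_sqrt_resonance:
  assumes \<alpha>: "\<And>i. norm (\<alpha> i) < 1" and N: "a + m \<le> N"
  shows "(\<integral>\<^sup>+p. ennreal (sqrt (resonance \<alpha> a m (ec (fst p)) (ec (- snd p)))) \<partial>nuN \<alpha> N) \<le> ennreal (sqrt 2)"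
proof -
  obtain g I where g: "\<And>z V. norm z = 1 \<Longrightarrow> norm V = 1 \<Longrightarrow> sqrt (resonance \<alpha> a m z V) \<le> sqrt 2 * g z V"
    "\<And>z V. norm z = 1 \<Longrightarrow> norm V = 1 \<Longrightarrow> 0 \<le> g z V"
    and I: "\<And>z. norm z = 1 \<Longrightarrow> ((\<lambda>x. g z (ec x) * (szD \<alpha> N / (norm (snd (szego \<alpha> z (ec x, 1) N)))\<^sup>2)) has_integral I z) {0..1}"
    "((\<lambda>t. I (ec t)) has_integral 1) {0..1}"
    by (rule resonance_mean[of \<alpha> a m N, OF \<alpha> N]) (rule that)
  have D: "szdens \<alpha> N t x \<ge> 0" for t x using szD_pos[of \<alpha> N, OF \<alpha>] by (simp add: szdens_def)
  have inner: "((\<lambda>x. szdens \<alpha> N t x * (sqrt 2 * g (ec t) (ec (- x)))) has_integral (sqrt 2 * I (ec t))) {0..1}" for t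
  proof -
    have "((\<lambda>x. (\<lambda>V. g (ec t) V * (szD \<alpha> N / (norm (snd (szego \<alpha> (ec t) (V, 1) N)))\<^sup>2)) (ec x)) has_integral I (ec t)) {0..1}"
      using I(1)[of "ec t"] by simp
    then have "((\<lambda>x. g (ec t) (ec (- x)) * (szD \<alpha> N / (norm (snd (szego \<alpha> (ec t) (ec (- x), 1) N)))\<^sup>2)) has_integral I (ec t)) {0..1}"
      by (rule has_integral_ec_reflect)
    then have "((\<lambda>x. sqrt 2 * (g (ec t) (ec (- x)) * szdens \<alpha> N t x)) has_integral (sqrt 2 * I (ec t))) {0..1}"
      unfolding szdens_def szY_def by (rule has_integral_mult_right)
    then show ?thesis by (simp add: mult_ac)
  qed
  have I0: "0 \<le> I (ec t)" for t
  proof -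
    have "0 \<le> sqrt 2 * I (ec t)"
      using inner[of t] by (rule has_integral_nonneg) (use D g(2) in auto)
    then show ?thesis by (simp add: zero_le_mult_iff)
  qed
  have "(\<integral>\<^sup>+p. ennreal (sqrt (resonance \<alpha> a m (ec (fst p)) (ec (- snd p)))) \<partial>nuN \<alpha> N)
    = (\<integral>\<^sup>+t. (\<integral>\<^sup>+x. ennreal (szdens \<alpha> N t x) * ennreal (sqrt (resonance \<alpha> a m (ec t) (ec (- x)))) * indicator {0..1} x \<partial>lborel) * indicator {0..1} t \<partial>lborel)"
    by (subst nn_integral_nuN) measurable
  also have "\<dots> \<le> (\<integral>\<^sup>+t. (\<integral>\<^sup>+x. ennreal (szdens \<alpha> N t x * (sqrt 2 * g (ec t) (ec (- x)))) * indicator {0..1} x \<partial>lborel) * indicator {0..1} t \<partial>lborel)"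
  proof (intro nn_integral_mono mult_right_mono)
    fix t x
    show "ennreal (szdens \<alpha> N t x) * ennreal (sqrt (resonance \<alpha> a m (ec t) (ec (- x)))) \<le> ennreal (szdens \<alpha> N t x * (sqrt 2 * g (ec t) (ec (- x))))"
      using g D[of t x] by (subst ennreal_mult[symmetric]) (auto intro!: ennreal_leI mult_left_mono resonance_nonneg[of \<alpha>, OF \<alpha>])
  qed auto
  also have "\<dots> = (\<integral>\<^sup>+t. ennreal (sqrt 2 * I (ec t)) * indicator {0..1} t \<partial>lborel)"
  proof (intro nn_integral_cong)
    fix t
    have "(\<integral>\<^sup>+x. ennreal (szdens \<alpha> N t x * (sqrt 2 * g (ec t) (ec (- x)))) * indicator {0..1} x \<partial>lborel) = ennreal (sqrt 2 * I (ec t))"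
      by (rule nn_integral_has_integral_lebesgue'[OF _ inner]) (use D g(2) in auto)
    then show "(\<integral>\<^sup>+x. ennreal (szdens \<alpha> N t x * (sqrt 2 * g (ec t) (ec (- x)))) * indicator {0..1} x \<partial>lborel) * indicator {0..1} t
        = ennreal (sqrt 2 * I (ec t)) * indicator {0..1} t" by simp
  qed
  also have "\<dots> = ennreal (sqrt 2 * 1)"
    by (rule nn_integral_has_integral_lebesgue'[OF _ has_integral_mult_right[OF I(2)]]) (use I0 in auto)
  finally show ?thesis by simp
qed

lemma nuN_resonance_tail:
  assumes \<alpha>: "\<And>i. norm (\<alpha> i) < 1" and N: "a + m \<le> N"
  shows "{p. exp (2 * s) < resonance \<alpha> a m (ec (fst p)) (ec (- snd p))} \<in> sets borel"
    and "emeasure (nuN \<alpha> N) {p. exp (2 * s) < resonance \<alpha> a m (ec (fst p)) (ec (- snd p))} \<le> ennreal (2 * exp (- s))"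
proof -
  let ?r = "\<lambda>p. resonance \<alpha> a m (ec (fst p)) (ec (- snd p))"
  let ?u = "\<lambda>p. ennreal (sqrt (?r p))"
  show S: "{p. exp (2 * s) < ?r p} \<in> sets borel"
    using measurable_sets_borel[OF resonance_measurable[of \<alpha> a m], of "{exp (2 * s)<..}"] by (simp add: vimage_def)
  have "emeasure (nuN \<alpha> N) {p. exp (2 * s) < ?r p} \<le> emeasure (nuN \<alpha> N) {p \<in> UNIV. 1 \<le> ennreal (exp (- s)) * ?u p}"
  proof (rule emeasure_mono)
    show "{p \<in> UNIV. 1 \<le> ennreal (exp (- s)) * ?u p} \<in> sets (nuN \<alpha> N)" by measurable
    show "{p. exp (2 * s) < ?r p} \<subseteq> {p \<in> UNIV. 1 \<le> ennreal (exp (- s)) * ?u p}"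
    proof (rule subsetI)
      fix p assume "p \<in> {p. exp (2 * s) < ?r p}"
      then have "sqrt (exp (2 * s)) \<le> sqrt (?r p)" by simp
      moreover have "sqrt (exp (2 * s)) = exp s" by (rule real_sqrt_unique) (auto simp: exp_double)
      ultimately have "exp (- s) * exp s \<le> exp (- s) * sqrt (?r p)" by (intro mult_left_mono) auto
      then have "1 \<le> exp (- s) * sqrt (?r p)" by (simp add: exp_minus)
      then have "ennreal 1 \<le> ennreal (exp (- s) * sqrt (?r p))" by (rule ennreal_leI)
      then show "p \<in> {p \<in> UNIV. 1 \<le> ennreal (exp (- s)) * ?u p}"
        by (simp add: ennreal_mult resonance_nonneg[of \<alpha>, OF \<alpha>])
    qed
  qed
  also have "\<dots> \<le> ennreal (exp (- s)) * (\<integral>\<^sup>+p. ?u p * indicator UNIV p \<partial>nuN \<alpha> N)"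
    by (rule nn_integral_Markov_inequality) measurable
  also have "\<dots> \<le> ennreal (exp (- s)) * ennreal (sqrt 2)"
    using nuN_sqrt_resonance[of \<alpha> a m N, OF \<alpha> N] by (intro mult_left_mono) auto
  also have "\<dots> = ennreal (exp (- s) * sqrt 2)" by (simp add: ennreal_mult)
  also have "\<dots> \<le> ennreal (2 * exp (- s))" using real_le_lsqrt[of 2 2] by (intro ennreal_leI) auto
  finally show "emeasure (nuN \<alpha> N) {p. exp (2 * s) < ?r p} \<le> ennreal (2 * exp (- s))" .
qed

lemma exp_neg_sum_le:
  assumes "\<gamma> > 0" "\<And>j. A + j \<le> a j"
  shows "(\<Sum>j<J. exp (- (\<gamma> * real (a j)))) \<le> exp (- (\<gamma> * real A)) / (1 - exp (- \<gamma>))"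
proof -
  have "(\<Sum>j<J. exp (- (\<gamma> * real (a j)))) \<le> (\<Sum>j<J. exp (- (\<gamma> * real A)) * exp (- \<gamma>) ^ j)"
  proof (rule sum_mono)
    fix j
    have "real (A + j) \<le> real (a j)" using assms(2) of_nat_mono by blast
    then have "\<gamma> * real (A + j) \<le> \<gamma> * real (a j)" using assms(1) by (intro mult_left_mono) auto
    then have "exp (- (\<gamma> * real (a j))) \<le> exp (- (\<gamma> * real (A + j)))" by simp
    also have "\<dots> = exp (- (\<gamma> * real A)) * exp (- \<gamma>) ^ j"
      by (simp add: exp_of_nat_mult[symmetric] exp_add[symmetric] algebra_simps)
    finally show "exp (- (\<gamma> * real (a j))) \<le> exp (- (\<gamma> * real A)) * exp (- \<gamma>) ^ j" .
  qed
  also have "\<dots> = exp (- (\<gamma> * real A)) * ((1 - exp (- \<gamma>) ^ J) / (1 - exp (- \<gamma>)))"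
    using assms(1) by (simp add: sum_distrib_left[symmetric] sum_gp_strict)
  also have "\<dots> \<le> exp (- (\<gamma> * real A)) * (1 / (1 - exp (- \<gamma>)))"
    using assms(1) by (intro mult_left_mono divide_right_mono) auto
  finally show ?thesis by simp
qed

text \<open>Outside the exceptional sets the normalised polynomial is small at the scale \<open>a j\<close> by growth of the
  transfer matrix, and it cannot recover before the scale \<open>a (j + 1)\<close> without a resonance.\<close>

lemma small_between_scales:
  assumes \<alpha>: "\<And>i. norm (\<alpha> i) = \<kappa>" "\<kappa> < 1" and \<rho>: "\<rho> > 0" "\<rho>\<^sup>2 = 1 - \<kappa>\<^sup>2" and \<gamma>: "\<gamma> = - ln \<rho> / 4"
    and good: "good_scale \<alpha> \<rho> a t"
    and r1: "resonance \<alpha> 0 a (ec t) (ec (- x)) \<le> exp (\<gamma> / 2 * real a)"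
    and r2: "resonance \<alpha> a m (ec t) (ec (- x)) \<le> exp (\<gamma> / 4 * real a)"
  shows "(norm (szY \<alpha> (a + m) t x) / \<rho> ^ (a + m))\<^sup>2 \<le> exp (- (\<gamma> / 2 * real a))"
proof -
  let ?Y = "\<lambda>n. norm (szY \<alpha> n t x) / \<rho> ^ n"
  have \<alpha>1: "norm (\<alpha> i) < 1" for i using \<alpha> by simp
  have D: "szD (\<lambda>i. \<alpha> (b + i)) n = \<rho> ^ n * \<rho> ^ n" for b n
    unfolding szD_def \<alpha>(1) \<rho>(2)[symmetric] by (simp add: power2_eq_square power_mult_distrib)
  have Y0: "norm (szY \<alpha> n t x) > 0" for n using szY_nonzero[of \<alpha> n t x, OF \<alpha>1] by simp
  have "exp (\<gamma> * real a) \<le> exp ((- ln \<rho> / 4 + real a powr (-1/4)) * real a)"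
    unfolding \<gamma> exp_le_cancel_iff by (intro mult_right_mono) auto
  then have "\<rho> ^ a * exp (\<gamma> * real a) \<le> \<rho> ^ a * exp ((- ln \<rho> / 4 + real a powr (-1/4)) * real a)"
    using \<rho> by (intro mult_left_mono) auto
  then have p: "exp (\<gamma> * real a) \<le> norm (szp \<alpha> a (ec t)) / \<rho> ^ a"
    using order_trans[OF _ good[unfolded good_scale_def]] \<rho> by (simp add: pos_le_divide_eq mult.commute)
  \<comment> \<open>From time 0 the second component starts at 1, so here the resonance is the
    product of the normalised matrix entry and the normalised polynomial.\<close>
  have "resonance \<alpha> 0 a (ec t) (ec (- x)) = norm (szp \<alpha> a (ec t)) * norm (szY \<alpha> a t x) / (\<rho> ^ a * \<rho> ^ a)"
    using D[of 0 a] by (simp add: resonance_def szY_def)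
  then have "resonance \<alpha> 0 a (ec t) (ec (- x)) = norm (szp \<alpha> a (ec t)) / \<rho> ^ a * ?Y a" by simp
  then have "exp (\<gamma> * real a) * ?Y a \<le> exp (\<gamma> / 2 * real a)"
    using r1 mult_right_mono[OF p, of "?Y a"] \<rho> by simp
  then have "exp (- (\<gamma> * real a)) * (exp (\<gamma> * real a) * ?Y a) \<le> exp (- (\<gamma> * real a)) * exp (\<gamma> / 2 * real a)"
    by (intro mult_left_mono) auto
  then have Ya: "?Y a \<le> exp (- (\<gamma> / 2 * real a))"
    by (simp add: mult.assoc[symmetric] exp_add[symmetric] del: mult.assoc times_divide_eq_right)
  let ?P = "norm (szp (\<lambda>i. \<alpha> (a + i)) m (ec t))"
  \<comment> \<open>Between scales no growth of the block is known, but its normalised entry is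
    always at least 1, so the polynomial cannot recover by more than the resonance.\<close>
  have P: "\<rho> ^ m \<le> ?P" by (rule norm_szp_ge[of _ _ \<kappa>]) (use \<alpha> \<rho> in auto)
  have res: "resonance \<alpha> a m (ec t) (ec (- x)) = ?P * norm (szY \<alpha> (a + m) t x) / (norm (szY \<alpha> a t x) * (\<rho> ^ m * \<rho> ^ m))"
    unfolding resonance_def D szY_def ..
  have "\<rho> ^ m * norm (szY \<alpha> (a + m) t x) / (norm (szY \<alpha> a t x) * (\<rho> ^ m * \<rho> ^ m)) \<le> resonance \<alpha> a m (ec t) (ec (- x))"
    unfolding res using P Y0[of a] \<rho> by (intro divide_right_mono mult_right_mono) auto
  also have "\<dots> \<le> exp (\<gamma> / 4 * real a)" by (rule r2)
  finally have "?Y (a + m) / ?Y a \<le> exp (\<gamma> / 4 * real a)"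
    using \<rho> by (simp add: power_add field_simps)
  then have "?Y (a + m) \<le> exp (\<gamma> / 4 * real a) * ?Y a"
    by (subst (asm) pos_divide_le_eq) (use Y0[of a] \<rho> in auto)
  also have "\<dots> \<le> exp (\<gamma> / 4 * real a) * exp (- (\<gamma> / 2 * real a))" using Ya by (intro mult_left_mono) auto
  also have "\<dots> = exp (- (\<gamma> / 4 * real a))" by (simp add: exp_add[symmetric])
  finally have "?Y (a + m) \<le> exp (- (\<gamma> / 4 * real a))" .
  then have "(?Y (a + m))\<^sup>2 \<le> (exp (- (\<gamma> / 4 * real a)))\<^sup>2" using \<rho> by (intro power_mono) auto
  also have "\<dots> = exp (- (\<gamma> / 2 * real a))" by (simp add: exp_double[symmetric])
  finally show ?thesis .
qed

text \<open>On the exceptional set, made of the sets \<open>B j\<close> and the resonances, the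
  truncation at 1 leaves only its measure; elsewhere \<open>small_between_scales\<close> bounds the
  sum. Uniformity in \<open>N\<close> and \<open>N'\<close> is what later permits passing to the
  limit.\<close>

theorem nuN_tail:
  fixes k :: nat and \<omega> :: real and l :: complex
  assumes k: "k \<ge> 2" and \<omega>: "\<omega> \<notin> \<rat>" and l: "norm l < 1" "0 < norm l" and \<rho>: "\<rho> > 0" "\<rho>\<^sup>2 = 1 - (norm l)\<^sup>2"
    and \<epsilon>: "\<epsilon> > 0"
  defines "\<alpha> \<equiv> \<lambda>n. l * ec (\<omega> * real n ^ k)"
  shows "\<exists>A. \<forall>N' N. N' \<le> N \<longrightarrow>
    (\<integral>\<^sup>+p. ennreal (min 1 (\<Sum>n\<in>{A..N'}. (norm (szY \<alpha> n (fst p) (snd p)) / \<rho> ^ n)\<^sup>2)) \<partial>nuN \<alpha> N) \<le> ennreal \<epsilon>"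
proof -
  have \<alpha>\<kappa>: "norm (\<alpha> i) = norm l" for i by (simp add: \<alpha>_def norm_mult)
  have \<alpha>: "norm (\<alpha> i) < 1" for i using \<alpha>\<kappa> l by simp
  define \<gamma> where "\<gamma> = - ln \<rho> / 4"
  have "\<rho>\<^sup>2 < 1\<^sup>2" using \<rho> l by simp
  then have "\<rho> < 1" by (rule power_less_imp_less_base) simp
  then have \<gamma>: "\<gamma> > 0" using \<rho> by (simp add: \<gamma>_def)
  \<comment> \<open>There are at most \<open>exp (c * a j)\<close> times before the next scale, and
    a resonance at one of them has probability at most \<open>2 * exp (- (2 * c * a j))\<close>; the
    product is still summable.\<close>
  define c where "c = \<gamma> / 16"
  have c: "c > 0" using \<gamma> by (simp add: c_def)
  \<comment> \<open>Four of the five units are for the resonances, one for the sum off the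
    exceptional set.\<close>
  have "(\<lambda>A. 5 * exp (- (c * real A)) / (1 - exp (- c))) \<longlonglongrightarrow> 0" using c by real_asymp
  then have "eventually (\<lambda>A. 5 * exp (- (c * real A)) / (1 - exp (- c)) < \<epsilon> / 2) sequentially"
    using \<epsilon> by (intro order_tendstoD) auto
  then obtain K where K: "\<And>A. K \<le> A \<Longrightarrow> 5 * exp (- (c * real A)) / (1 - exp (- c)) < \<epsilon> / 2"
    unfolding eventually_sequentially by blast
  have "\<epsilon> / 2 > 0" using \<epsilon> by simp
  then obtain a :: "nat \<Rightarrow> nat" and B :: "nat \<Rightarrow> real set" where a0: "max K 2 \<le> a 0" and a2': "\<forall>j. (a j)\<^sup>2 \<le> a (Suc j)" and ae': "\<forall>j. real (a (Suc j)) \<le> exp (c * real (a j))"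
    and Bc': "\<forall>j. closed (B j)" and B01': "\<forall>j. B j \<subseteq> {0..1}" and Bs': "\<forall>n. (\<Sum>j<n. measure lebesgue (B j)) \<le> \<epsilon> / 2"
    and Bg': "\<forall>t\<in>{0..1}. (\<forall>i. t \<notin> B i) \<longrightarrow> (\<forall>j. good_scale \<alpha> \<rho> (a j) t)"
    by (rule scale_chain[OF k \<omega> l c \<rho>, where K = "max K 2", folded \<alpha>_def]) (rule that)
  note a2 = a2'[rule_format] and ae = ae'[rule_format] and Bc = Bc'[rule_format] and B01 = B01'[rule_format]
    and Bs = Bs'[rule_format] and Bg = Bg'[rule_format]
  have a_ge: "a 0 + j \<le> a j" for j
  proof (induction j)
    case (Suc j)
    have "2 \<le> a j" using Suc a0 by simp
    then have "a j + 1 \<le> (a j)\<^sup>2" by (simp add: power2_eq_square) (metis Suc_leI add_leE less_add_same_cancel1 mult_2 mult_le_mono1 nat_less_le numeral_2_eq_2 not_less_eq_eq order_trans zero_less_Suc)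
    then show ?case using Suc a2[of j] by linarith
  qed simp
  show ?thesis
  proof (intro exI[of _ "a 0"] allI impI)
    fix N' N :: nat assume N: "N' \<le> N"
    let ?\<phi> = "\<lambda>n p. (norm (szY \<alpha> n (fst p) (snd p)) / \<rho> ^ n)\<^sup>2"
    let ?res = "\<lambda>b m p. resonance \<alpha> b m (ec (fst p)) (ec (- snd p))"
    define J where "J = Suc N'"
    have aJ: "N' < a J" using a_ge[of J] by (simp add: J_def)
    define R where "R j = {p. exp (2 * (\<gamma> / 4 * real (a j))) < ?res 0 (a j) p}" for j
    define R' where "R' j m = {p. exp (2 * (\<gamma> / 8 * real (a j))) < ?res (a j) m p}" for j m
    define I where "I j = {m. m < a (Suc j) \<and> a j + m \<le> N'}" for j
    have Ifin: "finite (I j)" "card (I j) \<le> a (Suc j)" for j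
    proof -
      have "I j \<subseteq> {..<a (Suc j)}" by (auto simp: I_def)
      then show "finite (I j)" "card (I j) \<le> a (Suc j)" using finite_subset card_mono[of "{..<a (Suc j)}" "I j"] by auto
    qed
    \<comment> \<open>Resonance bounds for \<open>nuN \<alpha> N\<close> reach up to time
      \<open>N\<close>, so only scales starting by \<open>N' \<le> N\<close> enter; later scales do
      not meet the range of summation.\<close>
    define JJ where "JJ = {j. j < J \<and> a j \<le> N'}"
    have JJfin: "finite JJ" "JJ \<subseteq> {..<J}" by (auto simp: JJ_def)
    define Bad1 where "Bad1 = (\<Union>j. B j) \<times> (UNIV :: real set)"
    define Bad2 where "Bad2 = (\<Union>j\<in>JJ. R j \<union> (\<Union>m\<in>I j. R' j m))"
    have Rs: "R j \<in> sets borel" "R' j m \<in> sets borel" for j m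
      unfolding R_def R'_def by (intro nuN_resonance_tail(1)[of \<alpha> _ _ "_ + _", OF \<alpha> order_refl])+
    have B1s: "Bad1 \<in> sets (borel :: (real \<times> real) measure)"
      unfolding Bad1_def by (intro borel_Times sets.countable_UN) (use Bc in auto)
    have B2s: "Bad2 \<in> sets (borel :: (real \<times> real) measure)"
      unfolding Bad2_def using Rs JJfin Ifin by (intro sets.finite_UN sets.Un) auto
    have eB1: "emeasure (nuN \<alpha> N) Bad1 \<le> ennreal (\<epsilon> / 2)"
    proof -
      have Bb: "(\<Union>j. B j) \<in> sets borel" using Bc by (intro sets.countable_UN) auto
      have "emeasure (nuN \<alpha> N) Bad1 = emeasure lborel ((\<Union>j. B j) \<inter> {0..1})"
        unfolding Bad1_def by (rule nuN_marginal[of \<alpha>, OF \<alpha> Bb])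
      also have "\<dots> \<le> emeasure lborel (\<Union>j. B j)" using Bb by (intro emeasure_mono) auto
      also have "\<dots> \<le> (\<Sum>j. emeasure lborel (B j))" using Bc by (intro emeasure_subadditive_countably) auto
      also have "\<dots> \<le> ennreal (\<epsilon> / 2)"
      proof (rule suminf_le_const)
        fix n
        have "emeasure lborel (B j) = ennreal (measure lebesgue (B j))" for j
        proof -
          have "compact (B j)" using Bc B01 by (metis bounded_closed_interval bounded_subset compact_eq_bounded_closed)
          then have "B j \<in> lmeasurable" by (rule lmeasurable_compact)
          then have "emeasure lebesgue (B j) = ennreal (measure lebesgue (B j))" by (simp only: emeasure_eq_measure2 fmeasurableD2)
          then show ?thesis using Bc by simp
        qed
        then have "(\<Sum>j<n. emeasure lborel (B j)) = ennreal (\<Sum>j<n. measure lebesgue (B j))" by (simp add: sum_ennreal)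
        also have "\<dots> \<le> ennreal (\<epsilon> / 2)" by (intro ennreal_leI Bs)
        finally show "(\<Sum>j<n. emeasure lborel (B j)) \<le> ennreal (\<epsilon> / 2)" .
      qed simp
      finally show ?thesis .
    qed
    have eB2: "emeasure (nuN \<alpha> N) Bad2 \<le> ennreal (\<Sum>j<J. 4 * exp (- (c * real (a j))))"
    proof -
      have one: "emeasure (nuN \<alpha> N) (R j \<union> (\<Union>m\<in>I j. R' j m)) \<le> ennreal (4 * exp (- (c * real (a j))))" if j: "j \<in> JJ" for j
      proof -
        have "emeasure (nuN \<alpha> N) (R j \<union> (\<Union>m\<in>I j. R' j m)) \<le> emeasure (nuN \<alpha> N) (R j) + emeasure (nuN \<alpha> N) (\<Union>m\<in>I j. R' j m)"
          using Rs Ifin by (intro emeasure_subadditive) auto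
        also have "\<dots> \<le> ennreal (2 * exp (- (\<gamma> / 4 * real (a j)))) + ennreal (2 * exp (- (c * real (a j))))"
        proof (rule add_mono)
          show "emeasure (nuN \<alpha> N) (R j) \<le> ennreal (2 * exp (- (\<gamma> / 4 * real (a j))))"
            unfolding R_def using j N by (intro nuN_resonance_tail(2)[of \<alpha>, OF \<alpha>]) (auto simp: JJ_def)
          have "emeasure (nuN \<alpha> N) (\<Union>m\<in>I j. R' j m) \<le> (\<Sum>m\<in>I j. emeasure (nuN \<alpha> N) (R' j m))"
            using Rs Ifin by (intro emeasure_subadditive_finite) auto
          also have "\<dots> \<le> (\<Sum>m\<in>I j. ennreal (2 * exp (- (\<gamma> / 8 * real (a j)))))"
            unfolding R'_def using N by (intro sum_mono nuN_resonance_tail(2)[of \<alpha>, OF \<alpha>]) (auto simp: I_def)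
          also have "\<dots> = ennreal (real (card (I j)) * (2 * exp (- (\<gamma> / 8 * real (a j)))))"
            by (simp add: ennreal_mult ennreal_of_nat_eq_real_of_nat)
          also have "\<dots> \<le> ennreal (exp (c * real (a j)) * (2 * exp (- (\<gamma> / 8 * real (a j)))))"
            using Ifin(2)[of j] ae[of j] by (intro ennreal_leI mult_right_mono) (auto intro: order_trans[OF of_nat_mono])
          also have "exp (c * real (a j)) * (2 * exp (- (\<gamma> / 8 * real (a j)))) = 2 * exp (- (c * real (a j)))"
            by (simp add: c_def exp_add[symmetric])
          finally show "emeasure (nuN \<alpha> N) (\<Union>m\<in>I j. R' j m) \<le> ennreal (2 * exp (- (c * real (a j))))" .
        qed
        also have "\<dots> = ennreal (2 * exp (- (\<gamma> / 4 * real (a j))) + 2 * exp (- (c * real (a j))))"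
          by (subst ennreal_plus) auto
        also have "\<dots> \<le> ennreal (4 * exp (- (c * real (a j))))"
        proof (rule ennreal_leI)
          have "c * real (a j) \<le> \<gamma> / 4 * real (a j)" using \<gamma> by (intro mult_right_mono) (auto simp: c_def)
          then have "exp (- (\<gamma> / 4 * real (a j))) \<le> exp (- (c * real (a j)))" by simp
          then show "2 * exp (- (\<gamma> / 4 * real (a j))) + 2 * exp (- (c * real (a j))) \<le> 4 * exp (- (c * real (a j)))" by linarith
        qed
        finally show ?thesis .
      qed
      have "emeasure (nuN \<alpha> N) Bad2 \<le> (\<Sum>j\<in>JJ. emeasure (nuN \<alpha> N) (R j \<union> (\<Union>m\<in>I j. R' j m)))"
        unfolding Bad2_def using Rs Ifin JJfin by (intro emeasure_subadditive_finite) auto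
      also have "\<dots> \<le> (\<Sum>j\<in>JJ. ennreal (4 * exp (- (c * real (a j)))))" by (intro sum_mono one)
      also have "\<dots> \<le> (\<Sum>j<J. ennreal (4 * exp (- (c * real (a j)))))" using JJfin by (intro sum_mono2) auto
      also have "\<dots> = ennreal (\<Sum>j<J. 4 * exp (- (c * real (a j))))" by (intro sum_ennreal) auto
      finally show ?thesis .
    qed
    define S where "S = (\<Sum>j<J. exp (- (c * real (a j))))"
    have S0: "0 \<le> S" unfolding S_def by (intro sum_nonneg) auto
    have pw: "ennreal (min 1 (\<Sum>n\<in>{a 0..N'}. ?\<phi> n p)) \<le> indicator Bad1 p + indicator Bad2 p + ennreal S"
      if t: "fst p \<in> {0..1}" for p
    proof (cases "p \<in> Bad1 \<or> p \<in> Bad2")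
      case True
      have "ennreal (min 1 (\<Sum>n\<in>{a 0..N'}. ?\<phi> n p)) \<le> 1" by (simp add: ennreal_le_1)
      also have "\<dots> \<le> indicator Bad1 p + indicator Bad2 p + ennreal S" using True by (auto simp: indicator_def add_increasing2)
      finally show ?thesis .
    next
      case False
      have notB: "fst p \<notin> B i" for i using False by (cases p) (auto simp: Bad1_def)
      have bound: "?\<phi> n p \<le> (\<Sum>j<J. if n \<in> {a j..<a (Suc j)} then exp (- (\<gamma> / 2 * real (a j))) else 0)" if n: "n \<in> {a 0..N'}" for n
      proof -
        define j where "j = (LEAST j. n < a (Suc j))"
        have ex: "n < a (Suc N')" using a_ge[of "Suc N'"] n by simp
        have jl: "n < a (Suc j)" unfolding j_def by (rule LeastI[of _ N']) (rule ex)
        have jN: "j \<le> N'" unfolding j_def by (rule Least_le) (rule ex)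
        have aj: "a j \<le> n"
        proof (cases j)
          case (Suc i)
          then have "\<not> n < a (Suc i)" using not_less_Least[of i "\<lambda>j. n < a (Suc j)"] by (simp add: j_def)
          then show ?thesis using Suc by simp
        qed (use n in auto)
        obtain m where m: "n = a j + m" using aj le_Suc_ex by blast
        have jJ: "j < J" using jN by (simp add: J_def)
        have jJJ: "j \<in> JJ" using jJ aj n by (auto simp: JJ_def)
        have mI: "m \<in> I j" using m jl n by (auto simp: I_def)
        have "p \<notin> R j" "p \<notin> R' j m" using False jJJ mI by (auto simp: Bad2_def)
        then have "?res 0 (a j) p \<le> exp (\<gamma> / 2 * real (a j))" "?res (a j) m p \<le> exp (\<gamma> / 4 * real (a j))"
          by (auto simp: R_def R'_def not_less)
        then have "?\<phi> n p \<le> exp (- (\<gamma> / 2 * real (a j)))"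
          unfolding m using Bg[OF t notB] by (intro small_between_scales[OF \<alpha>\<kappa> l(1) \<rho> \<gamma>_def]) auto
        also have "\<dots> = (if n \<in> {a j..<a (Suc j)} then exp (- (\<gamma> / 2 * real (a j))) else 0)" using aj jl by simp
        also have "\<dots> \<le> (\<Sum>j<J. if n \<in> {a j..<a (Suc j)} then exp (- (\<gamma> / 2 * real (a j))) else 0)"
          using jJ by (intro member_le_sum) auto
        finally show ?thesis .
      qed
      have "(\<Sum>n\<in>{a 0..N'}. ?\<phi> n p) \<le> (\<Sum>n\<in>{a 0..N'}. \<Sum>j<J. if n \<in> {a j..<a (Suc j)} then exp (- (\<gamma> / 2 * real (a j))) else 0)"
        by (intro sum_mono bound)
      also have "\<dots> = (\<Sum>j<J. \<Sum>n\<in>{a 0..N'}. if n \<in> {a j..<a (Suc j)} then exp (- (\<gamma> / 2 * real (a j))) else 0)"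
        by (rule sum.swap)
      also have "\<dots> \<le> (\<Sum>j<J. exp (- (c * real (a j))))"
      proof (rule sum_mono)
        fix j
        have "(\<Sum>n\<in>{a 0..N'}. if n \<in> {a j..<a (Suc j)} then exp (- (\<gamma> / 2 * real (a j))) else 0)
            = real (card ({a 0..N'} \<inter> {a j..<a (Suc j)})) * exp (- (\<gamma> / 2 * real (a j)))"
          by (simp add: sum.If_cases Int_def)
        also have "\<dots> \<le> real (a (Suc j)) * exp (- (\<gamma> / 2 * real (a j)))"
        proof (intro mult_right_mono of_nat_mono)
          have "card ({a 0..N'} \<inter> {a j..<a (Suc j)}) \<le> card {a j..<a (Suc j)}" by (intro card_mono) auto
          then show "card ({a 0..N'} \<inter> {a j..<a (Suc j)}) \<le> a (Suc j)" by simp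
        qed auto
        also have "\<dots> \<le> exp (c * real (a j)) * exp (- (\<gamma> / 2 * real (a j)))" using ae[of j] by (intro mult_right_mono) auto
        also have "\<dots> = exp (c * real (a j) - \<gamma> / 2 * real (a j))" by (simp only: exp_add[symmetric] diff_conv_add_uminus)
        also have "\<dots> \<le> exp (- (c * real (a j)))"
        proof -
          have "2 * c \<le> \<gamma> / 2" using \<gamma> by (simp add: c_def)
          then have "(2 * c) * real (a j) \<le> (\<gamma> / 2) * real (a j)" by (intro mult_right_mono) auto
          then show ?thesis by simp
        qed
        finally show "(\<Sum>n\<in>{a 0..N'}. if n \<in> {a j..<a (Suc j)} then exp (- (\<gamma> / 2 * real (a j))) else 0) \<le> exp (- (c * real (a j)))" .
      qed
      finally have "(\<Sum>n\<in>{a 0..N'}. ?\<phi> n p) \<le> S" by (simp add: S_def)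
      then have "ennreal (min 1 (\<Sum>n\<in>{a 0..N'}. ?\<phi> n p)) \<le> ennreal S" by (intro ennreal_leI) auto
      then show ?thesis using False by simp
    qed
    have ae01: "AE p in nuN \<alpha> N. fst p \<in> {0..1}"
      unfolding nuN_def by (subst AE_density) (auto simp: case_prod_beta indicator_def)
    have "(\<integral>\<^sup>+p. ennreal (min 1 (\<Sum>n\<in>{a 0..N'}. ?\<phi> n p)) \<partial>nuN \<alpha> N)
        \<le> (\<integral>\<^sup>+p. indicator Bad1 p + indicator Bad2 p + ennreal S \<partial>nuN \<alpha> N)"
      by (intro nn_integral_mono_AE eventually_mono[OF ae01] pw)
    also have "\<dots> = emeasure (nuN \<alpha> N) Bad1 + emeasure (nuN \<alpha> N) Bad2 + ennreal S"
      using B1s B2s emeasure_nuN_UNIV[of \<alpha> N, OF \<alpha>] by (subst nn_integral_add) (auto simp: nn_integral_add)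
    also have "\<dots> \<le> ennreal (\<epsilon> / 2) + ennreal (\<Sum>j<J. 4 * exp (- (c * real (a j)))) + ennreal S"
      by (intro add_mono eB1 eB2 order_refl)
    also have "\<dots> = ennreal (\<epsilon> / 2 + (4 * S + S))"
      using \<epsilon> S0 by (simp add: S_def sum_distrib_left[symmetric] ennreal_plus[symmetric] del: ennreal_plus)
    also have "\<dots> \<le> ennreal \<epsilon>"
    proof (rule ennreal_leI)
      have "S \<le> exp (- (c * real (a 0))) / (1 - exp (- c))"
        unfolding S_def by (rule exp_neg_sum_le[OF c a_ge])
      then have "5 * S \<le> 5 * exp (- (c * real (a 0))) / (1 - exp (- c))" by simp
      also have "\<dots> < \<epsilon> / 2" using a0 by (intro K) auto
      finally show "\<epsilon> / 2 + (4 * S + S) \<le> \<epsilon>" by simp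
    qed
    finally show "(\<integral>\<^sup>+p. ennreal (min 1 (\<Sum>n\<in>{a 0..N'}. ?\<phi> n p)) \<partial>nuN \<alpha> N) \<le> ennreal \<epsilon>" .
  qed
qed

section \<open>Orthogonal polynomials on the unit circle\<close>

lemma poly_reverse_circle:
  assumes "degree p \<le> n" "norm z = 1"
  shows "poly (szego_reverse n p) z = z ^ n * cnj (poly p z)"
proof -
  have z: "z \<noteq> 0" using assms by auto
  have "z * cnj z = 1" using assms by (simp add: complex_norm_square[symmetric])
  then have "inverse (cnj z) = z" using z by (metis complex_cnj_zero_iff inverse_unique mult.commute)
  then show ?thesis using poly_szego_reverse[OF assms(1) z] by simp
qed

lemma degree_Phi: "degree (Phi \<beta> n) = n" and coeff_Phi: "coeff (Phi \<beta> n) n = 1"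
  using Phi_monic[of \<beta> n] by auto

lemma Phi_szego:
  assumes z: "norm z = 1"
  shows "poly (Phi \<beta> n) z = snd (szego \<beta> z (1, 1) n)" "z ^ n * cnj (poly (Phi \<beta> n) z) = fst (szego \<beta> z (1, 1) n)"
proof -
  have zc: "z * cnj z = 1" using z by (simp add: complex_norm_square[symmetric])
  have "poly (Phi \<beta> n) z = snd (szego \<beta> z (1, 1) n) \<and> z ^ n * cnj (poly (Phi \<beta> n) z) = fst (szego \<beta> z (1, 1) n)"
  proof (induction n)
    case (Suc n)
    have P: "poly (Phi \<beta> (Suc n)) z = z * poly (Phi \<beta> n) z - cnj (\<beta> n) * (z ^ n * cnj (poly (Phi \<beta> n) z))"
      using poly_reverse_circle[OF _ z, of "Phi \<beta> n" n] by (simp add: degree_Phi poly_monom)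
    have "z ^ Suc n * cnj (poly (Phi \<beta> (Suc n)) z)
        = (z * cnj z) * (z ^ n * cnj (poly (Phi \<beta> n) z)) - \<beta> n * z * ((z * cnj z) ^ n * poly (Phi \<beta> n) z)"
      unfolding P by (simp add: algebra_simps power_mult_distrib)
    then have X: "z ^ Suc n * cnj (poly (Phi \<beta> (Suc n)) z)
        = z ^ n * cnj (poly (Phi \<beta> n) z) - \<beta> n * z * poly (Phi \<beta> n) z" unfolding zc by simp
    have IH: "poly (Phi \<beta> n) z = snd (szego \<beta> z (1, 1) n)" "z ^ n * cnj (poly (Phi \<beta> n) z) = fst (szego \<beta> z (1, 1) n)"
      using Suc by auto
    have "poly (Phi \<beta> (Suc n)) z = snd (szego \<beta> z (1, 1) (Suc n))" unfolding P IH(2) unfolding IH(1) by simp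
    moreover have "z ^ Suc n * cnj (poly (Phi \<beta> (Suc n)) z) = fst (szego \<beta> z (1, 1) (Suc n))"
      unfolding X IH(2) unfolding IH(1) by simp
    ultimately show ?case by blast
  qed simp
  then show "poly (Phi \<beta> n) z = snd (szego \<beta> z (1, 1) n)" "z ^ n * cnj (poly (Phi \<beta> n) z) = fst (szego \<beta> z (1, 1) n)" by auto
qed

text \<open>Conjugation by the diagonal matrix with entries \<open>V\<close> and 1 moves the
  rotation of all coefficients into the initial vector.\<close>

lemma szego_rotate:
  assumes "norm V = 1"
  shows "snd (szego (\<lambda>i. \<alpha> i * cnj V) z (1, 1) n) = snd (szego \<alpha> z (V, 1) n)"
    "V * fst (szego (\<lambda>i. \<alpha> i * cnj V) z (1, 1) n) = fst (szego \<alpha> z (V, 1) n)"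
proof -
  have V: "V * cnj V = 1" using assms by (simp add: complex_norm_square[symmetric])
  have "snd (szego (\<lambda>i. \<alpha> i * cnj V) z (1, 1) n) = snd (szego \<alpha> z (V, 1) n) \<and>
    V * fst (szego (\<lambda>i. \<alpha> i * cnj V) z (1, 1) n) = fst (szego \<alpha> z (V, 1) n)"
  proof (induction n)
    case (Suc n)
    let ?x = "fst (szego (\<lambda>i. \<alpha> i * cnj V) z (1, 1) n)" and ?y = "snd (szego (\<lambda>i. \<alpha> i * cnj V) z (1, 1) n)"
    have "V * (?x - \<alpha> n * cnj V * z * ?y) = V * ?x - \<alpha> n * z * ((V * cnj V) * ?y)" by (simp add: algebra_simps)
    moreover have "z * ?y - cnj (\<alpha> n * cnj V) * ?x = z * ?y - cnj (\<alpha> n) * (V * ?x)" by (simp add: algebra_simps)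
    ultimately show ?case using Suc by (simp add: V)
  qed simp
  then show "snd (szego (\<lambda>i. \<alpha> i * cnj V) z (1, 1) n) = snd (szego \<alpha> z (V, 1) n)"
    "V * fst (szego (\<lambda>i. \<alpha> i * cnj V) z (1, 1) n) = fst (szego \<alpha> z (V, 1) n)" by auto
qed

lemma Phi_span:
  assumes "degree p \<le> n"
  shows "\<exists>c. p = (\<Sum>j\<le>n. smult (c j) (Phi \<beta> j))"
  using assms
proof (induction n arbitrary: p)
  case 0
  then have "degree p = 0" by simp
  then have "p = [:coeff p 0:]" by (metis coeff_pCons_0 degree_eq_zeroE)
  then show ?case by (intro exI[of _ "\<lambda>_. coeff p 0"]) (simp add: smult_one)
next
  case (Suc n)
  define p' where "p' = p - smult (coeff p (Suc n)) (Phi \<beta> (Suc n))"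
  have "degree p' \<le> Suc n" unfolding p'_def
    using Suc.prems degree_Phi[of \<beta> "Suc n"] degree_smult_le[of "coeff p (Suc n)" "Phi \<beta> (Suc n)"] by (intro degree_diff_le) auto
  moreover have "coeff p' (Suc n) = 0" using coeff_Phi[of \<beta> "Suc n"] by (simp add: p'_def del: Phi.simps)
  ultimately have "degree p' \<le> n" by (metis coeff_eq_0 le_SucE leading_coeff_0_iff degree_0 le0)
  then obtain c where c: "p' = (\<Sum>j\<le>n. smult (c j) (Phi \<beta> j))" using Suc.IH by blast
  have "p = p' + smult (coeff p (Suc n)) (Phi \<beta> (Suc n))" by (simp add: p'_def)
  also have "\<dots> = (\<Sum>j\<le>Suc n. smult ((c(Suc n := coeff p (Suc n))) j) (Phi \<beta> j))"
    unfolding c by (simp del: Phi.simps)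
  finally show ?case by blast
qed

text \<open>Integration against the \<open>N\<close>-th Bernstein--Szego approximant.\<close>

definition Isig :: "(nat \<Rightarrow> complex) \<Rightarrow> nat \<Rightarrow> (complex \<Rightarrow> complex) \<Rightarrow> complex" where
  "Isig \<beta> N f = integral {0..1} (\<lambda>t. f (ec t) * of_real (szD \<beta> N / (norm (poly (Phi \<beta> N) (ec t)))\<^sup>2))"

text \<open>The Moebius iteration of \<open>szq_less_szp\<close>, now started at the boundary point
  1 instead of 0; hence only the weak inequality between the components.\<close>

lemma szego_unit_nonzero:
  assumes \<beta>: "\<And>i. norm (\<beta> i) < 1" and z: "norm z \<le> 1"
  shows "fst (szego \<beta> z (1, 1) n) \<noteq> 0 \<and> norm (snd (szego \<beta> z (1, 1) n)) \<le> norm (fst (szego \<beta> z (1, 1) n))"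
proof (induction n)
  case (Suc n)
  let ?x = "fst (szego \<beta> z (1, 1) n)" and ?y = "snd (szego \<beta> z (1, 1) n)"
  have x: "?x \<noteq> 0" and yx: "norm ?y \<le> norm ?x" using Suc by auto
  define b where "b = z * (?y / ?x)"
  have "norm z * norm (?y / ?x) \<le> 1 * 1" using z x yx by (intro mult_mono) (auto simp: norm_divide divide_simps)
  then have b1: "norm b \<le> 1" unfolding b_def norm_mult by simp
  have e: "fst (szego \<beta> z (1, 1) (Suc n)) = ?x * (1 - \<beta> n * b)" "snd (szego \<beta> z (1, 1) (Suc n)) = ?x * (b - cnj (\<beta> n))"
    using x by (simp_all add: b_def field_simps)
  have "norm (\<beta> n * b) \<le> norm (\<beta> n) * 1" unfolding norm_mult using b1 by (intro mult_left_mono) auto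
  then have "\<beta> n * b \<noteq> 1" using \<beta>[of n] by auto
  then have "1 - \<beta> n * b \<noteq> 0" by simp
  moreover have "norm (b - cnj (\<beta> n)) \<le> norm (1 - \<beta> n * b)"
  proof -
    have "complex_of_real ((norm (1 - \<beta> n * b))\<^sup>2 - (norm (b - cnj (\<beta> n)))\<^sup>2)
        = complex_of_real ((1 - (norm (\<beta> n))\<^sup>2) * (1 - (norm b)\<^sup>2))"
      unfolding of_real_diff of_real_mult complex_norm_square by (simp add: algebra_simps)
    then have "(norm (1 - \<beta> n * b))\<^sup>2 - (norm (b - cnj (\<beta> n)))\<^sup>2 = (1 - (norm (\<beta> n))\<^sup>2) * (1 - (norm b)\<^sup>2)"
      by (simp only: of_real_eq_iff)
    also have "\<dots> \<ge> 0" using \<beta>[of n] b1 by (intro mult_nonneg_nonneg) (auto simp: power_le_one)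
    finally show ?thesis using power2_le_imp_le[of "norm (b - cnj (\<beta> n))" "norm (1 - \<beta> n * b)"] by simp
  qed
  ultimately show ?case unfolding e(1) e(2) norm_mult using x by (intro conjI mult_left_mono) simp_all
qed simp

lemma szp_at_0 [simp]: "szp \<alpha> n 0 = 1"
  by (induction n) (simp_all add: szp_Suc)

section \<open>Orthogonality for the Bernstein--Szego density\<close>

context
  fixes \<beta> :: "nat \<Rightarrow> complex"
  assumes \<beta>: "\<And>i. norm (\<beta> i) < 1"
begin

lemma Phi_circle_nonzero: "norm z = 1 \<Longrightarrow> poly (Phi \<beta> n) z \<noteq> 0"
  using szego_unit_nonzero[of \<beta> z n, OF \<beta>] Phi_szego(2)[of z n \<beta>] by auto

lemma Isig_integrable:
  fixes f :: "complex \<Rightarrow> complex"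
  assumes "continuous_on (sphere 0 1) f"
  shows "(\<lambda>t. f (ec t) * of_real (szD \<beta> N / (norm (poly (Phi \<beta> N) (ec t)))\<^sup>2)) integrable_on {0..1}"
proof (rule integrable_continuous_interval)
  have e: "continuous_on {0..1} (\<lambda>t. ec t)" unfolding cis_conv_exp by (intro continuous_intros)
  have "continuous_on {0..1} (\<lambda>t. f (ec t))"
    by (rule continuous_on_compose2[OF assms e]) auto
  then show "continuous_on {0..1} (\<lambda>t. f (ec t) * of_real (szD \<beta> N / (norm (poly (Phi \<beta> N) (ec t)))\<^sup>2))"
    by (intro continuous_intros e) (auto simp: Phi_circle_nonzero)
qed

lemma Isig_add:
  assumes "continuous_on (sphere 0 1) f" "continuous_on (sphere 0 1) g"
  shows "Isig \<beta> N (\<lambda>z. f z + g z) = Isig \<beta> N f + Isig \<beta> N g"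
  unfolding Isig_def distrib_right by (intro integral_add Isig_integrable assms)

lemma Isig_cmult: "Isig \<beta> N (\<lambda>z. c * f z) = c * Isig \<beta> N f"
  unfolding Isig_def mult.assoc by (rule integral_mult_right)

lemma Isig_cong: "(\<And>z. norm z = 1 \<Longrightarrow> f z = g z) \<Longrightarrow> Isig \<beta> N f = Isig \<beta> N g"
  unfolding Isig_def by (intro integral_cong) auto

lemma Isig_cnj: "Isig \<beta> N (\<lambda>z. cnj (f z)) = cnj (Isig \<beta> N f)"
  unfolding Isig_def by (simp add: integral_cnj)

text \<open>On the circle the density is the real part of the Caratheodory function
  \<open>F\<close>, which is holomorphic in the disc with \<open>F 0 = 1\<close>.\<close>

lemma Isig_1: "Isig \<beta> N (\<lambda>_. 1) = 1"
proof -
  define F where "F z = (szp \<beta> N z - szr \<beta> N z) / (szp \<beta> N z + szr \<beta> N z)" for z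
  have X: "fst (szego \<beta> z (1, 1) N) = szp \<beta> N z + szr \<beta> N z" for z by (simp add: szego_eq)
  have hol: "F holomorphic_on cball 0 1"
    unfolding F_def using szego_unit_nonzero[of \<beta> _ N, OF \<beta>] by (intro holomorphic_intros szego_holomorphic) (auto simp: X)
  have "((\<lambda>t. F (ec t)) has_integral F 0) {0..1}"
    by (rule circle_mean_value) (use hol in \<open>auto intro: holomorphic_on_subset holomorphic_on_imp_continuous_on\<close>)
  from has_integral_Re[OF this] have "((\<lambda>t. Re (F (ec t))) has_integral 1) {0..1}" by (simp add: F_def)
  moreover have "Re (F z) = szD \<beta> N / (norm (poly (Phi \<beta> N) z))\<^sup>2" if z: "norm z = 1" for z
  proof -
    let ?p = "szp \<beta> N z" and ?r = "szr \<beta> N z"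
    have nr: "norm ?r = norm (szq \<beta> N z)" unfolding szs_szr_circle(2)[OF z] by (simp add: norm_mult norm_power z)
    have "norm (?p + ?r) = norm (z ^ N * cnj (poly (Phi \<beta> N) z))" unfolding Phi_szego(2)[OF z] X ..
    then have nX: "norm (?p + ?r) = norm (poly (Phi \<beta> N) z)" by (simp add: norm_mult norm_power z)
    have "Re (F z) = Re ((?p - ?r) * cnj (?p + ?r)) / (norm (?p + ?r))\<^sup>2"
    proof -
      have "F z = ((?p - ?r) * cnj (?p + ?r)) / of_real ((norm (?p + ?r))\<^sup>2)"
        unfolding F_def by (subst complex_div_cnj) simp
      then show ?thesis by (simp only: Re_divide_of_real)
    qed
    also have "Re ((?p - ?r) * cnj (?p + ?r)) = (norm ?p)\<^sup>2 - (norm ?r)\<^sup>2"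
      unfolding cmod_power2 by (simp add: algebra_simps power2_eq_square)
    also have "\<dots> = szD \<beta> N" unfolding nr szp_szq_circle[OF z] szD_def ..
    finally show ?thesis by (simp add: nX)
  qed
  ultimately have "((\<lambda>t. szD \<beta> N / (norm (poly (Phi \<beta> N) (ec t)))\<^sup>2) has_integral 1) {0..1}" by simp
  then have "((\<lambda>t. complex_of_real (szD \<beta> N / (norm (poly (Phi \<beta> N) (ec t)))\<^sup>2)) has_integral of_real 1) {0..1}"
    by (rule has_integral_of_real)
  then show ?thesis unfolding Isig_def by (simp add: integral_unique)
qed

text \<open>One factor of the density cancels against \<open>\<Phi>\<^sub>N\<close>. What is left is
  \<open>z ^ (N - j)\<close> over the reversed polynomial, which has no zeros in the closed disc, so
  the mean is the value 0 at the origin.\<close>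

lemma Isig_orth_top:
  assumes j: "j < N"
  shows "Isig \<beta> N (\<lambda>z. poly (Phi \<beta> N) z * cnj (z ^ j)) = 0"
proof -
  define G where "G z = of_real (szD \<beta> N) * z ^ (N - j) / fst (szego \<beta> z (1, 1) N)" for z
  have X: "fst (szego \<beta> z (1, 1) N) = szp \<beta> N z + szr \<beta> N z" for z by (simp add: szego_eq)
  have hol: "G holomorphic_on cball 0 1"
    unfolding G_def X using szego_unit_nonzero[of \<beta> _ N, OF \<beta>] by (intro holomorphic_intros szego_holomorphic) (auto simp: X)
  have "((\<lambda>t. G (ec t)) has_integral G 0) {0..1}"
    by (rule circle_mean_value) (use hol in \<open>auto intro: holomorphic_on_subset holomorphic_on_imp_continuous_on\<close>)
  moreover have "G 0 = 0" using j by (simp add: G_def)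
  moreover have "poly (Phi \<beta> N) z * cnj (z ^ j) * of_real (szD \<beta> N / (norm (poly (Phi \<beta> N) z))\<^sup>2) = G z" if z: "norm z = 1" for z
  proof -
    let ?P = "poly (Phi \<beta> N) z"
    have P0: "?P \<noteq> 0" by (rule Phi_circle_nonzero[OF z])
    have z0: "z \<noteq> 0" using z by auto
    have zc: "z * cnj z = 1" using z by (simp add: complex_norm_square[symmetric])
    have "z ^ N = z ^ j * z ^ (N - j)" using j by (simp add: power_add[symmetric])
    moreover have "z ^ j * cnj z ^ j = 1" unfolding power_mult_distrib[symmetric] zc by simp
    ultimately have "z ^ N * cnj z ^ j = z ^ (N - j)" by (metis mult.commute mult.left_commute mult_1)
    moreover have "of_real ((norm ?P)\<^sup>2) = ?P * cnj ?P" by (rule complex_norm_square)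
    then have "?P * cnj (z ^ j) * of_real (szD \<beta> N / (norm ?P)\<^sup>2) = of_real (szD \<beta> N) * cnj z ^ j / cnj ?P"
      using P0 by (simp add: field_simps)
    ultimately show ?thesis
      unfolding G_def Phi_szego(2)[OF z, symmetric] using z0 P0 by (simp add: field_simps) (metis mult.assoc mult.commute)
  qed
  ultimately have "((\<lambda>t. poly (Phi \<beta> N) (ec t) * cnj (ec t ^ j) * of_real (szD \<beta> N / (norm (poly (Phi \<beta> N) (ec t)))\<^sup>2)) has_integral 0) {0..1}"
    by simp
  then show ?thesis unfolding Isig_def by (rule integral_unique)
qed

text \<open>Orthogonality for the Bernstein--Szego density is passed down from degree \<open>N\<close> by the inverse recursion.\<close>

lemma Isig_orth:
  assumes "n \<le> N" "j < n"
  shows "Isig \<beta> N (\<lambda>z. poly (Phi \<beta> n) z * cnj (z ^ j)) = 0"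
  using assms
proof (induction "N - n" arbitrary: n j)
  case 0
  then show ?case using Isig_orth_top by simp
next
  case (Suc d)
  let ?\<Phi> = "\<lambda>n z. poly (Phi \<beta> n) z"
  have IH: "Isig \<beta> N (\<lambda>z. ?\<Phi> (Suc n) z * cnj (z ^ i)) = 0" if "i \<le> n" for i
    using Suc.hyps(1)[of "Suc n" i] Suc.hyps(2) Suc.prems that by simp
  have cont: "continuous_on (sphere 0 1) (\<lambda>z. ?\<Phi> m z * cnj (z ^ i))" for m i by (intro continuous_intros)
  \<comment> \<open>The inverse recursion expresses \<open>z * \<Phi>\<^sub>n\<close> by
    \<open>\<Phi>\<^sub>n\<^sub>+\<^sub>1\<close> and its reversal. After multiplication by
    \<open>cnj z ^ Suc j\<close> the two terms are tested against the exponents \<open>Suc j\<close>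
    and \<open>n - j\<close>, both at most \<open>n\<close>.\<close>
  have r: "(1 - \<beta> n * cnj (\<beta> n)) * (?\<Phi> n z * cnj (z ^ j))
      = ?\<Phi> (Suc n) z * cnj (z ^ Suc j) + cnj (\<beta> n) * cnj (?\<Phi> (Suc n) z * cnj (z ^ (n - j)))" if z: "norm z = 1" for z
  proof -
    have zc: "z * cnj z = 1" using z by (simp add: complex_norm_square[symmetric])
    let ?x = "fst (szego \<beta> z (1, 1) n)" and ?y = "snd (szego \<beta> z (1, 1) n)"
    have y: "?\<Phi> (Suc n) z = z * ?y - cnj (\<beta> n) * ?x" and y0: "?\<Phi> n z = ?y"
      unfolding Phi_szego(1)[OF z] by simp_all
    have x: "z ^ Suc n * cnj (?\<Phi> (Suc n) z) = ?x - \<beta> n * z * ?y" unfolding Phi_szego(2)[OF z] by simp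
    have zz: "z ^ i * cnj z ^ i = 1" for i unfolding power_mult_distrib[symmetric] zc by simp
    have "z ^ Suc n = z ^ (n - j) * z ^ Suc j" using Suc.prems by (simp add: power_add[symmetric])
    then have zn: "z ^ Suc n * cnj z ^ Suc j = z ^ (n - j)" using zz[of "Suc j"] by (metis mult.assoc mult.right_neutral)
    have "cnj (?\<Phi> (Suc n) z * cnj (z ^ (n - j))) = z ^ Suc n * cnj (?\<Phi> (Suc n) z) * cnj z ^ Suc j"
      unfolding zn[symmetric] by (simp add: mult_ac)
    also have "\<dots> = (?x - \<beta> n * z * ?y) * cnj z ^ Suc j" unfolding x ..
    finally have e1: "cnj (?\<Phi> (Suc n) z * cnj (z ^ (n - j))) = (?x - \<beta> n * z * ?y) * cnj z ^ Suc j" .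
    have "?\<Phi> (Suc n) z * cnj (z ^ Suc j) + cnj (\<beta> n) * cnj (?\<Phi> (Suc n) z * cnj (z ^ (n - j)))
        = ((z * ?y - cnj (\<beta> n) * ?x) + cnj (\<beta> n) * (?x - \<beta> n * z * ?y)) * cnj z ^ Suc j"
      unfolding e1 unfolding y by (simp add: algebra_simps)
    also have "\<dots> = (1 - \<beta> n * cnj (\<beta> n)) * ?y * (z * cnj z) * cnj z ^ j" by (simp add: algebra_simps)
    finally show ?thesis unfolding zc y0 by simp
  qed
  have "(1 - \<beta> n * cnj (\<beta> n)) * Isig \<beta> N (\<lambda>z. ?\<Phi> n z * cnj (z ^ j))
      = Isig \<beta> N (\<lambda>z. ?\<Phi> (Suc n) z * cnj (z ^ Suc j) + cnj (\<beta> n) * cnj (?\<Phi> (Suc n) z * cnj (z ^ (n - j))))"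
    unfolding Isig_cmult[symmetric] by (rule Isig_cong) (rule r)
  also have "\<dots> = Isig \<beta> N (\<lambda>z. ?\<Phi> (Suc n) z * cnj (z ^ Suc j)) + Isig \<beta> N (\<lambda>z. cnj (\<beta> n) * cnj (?\<Phi> (Suc n) z * cnj (z ^ (n - j))))"
    by (rule Isig_add[OF cont]) (intro continuous_intros)
  also have "\<dots> = 0" unfolding Isig_cmult Isig_cnj using IH[of "Suc j"] IH[of "n - j"] Suc.prems by simp
  finally have "(1 - \<beta> n * cnj (\<beta> n)) * Isig \<beta> N (\<lambda>z. ?\<Phi> n z * cnj (z ^ j)) = 0" .
  moreover have "1 - \<beta> n * cnj (\<beta> n) \<noteq> 0"
  proof
    assume "1 - \<beta> n * cnj (\<beta> n) = 0"
    then have "complex_of_real ((norm (\<beta> n))\<^sup>2) = of_real 1" unfolding complex_norm_square by simp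
    then have "(norm (\<beta> n))\<^sup>2 = 1" by (simp only: of_real_eq_iff)
    moreover have "(norm (\<beta> n))\<^sup>2 < 1" using \<beta>[of n] by (simp add: abs_square_less_1)
    ultimately show False by simp
  qed
  ultimately show ?case by simp
qed

lemma Isig_sum:
  assumes "\<And>j. j \<in> A \<Longrightarrow> continuous_on (sphere 0 1) (f j)" "finite A"
  shows "Isig \<beta> N (\<lambda>z. \<Sum>j\<in>A. f j z) = (\<Sum>j\<in>A. Isig \<beta> N (f j))"
  using assms(2,1)
proof (induction A rule: finite_induct)
  case empty
  show ?case by (simp add: Isig_def)
next
  case (insert x F)
  have "Isig \<beta> N (\<lambda>z. f x z + (\<Sum>j\<in>F. f j z)) = Isig \<beta> N (f x) + Isig \<beta> N (\<lambda>z. \<Sum>j\<in>F. f j z)"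
    using insert by (intro Isig_add continuous_intros) auto
  then show ?case using insert by simp
qed

lemma Isig_Phi_combination:
  assumes "m \<le> N"
  shows "Isig \<beta> N (\<lambda>z. poly (\<Sum>j\<le>m. smult (c j) (Phi \<beta> j)) z) = c 0"
proof -
  have z: "Isig \<beta> N (\<lambda>z. poly (Phi \<beta> j) z) = (if j = 0 then 1 else 0)" if "j \<le> m" for j
    using Isig_orth[of j N 0] Isig_1 assms that by (auto simp del: Phi.simps(2))
  have "Isig \<beta> N (\<lambda>z. poly (\<Sum>j\<le>m. smult (c j) (Phi \<beta> j)) z) = Isig \<beta> N (\<lambda>z. \<Sum>j\<le>m. c j * poly (Phi \<beta> j) z)"
    by (simp add: poly_sum)
  also have "\<dots> = (\<Sum>j\<le>m. c j * Isig \<beta> N (\<lambda>z. poly (Phi \<beta> j) z))"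
    by (subst Isig_sum) (auto intro!: continuous_intros simp: Isig_cmult)
  also have "\<dots> = (\<Sum>j\<le>m. c j * (if j = 0 then 1 else 0))" by (intro sum.cong) (auto simp: z)
  also have "\<dots> = c 0" by (simp add: if_distrib cong: if_cong)
  finally show ?thesis .
qed

end

text \<open>Trigonometric polynomials of degree at most \<open>N\<close>, with \<open>cnj z\<close> in the role of \<open>z\<^sup>-\<^sup>1\<close>.\<close>

inductive trig :: "nat \<Rightarrow> (complex \<Rightarrow> complex) \<Rightarrow> bool" where
  monom: "a \<le> N \<Longrightarrow> b \<le> N \<Longrightarrow> trig N (\<lambda>z. z ^ a * cnj z ^ b)"
| scale: "trig N f \<Longrightarrow> trig N (\<lambda>z. c * f z)"
| add: "trig N f \<Longrightarrow> trig N g \<Longrightarrow> trig N (\<lambda>z. f z + g z)"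

lemma trig_mono: "trig N f \<Longrightarrow> N \<le> N' \<Longrightarrow> trig N' f"
  by (induction rule: trig.induct) (auto intro: trig.intros)

lemma trig_continuous: "trig N f \<Longrightarrow> continuous_on A f"
  by (induction rule: trig.induct) (auto intro!: continuous_intros)

lemma trig_0: "trig N (\<lambda>_. 0)"
  using trig.scale[OF trig.monom[of 0 N 0], of 0] by simp

lemma trig_1: "trig N (\<lambda>_. 1)"
  using trig.monom[of 0 N 0] by simp

lemma trig_sum: "finite A \<Longrightarrow> (\<And>i. i \<in> A \<Longrightarrow> trig N (f i)) \<Longrightarrow> trig N (\<lambda>z. \<Sum>i\<in>A. f i z)"
  by (induction A rule: finite_induct) (auto intro: trig_0 trig.add)

lemma trig_mult:
  assumes "trig N f" "trig N' g" shows "trig (N + N') (\<lambda>z. f z * g z)"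
  using assms(1)
proof (induction rule: trig.induct)
  case (monom a N b)
  from assms(2) show ?case
  proof (induction rule: trig.induct)
    case (monom a' N' b')
    then have "trig (N + N') (\<lambda>z. z ^ (a + a') * cnj z ^ (b + b'))"
      using \<open>a \<le> N\<close> \<open>b \<le> N\<close> by (intro trig.monom) auto
    then show ?case by (simp add: power_add mult_ac)
  next
    case (scale N' f c)
    from trig.scale[OF scale.IH, of c] show ?case by (simp add: mult_ac)
  next
    case (add N' f g)
    from trig.add[OF add.IH] show ?case by (simp add: distrib_left)
  qed
next
  case (scale N f c)
  from trig.scale[OF scale.IH, of c] show ?case by (simp add: mult_ac)
next
  case (add N f h)
  from trig.add[OF add.IH] show ?case by (simp add: distrib_right)
qed

lemma trig_power: "trig N f \<Longrightarrow> trig (N * i) (\<lambda>z. f z ^ i)"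
proof (induction i)
  case (Suc i)
  then show ?case using trig_mult[of N f "N * i" "\<lambda>z. f z ^ i"] by simp
qed (simp add: trig_1)

lemma trig_poly_mult_cnj:
  assumes "degree p \<le> N" "degree q \<le> N" shows "trig N (\<lambda>z. poly p z * cnj (poly q z))"
proof -
  have "trig N (\<lambda>z. \<Sum>i\<le>degree p. \<Sum>j\<le>degree q. (coeff p i * cnj (coeff q j)) * (z ^ i * cnj z ^ j))"
    using assms by (intro trig_sum trig.scale trig.monom) auto
  moreover have "poly p z * cnj (poly q z) = (\<Sum>i\<le>degree p. \<Sum>j\<le>degree q. (coeff p i * cnj (coeff q j)) * (z ^ i * cnj z ^ j))" for z
    unfolding poly_altdef cnj_sum sum_product by (intro sum.cong refl) simp
  ultimately show ?thesis by simp
qed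

section \<open>A measure with given Verblunsky coefficients\<close>

context
  fixes M :: "complex measure" and \<beta> :: "nat \<Rightarrow> complex"
  assumes H: "has_verblunsky_coeffs M \<beta>"
begin

lemma verblunsky_lt_1: "norm (\<beta> i) < 1"
  using H by (simp add: has_verblunsky_coeffs_def)

lemma verblunsky_prob_space: "prob_space M"
  using H by (simp add: has_verblunsky_coeffs_def)

lemma verblunsky_sets: "sets M = sets (restrict_space borel (sphere 0 1))"
  using H by (simp add: has_verblunsky_coeffs_def)

lemma verblunsky_space: "space M = sphere 0 1"
  using sets_eq_imp_space_eq[OF verblunsky_sets] by (simp add: space_restrict_space)

lemma verblunsky_singleton: "norm z = 1 \<Longrightarrow> {z} \<in> sets M"
  unfolding verblunsky_sets by (subst sets_restrict_space_iff) auto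

lemma verblunsky_measurable:
  fixes f :: "complex \<Rightarrow> 'b :: topological_space"
  assumes "continuous_on (sphere 0 1) f"
  shows "f \<in> borel_measurable M"
  using borel_measurable_continuous_on_restrict[OF assms] measurable_cong_sets[OF verblunsky_sets refl] by blast

lemma verblunsky_integrable:
  fixes f :: "complex \<Rightarrow> 'b :: {banach, second_countable_topology}"
  assumes f: "continuous_on (sphere 0 1) f"
  shows "integrable M f"
proof -
  interpret prob_space M by (rule verblunsky_prob_space)
  have "bounded (f ` sphere 0 1)" by (intro compact_imp_bounded compact_continuous_image f) auto
  then obtain B where "\<forall>z\<in>f ` sphere 0 1. norm z \<le> B" unfolding bounded_iff ..
  then have B: "norm (f z) \<le> B" if "norm z = 1" for z using that by simp
  show ?thesis
    by (rule integrable_const_bound[of _ B]) (auto intro!: verblunsky_measurable f AE_I2 B simp: verblunsky_space)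
qed

lemma verblunsky_LINT_Phi: "(LINT z|M. poly (Phi \<beta> j) z) = (if j = 0 then 1 else 0)"
proof (cases "j = 0")
  case True
  interpret prob_space M by (rule verblunsky_prob_space)
  show ?thesis using True prob_space by simp
next
  case False
  then have "(LINT z|M. poly (Phi \<beta> j) z * cnj (poly (Phi \<beta> 0) z)) = 0"
    using H by (simp add: has_verblunsky_coeffs_def del: Phi.simps)
  then show ?thesis using False by simp
qed

text \<open>Both functionals are normalised and annihilate \<open>\<Phi>\<^sub>j\<close> for
  \<open>1 \<le> j \<le> N\<close>, so each reads off the coefficient of
  \<open>\<Phi>\<^sub>0\<close>.\<close>

lemma verblunsky_LINT_poly:
  assumes "degree p \<le> N"
  shows "(LINT z|M. poly p z) = Isig \<beta> N (poly p)"
proof -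
  obtain c where p: "p = (\<Sum>j\<le>N. smult (c j) (Phi \<beta> j))" using Phi_span[OF assms] by blast
  have "(LINT z|M. poly p z) = (LINT z|M. (\<Sum>j\<le>N. c j * poly (Phi \<beta> j) z))" by (simp add: p poly_sum)
  also have "\<dots> = (\<Sum>j\<le>N. LINT z|M. c j * poly (Phi \<beta> j) z)"
    by (intro Bochner_Integration.integral_sum verblunsky_integrable continuous_intros)
  also have "\<dots> = (\<Sum>j\<le>N. c j * (if j = 0 then 1 else 0))"
    by (simp add: verblunsky_LINT_Phi del: Phi.simps)
  also have "\<dots> = c 0" by (simp add: if_distrib cong: if_cong)
  also have "\<dots> = Isig \<beta> N (poly p)"
    unfolding p using Isig_Phi_combination[of \<beta> N N c, OF verblunsky_lt_1] by simp
  finally show ?thesis .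
qed

lemma verblunsky_LINT_cong: "(\<And>z. norm z = 1 \<Longrightarrow> f z = g z) \<Longrightarrow> (LINT z|M. f z) = (LINT z|M. g z)"
  by (intro Bochner_Integration.integral_cong) (auto simp: verblunsky_space)

text \<open>On the circle a monomial in \<open>z\<close> and \<open>cnj z\<close> is a power of one
  of the two, which reduces the claim to polynomials and their conjugates. Exact equality in low
  degree takes the place of weak convergence of the approximants.\<close>

lemma Bernstein_Szego:
  assumes "trig K f" "K \<le> N"
  shows "(LINT z|M. f z) = Isig \<beta> N f"
  using assms
proof (induction rule: trig.induct)
  case (monom a K b)
  have zz: "z ^ i * cnj z ^ i = 1" if "norm z = 1" for z :: complex and i
    unfolding power_mult_distrib[symmetric] using that by (simp add: complex_norm_square[symmetric])
  have le: "(LINT z|M. z ^ a * cnj z ^ b) = Isig \<beta> N (\<lambda>z. z ^ a * cnj z ^ b)" if "b \<le> a" "a \<le> N" for a b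
  proof -
    have e: "z ^ a * cnj z ^ b = poly (monom 1 (a - b)) z" if z: "norm z = 1" for z
    proof -
      have "z ^ a = z ^ (a - b) * z ^ b" using \<open>b \<le> a\<close> by (simp add: power_add[symmetric])
      then show ?thesis using zz[OF z, of b] by (simp add: poly_monom mult.assoc)
    qed
    have "(LINT z|M. z ^ a * cnj z ^ b) = (LINT z|M. poly (monom 1 (a - b)) z)" by (rule verblunsky_LINT_cong[OF e])
    also have "\<dots> = Isig \<beta> N (poly (monom 1 (a - b)))"
      using that by (intro verblunsky_LINT_poly) (simp add: degree_monom_eq)
    also have "\<dots> = Isig \<beta> N (\<lambda>z. z ^ a * cnj z ^ b)" by (rule Isig_cong[of \<beta>, OF verblunsky_lt_1]) (simp add: e)
    finally show ?thesis .
  qed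
  show ?case
  proof (cases "b \<le> a")
    case True then show ?thesis using le monom by simp
  next
    case False
    have "(LINT z|M. z ^ a * cnj z ^ b) = (LINT z|M. cnj (z ^ b * cnj z ^ a))" by (simp add: mult.commute)
    also have "\<dots> = cnj (LINT z|M. z ^ b * cnj z ^ a)" by (rule Bochner_Integration.integral_cnj)
    also have "(LINT z|M. z ^ b * cnj z ^ a) = Isig \<beta> N (\<lambda>z. z ^ b * cnj z ^ a)" using le[of a b] False monom by simp
    also have "cnj \<dots> = Isig \<beta> N (\<lambda>z. cnj (z ^ b * cnj z ^ a))" by (rule Isig_cnj[of \<beta>, OF verblunsky_lt_1, symmetric])
    finally show ?thesis by (simp add: mult.commute)
  qed
next
  case (scale K f c)
  then show ?case using Isig_cmult[of \<beta> N c f, OF verblunsky_lt_1] by simp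
next
  case (add K f g)
  have "(LINT z|M. f z + g z) = (LINT z|M. f z) + (LINT z|M. g z)"
    using add trig_continuous by (intro Bochner_Integration.integral_add verblunsky_integrable) auto
  then show ?case using add Isig_add[of \<beta> f g N, OF verblunsky_lt_1] trig_continuous by simp
qed

text \<open>The diagonal entry is computed with the approximant of degree \<open>j\<close>, whose
  density cancels the squared modulus of \<open>\<Phi>\<^sub>j\<close>.\<close>

lemma verblunsky_orthogonal:
  "(LINT z|M. poly (Phi \<beta> i) z * cnj (poly (Phi \<beta> j) z)) = (if i = j then of_real (szD \<beta> j) else 0)"
proof (cases "i = j")
  case False
  then show ?thesis using H by (simp add: has_verblunsky_coeffs_def)
next
  case True
  let ?p = "poly (Phi \<beta> j)"
  have "(LINT z|M. ?p z * cnj (?p z)) = Isig \<beta> j (\<lambda>z. ?p z * cnj (?p z))"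
    by (rule Bernstein_Szego[OF trig_poly_mult_cnj order_refl]) (simp_all add: degree_Phi)
  also have "\<dots> = integral {0..1} (\<lambda>t::real. of_real (szD \<beta> j))"
    unfolding Isig_def
  proof (rule integral_cong)
    fix t :: real
    have n: "?p (ec t) \<noteq> 0" by (rule Phi_circle_nonzero[of \<beta>, OF verblunsky_lt_1]) simp
    have "?p (ec t) * cnj (?p (ec t)) = of_real ((norm (?p (ec t)))\<^sup>2)" by (rule complex_norm_square[symmetric])
    then show "?p (ec t) * cnj (?p (ec t)) * of_real (szD \<beta> j / (norm (?p (ec t)))\<^sup>2) = of_real (szD \<beta> j)"
      using n by (simp flip: of_real_mult)
  qed
  also have "\<dots> = of_real (szD \<beta> j)" by simp
  finally show ?thesis using True by simp
qed

text \<open>Expansion in the orthogonal basis and Cauchy--Schwarz. For polynomials peaking at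
  \<open>z\<close> the integral tends to the mass of \<open>z\<close>, which the reciprocal of the
  sum thus bounds from below.\<close>

lemma Christoffel:
  assumes p: "degree p \<le> n"
  shows "(norm (poly p z))\<^sup>2 \<le> (LINT z|M. (norm (poly p z))\<^sup>2) * (\<Sum>j\<le>n. (norm (poly (Phi \<beta> j) z))\<^sup>2 / szD \<beta> j)"
proof -
  let ?\<phi> = "\<lambda>j. poly (Phi \<beta> j)"
  obtain c where c: "p = (\<Sum>j\<le>n. smult (c j) (Phi \<beta> j))" using Phi_span[OF p] by blast
  have pc: "poly p w = (\<Sum>j\<le>n. c j * ?\<phi> j w)" for w by (simp add: c poly_sum)
  have D: "szD \<beta> j > 0" for j using szD_pos[of \<beta> j, OF verblunsky_lt_1] .
  have "complex_of_real (LINT z|M. (norm (poly p z))\<^sup>2) = (LINT z|M. poly p z * cnj (poly p z))"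
    unfolding integral_complex_of_real[symmetric] complex_norm_square ..
  also have "\<dots> = (LINT z|M. (\<Sum>i\<le>n. \<Sum>j\<le>n. (c i * cnj (c j)) * (?\<phi> i z * cnj (?\<phi> j z))))"
    by (simp add: pc sum_product cnj_sum mult_ac del: Phi.simps)
  also have "\<dots> = (\<Sum>i\<le>n. \<Sum>j\<le>n. LINT z|M. (c i * cnj (c j)) * (?\<phi> i z * cnj (?\<phi> j z)))"
    by (subst Bochner_Integration.integral_sum, intro verblunsky_integrable continuous_intros,
      intro sum.cong refl Bochner_Integration.integral_sum verblunsky_integrable continuous_intros)
  also have "\<dots> = (\<Sum>i\<le>n. \<Sum>j\<le>n. if i = j then c i * cnj (c i) * of_real (szD \<beta> i) else 0)"
    unfolding integral_mult_right_zero verblunsky_orthogonal by (intro sum.cong refl) simp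
  also have "\<dots> = complex_of_real (\<Sum>j\<le>n. (norm (c j))\<^sup>2 * szD \<beta> j)"
    unfolding of_real_sum of_real_mult complex_norm_square by (intro sum.cong refl) simp
  finally have I: "(LINT z|M. (norm (poly p z))\<^sup>2) = (\<Sum>j\<le>n. (norm (c j))\<^sup>2 * szD \<beta> j)"
    by (simp only: of_real_eq_iff)
  have "norm (poly p z) \<le> (\<Sum>j\<le>n. norm (c j * ?\<phi> j z))" unfolding pc by (rule norm_sum)
  also have "\<dots> = (\<Sum>j\<le>n. (norm (c j) * sqrt (szD \<beta> j)) * (norm (?\<phi> j z) / sqrt (szD \<beta> j)))"
    using D by (intro sum.cong) (auto simp: norm_mult less_le)
  finally have "(norm (poly p z))\<^sup>2 \<le> \<dots>\<^sup>2" by (rule power_mono) simp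
  also have "\<dots> \<le> (\<Sum>j\<le>n. (norm (c j) * sqrt (szD \<beta> j))\<^sup>2) * (\<Sum>j\<le>n. (norm (?\<phi> j z) / sqrt (szD \<beta> j))\<^sup>2)"
    by (rule Cauchy_Schwarz_ineq_sum)
  also have "\<dots> = (LINT z|M. (norm (poly p z))\<^sup>2) * (\<Sum>j\<le>n. (norm (?\<phi> j z))\<^sup>2 / szD \<beta> j)"
    unfolding I using D by (simp add: power_mult_distrib power_divide less_imp_le)
  finally show ?thesis .
qed

text \<open>The peak polynomials \<open>((1 + cnj z * w) / 2) ^ n\<close> converge to the indicator of \<open>{z}\<close> on the circle.\<close>

lemma verblunsky_atom:
  assumes z: "norm z = 1" and sm: "summable (\<lambda>j. (norm (poly (Phi \<beta> j) z))\<^sup>2 / szD \<beta> j)"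
  shows "measure M {z} > 0"
proof (rule ccontr)
  interpret prob_space M by (rule verblunsky_prob_space)
  assume "\<not> measure M {z} > 0"
  then have m0: "measure M {z} = 0" using measure_nonneg[of M "{z}"] by linarith
  define p where "p n = [:1/2, cnj z / 2:] ^ n" for n :: nat
  define S where "S = (\<Sum>j. (norm (poly (Phi \<beta> j) z))\<^sup>2 / szD \<beta> j)"
  have D: "szD \<beta> j > 0" for j using szD_pos[of \<beta> j, OF verblunsky_lt_1] .
  have pw: "poly (p n) w = ((1 + cnj z * w) / 2) ^ n" for n w by (simp add: p_def poly_power field_simps)
  have zc: "cnj z * z = 1" using z by (simp add: mult.commute complex_norm_square[symmetric])
  have dp: "degree (p n) \<le> n" for n
    unfolding p_def by (rule order_trans[OF degree_power_le]) (simp add: degree_pCons_le)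
  have nle: "norm ((1 + cnj z * w) / 2) \<le> 1" if "norm w = 1" for w
    using norm_triangle_ineq[of 1 "cnj z * w"] that z by (simp add: norm_mult norm_divide)
  have nlt: "norm ((1 + cnj z * w) / 2) < 1" if w: "norm w = 1" "w \<noteq> z" for w
  proof -
    let ?u = "cnj z * w"
    have u: "norm ?u = 1" using w z by (simp add: norm_mult)
    have "z * ?u = w" using zc by (metis mult.assoc mult.commute mult_1)
    then have u1: "?u \<noteq> 1" using w(2) by (metis mult_1_right)
    have "(norm (1 + ?u))\<^sup>2 + (norm (1 - ?u))\<^sup>2 = 2 * (norm (1::complex))\<^sup>2 + 2 * (norm ?u)\<^sup>2"
      unfolding cmod_power2 by (simp add: algebra_simps power2_eq_square)
    moreover have "(norm (1 - ?u))\<^sup>2 > 0" using u1 by simp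
    ultimately have "(norm (1 + ?u))\<^sup>2 < 4" unfolding u by (simp only: norm_one one_power2)
    then have "(norm (1 + ?u))\<^sup>2 < 2\<^sup>2" by simp
    then have "norm (1 + ?u) < 2" by (rule power2_less_imp_less) simp
    then show ?thesis by (simp add: norm_divide)
  qed
  have "(\<lambda>n. LINT w|M. (norm (poly (p n) w))\<^sup>2) \<longlonglongrightarrow> (LINT w|M. indicator {z} w)"
  proof (rule integral_dominated_convergence[where w = "\<lambda>_. 1"])
    show "(\<lambda>w. (norm (poly (p n) w))\<^sup>2) \<in> borel_measurable M" for n
      by (intro verblunsky_measurable continuous_intros)
    show "(\<lambda>w. indicator {z} w :: real) \<in> borel_measurable M"
      by (intro borel_measurable_indicator verblunsky_singleton z)
    show "AE w in M. (\<lambda>n. (norm (poly (p n) w))\<^sup>2) \<longlonglongrightarrow> indicator {z} w"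
    proof (rule AE_I2)
      fix w assume "w \<in> space M"
      then have w: "norm w = 1" by (simp add: verblunsky_space)
      show "(\<lambda>n. (norm (poly (p n) w))\<^sup>2) \<longlonglongrightarrow> indicator {z} w"
      proof (cases "w = z")
        case True then show ?thesis by (simp add: pw zc)
      next
        case False
        have "(\<lambda>n. (norm ((1 + cnj z * w) / 2) ^ n)\<^sup>2) \<longlonglongrightarrow> 0\<^sup>2"
          using nlt[OF w False] by (intro tendsto_power LIMSEQ_realpow_zero) auto
        then show ?thesis using False by (simp add: pw norm_power)
      qed
    qed
    show "AE w in M. norm ((norm (poly (p n) w))\<^sup>2) \<le> 1" for n
    proof (rule AE_I2)
      fix w assume "w \<in> space M"
      then have w: "norm w = 1" by (simp add: verblunsky_space)
      show "norm ((norm (poly (p n) w))\<^sup>2) \<le> 1"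
        unfolding pw norm_power using nle[OF w] by (simp add: power_le_one)
    qed
  qed simp
  moreover have "(LINT w|M. indicator {z} w) = measure M {z}"
    using verblunsky_singleton[OF z] by simp
  ultimately have lim: "(\<lambda>n. (LINT w|M. (norm (poly (p n) w))\<^sup>2) * S) \<longlonglongrightarrow> 0 * S"
    unfolding m0 by (intro tendsto_mult) auto
  have "1 \<le> (LINT w|M. (norm (poly (p n) w))\<^sup>2) * S" for n
  proof -
    have "1 = (norm (poly (p n) z))\<^sup>2" by (simp add: pw zc)
    also have "\<dots> \<le> (LINT w|M. (norm (poly (p n) w))\<^sup>2) * (\<Sum>j\<le>n. (norm (poly (Phi \<beta> j) z))\<^sup>2 / szD \<beta> j)"
      by (rule Christoffel[OF dp])
    also have "\<dots> \<le> (LINT w|M. (norm (poly (p n) w))\<^sup>2) * S"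
      unfolding S_def using D by (intro mult_left_mono sum_le_suminf sm) (auto intro!: divide_nonneg_pos)
    finally show ?thesis .
  qed
  then have "1 \<le> 0 * S" by (intro LIMSEQ_le_const[OF lim]) auto
  then show False by simp
qed

text \<open>By \<open>verblunsky_atom\<close> almost every point is an atom, and a finite measure
  has only countably many of them.\<close>

lemma verblunsky_pure_point:
  assumes ae: "AE z in M. summable (\<lambda>j. (norm (poly (Phi \<beta> j) z))\<^sup>2 / szD \<beta> j)"
  shows "pure_point M"
proof -
  interpret prob_space M by (rule verblunsky_prob_space)
  define C where "C = {z \<in> space M. measure M {z} \<noteq> 0}"
  have cC: "countable C" unfolding C_def by (rule countable_subset[OF _ countable_support]) auto
  have s: "{z} \<in> sets M" if "z \<in> space M" for z using that by (simp add: verblunsky_space verblunsky_singleton)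
  have CM: "X \<in> sets M" if "X \<subseteq> C" for X
  proof -
    have "(\<Union>z\<in>X. {z}) \<in> sets M"
      using that by (intro sets.countable_UN'' countable_subset[OF that cC] s) (auto simp: C_def)
    then show ?thesis by simp
  qed
  have aeC: "AE z in M. z \<in> C"
    using ae
  proof (rule AE_mp, intro AE_I2 impI)
    fix z assume "z \<in> space M" "summable (\<lambda>j. (norm (poly (Phi \<beta> j) z))\<^sup>2 / szD \<beta> j)"
    then show "z \<in> C" using verblunsky_atom[of z] by (auto simp: C_def verblunsky_space)
  qed
  have "emeasure M A = (\<integral>\<^sup>+z. emeasure M {z} * indicator A z \<partial>count_space C)" if A: "A \<in> sets M" for A
  proof -
    have "emeasure M A = emeasure M (A \<inter> C)"
      using aeC by (intro emeasure_eq_AE A CM) auto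
    also have "\<dots> = (\<integral>\<^sup>+z. emeasure M {z} \<partial>count_space (A \<inter> C))"
      using cC by (intro emeasure_countable_singleton s) (auto simp: C_def countable_Int2)
    also have "\<dots> = (\<integral>\<^sup>+z. emeasure M {z} * indicator (A \<inter> C) z \<partial>count_space UNIV)"
      by (subst nn_integral_count_space_indicator) simp_all
    also have "\<dots> = (\<integral>\<^sup>+z. emeasure M {z} * indicator A z * indicator C z \<partial>count_space UNIV)"
      by (intro nn_integral_cong) (auto simp: indicator_def)
    also have "\<dots> = (\<integral>\<^sup>+z. emeasure M {z} * indicator A z \<partial>count_space C)"
      by (subst (2) nn_integral_count_space_indicator) simp_all
    finally show ?thesis .
  qed
  then show ?thesis unfolding pure_point_def using cC
    by (intro exI[of _ C] exI[of _ "\<lambda>z. emeasure M {z}"]) (auto simp: C_def)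
qed

end

section \<open>Pure point spectrum\<close>

lemma Phi_szY: "poly (Phi (\<lambda>n. \<alpha> n * ec x) n) (ec t) = szY \<alpha> n t x"
proof -
  have "cnj (ec (- x)) = ec x" by (simp add: cis_cnj)
  then show ?thesis
    using Phi_szego(1)[of "ec t" "\<lambda>n. \<alpha> n * ec x" n] szego_rotate(1)[of "ec (- x)" \<alpha> "ec t" n] by (simp add: szY_def)
qed

lemma circle_ec: "norm z = 1 \<Longrightarrow> \<exists>t. z = ec t"
  using rcis_cmod_Arg[of z] by (intro exI[of _ "Arg z / (2 * pi)"]) (simp add: rcis_def)

text \<open>With \<open>t\<close> inside, the inner integral is against the Bernstein--Szego density
  for a fixed \<open>x\<close>; \<open>nn_integral_nuN\<close> has the phase inside, which exhibits
  the uniform law of \<open>t\<close>.\<close>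

lemma nn_integral_nuN_swap:
  assumes f [measurable]: "f \<in> borel_measurable borel"
  shows "(\<integral>\<^sup>+p. f p \<partial>nuN \<alpha> N) = (\<integral>\<^sup>+x. (\<integral>\<^sup>+t. ennreal (szdens \<alpha> N t x) * f (t, x) * indicator {0..1} t \<partial>lborel) * indicator {0..1} x \<partial>lborel)"
proof -
  let ?d = "\<lambda>p. ennreal (szdens \<alpha> N (fst p) (snd p)) * indicator {0..1} (snd p) * indicator {0..1} (fst p)"
  have [measurable]: "?d \<in> borel_measurable borel" by measurable
  have m: "(\<lambda>p. ?d p * f p) \<in> borel_measurable (lborel \<Otimes>\<^sub>M lborel)"
  proof -
    have "(\<lambda>p. ?d p * f p) \<in> borel_measurable (lborel :: (real \<times> real) measure)" by measurable
    then show ?thesis by (simp only: lborel_prod)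
  qed
  have "(\<integral>\<^sup>+p. f p \<partial>nuN \<alpha> N) = (\<integral>\<^sup>+p. ?d p * f p \<partial>lborel)"
    unfolding nuN_def case_prod_beta by (subst nn_integral_density) auto
  also have "\<dots> = (\<integral>\<^sup>+p. ?d p * f p \<partial>(lborel \<Otimes>\<^sub>M lborel))" by (simp only: lborel_prod)
  also have "\<dots> = (\<integral>\<^sup>+x. \<integral>\<^sup>+t. ?d (t, x) * f (t, x) \<partial>lborel \<partial>lborel)"
    by (rule lborel_pair.nn_integral_snd[OF m, symmetric])
  also have "\<dots> = (\<integral>\<^sup>+x. (\<integral>\<^sup>+t. ennreal (szdens \<alpha> N t x) * f (t, x) * indicator {0..1} t \<partial>lborel) * indicator {0..1} x \<partial>lborel)"
    by (intro nn_integral_cong) (auto simp: indicator_def mult_ac)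
  finally show ?thesis .
qed

section \<open>The Aleksandrov family\<close>

context
  fixes \<alpha> :: "nat \<Rightarrow> complex" and \<mu> :: "real \<Rightarrow> complex measure" and c \<rho> :: real
  assumes \<mu>: "\<And>x. has_verblunsky_coeffs (\<mu> x) (\<lambda>n. \<alpha> n * ec x)"
    and c: "\<And>n. norm (\<alpha> n) = c" and \<rho>: "\<rho> > 0" "\<rho>\<^sup>2 = 1 - c\<^sup>2"
begin

lemma Aleksandrov_lt_1: "norm (\<alpha> i) < 1"
  using verblunsky_lt_1[OF \<mu>, of i 0] by (simp add: norm_mult)

lemma Aleksandrov_szD: "szD (\<lambda>n. \<alpha> n * ec x) n = (\<rho> ^ n)\<^sup>2" "szD \<alpha> n = (\<rho> ^ n)\<^sup>2"
  by (simp_all add: szD_def norm_mult c \<rho>(2)[symmetric] power_mult[symmetric] mult.commute)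

definition psum :: "nat \<Rightarrow> nat \<Rightarrow> real \<Rightarrow> complex \<Rightarrow> real" where
  "psum A N x z = (\<Sum>n\<in>{A..N}. (norm (poly (Phi (\<lambda>n. \<alpha> n * ec x) n) z) / \<rho> ^ n)\<^sup>2)"

lemma psum_nonneg: "0 \<le> psum A N x z"
  unfolding psum_def by (intro sum_nonneg) simp

lemma psum_mono: "N \<le> N' \<Longrightarrow> psum A N x z \<le> psum A N' x z"
  unfolding psum_def by (intro sum_mono2) auto

lemma psum_szY: "psum A N x (ec t) = (\<Sum>n\<in>{A..N}. (norm (szY \<alpha> n t x) / \<rho> ^ n)\<^sup>2)"
  unfolding psum_def Phi_szY ..

lemma psum_continuous: "continuous_on B (psum A N x)"
  unfolding psum_def[abs_def] using \<rho> by (intro continuous_intros) auto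

lemma psum_continuous_ec: "continuous_on B (\<lambda>t. psum A N x (ec t))"
  unfolding psum_szY using \<rho> by (intro continuous_intros) auto

lemma szdens_continuous: "continuous_on B (\<lambda>t. szdens \<alpha> K t x)"
  unfolding szdens_def using szY_nonzero[of \<alpha>, OF Aleksandrov_lt_1] by (intro continuous_intros) auto

lemma psum_continuous2: "continuous_on B (\<lambda>p. psum A N (fst p) (ec (snd p)))"
  unfolding psum_szY using \<rho> by (intro continuous_intros) auto

lemma psum_trig: "trig N (\<lambda>z. complex_of_real (psum A N x z))"
proof -
  have "complex_of_real (psum A N x z)
      = (\<Sum>n\<in>{A..N}. complex_of_real (1 / (\<rho> ^ n)\<^sup>2) * (poly (Phi (\<lambda>n. \<alpha> n * ec x) n) z * cnj (poly (Phi (\<lambda>n. \<alpha> n * ec x) n) z)))" for z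
    unfolding psum_def of_real_sum
    by (intro sum.cong refl) (simp only: power_divide of_real_mult[symmetric] complex_norm_square[symmetric], simp)
  moreover have "trig N (\<lambda>z. \<Sum>n\<in>{A..N}. complex_of_real (1 / (\<rho> ^ n)\<^sup>2) * (poly (Phi (\<lambda>n. \<alpha> n * ec x) n) z * cnj (poly (Phi (\<lambda>n. \<alpha> n * ec x) n) z)))"
    by (intro trig_sum trig.scale trig_poly_mult_cnj) (auto simp: degree_Phi)
  ultimately show ?thesis by (simp only:)
qed

text \<open>Uniformity in \<open>x\<close> lets one Weierstrass polynomial on one compact interval
  serve all the measures at once.\<close>

lemma psum_bounded: "\<exists>K. \<forall>x z. norm z = 1 \<longrightarrow> psum A N x z \<le> K"
proof -
  have le: "norm (szY \<alpha> n t x) \<le> 2 ^ n" for n t x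
  proof -
    have "norm (fst (szego \<alpha> (ec t) (ec (- x), 1) n)) \<le> 2 ^ n \<and> norm (snd (szego \<alpha> (ec t) (ec (- x), 1) n)) \<le> 2 ^ n"
    proof (induction n)
      case (Suc n)
      let ?u = "fst (szego \<alpha> (ec t) (ec (- x), 1) n)" and ?v = "snd (szego \<alpha> (ec t) (ec (- x), 1) n)"
      have a: "norm (\<alpha> n * w) \<le> 2 ^ n" "norm (cnj (\<alpha> n) * w) \<le> 2 ^ n" if "norm w \<le> 2 ^ n" for w
        using mult_mono[of "norm (\<alpha> n)" 1 "norm w" "2 ^ n"] Aleksandrov_lt_1[of n] that by (auto simp: norm_mult)
      have "norm (?u - \<alpha> n * (ec t * ?v)) \<le> 2 ^ n + 2 ^ n"
        using Suc by (intro order_trans[OF norm_triangle_ineq4] add_mono a) (auto simp: norm_mult)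
      moreover have "norm (ec t * ?v - cnj (\<alpha> n) * ?u) \<le> 2 ^ n + 2 ^ n"
        using Suc by (intro order_trans[OF norm_triangle_ineq4] add_mono a) (auto simp: norm_mult)
      ultimately show ?case by (simp add: mult.assoc)
    qed simp
    then show ?thesis by (simp add: szY_def)
  qed
  have "psum A N x z \<le> (\<Sum>n\<in>{A..N}. (2 ^ n / \<rho> ^ n)\<^sup>2)" if z: "norm z = 1" for x z
  proof -
    obtain t where t: "z = ec t" using circle_ec[OF z] by blast
    show ?thesis unfolding t psum_szY using \<rho> by (intro sum_mono power_mono divide_right_mono le) auto
  qed
  then show ?thesis by blast
qed

text \<open>
  For polynomial test functions \<open>q\<close> in place of \<open>min 1\<close> the integral against \<open>\<mu> x\<close> equals the one
  against the Bernstein--Szego density of large degree.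
\<close>

lemma psum_approx:
  assumes e: "0 < e"
  shows "\<exists>h K. K \<ge> N \<and> continuous_on UNIV h \<and>
    (\<forall>x. \<bar>(LINT z|\<mu> x. min 1 (psum A N x z)) - h x\<bar> \<le> e \<and>
         \<bar>integral {0..1} (\<lambda>t. min 1 (psum A N x (ec t)) * szdens \<alpha> K t x) - h x\<bar> \<le> e)"
proof -
  obtain B where B: "\<And>x z. norm z = 1 \<Longrightarrow> psum A N x z \<le> B" using psum_bounded by metis
  have "continuous_on {0..B} (\<lambda>s::real. min 1 s)" by (intro continuous_intros)
  from Stone_Weierstrass_real_polynomial_function[OF compact_Icc this e]
  obtain q where q: "real_polynomial_function q" "\<And>s. s \<in> {0..B} \<Longrightarrow> \<bar>min 1 s - q s\<bar> < e" by metis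
  then obtain a n where qs: "q = (\<lambda>s. \<Sum>i\<le>n. a i * s ^ i)" unfolding real_polynomial_function_iff_sum by blast
  \<comment> \<open>\<open>N * n\<close> bounds the degree of the trigonometric polynomial
    \<open>q (psum A N x z)\<close>; adding \<open>N\<close> secures \<open>K \<ge> N\<close>, as
    the tail bound requires.\<close>
  define K where "K = N + N * n"
  have cq: "continuous_on S q" for S unfolding qs by (intro continuous_intros)
  have qe: "\<bar>min 1 (psum A N x z) - q (psum A N x z)\<bar> \<le> e" if "norm z = 1" for x z
    using q(2)[of "psum A N x z"] B[OF that, of x] psum_nonneg[of A N x z] by simp
  \<comment> \<open>The common value of the two integrals of the polynomial test function; its
    continuity in \<open>x\<close> later yields measurability.\<close>
  define h where "h x = integral {0..1} (\<lambda>t. q (psum A N x (ec t)) * szdens \<alpha> K t x)" for x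
  have cd: "continuous_on S (\<lambda>p. szdens \<alpha> K (snd p) (fst p))" for S
    unfolding szdens_def using szY_nonzero[of \<alpha>, OF Aleksandrov_lt_1] by (intro continuous_intros) auto
  have "continuous_on UNIV (\<lambda>x. integral (cbox 0 1) (\<lambda>t. q (psum A N x (ec t)) * szdens \<alpha> K t x))"
    unfolding h_def
  proof (rule integral_continuous_on_param)
    show "continuous_on (UNIV \<times> cbox 0 1) (\<lambda>(x, t). q (psum A N x (ec t)) * szdens \<alpha> K t x)"
      unfolding case_prod_beta by (intro continuous_intros cd continuous_on_compose2[OF cq[of UNIV] psum_continuous2]) auto
  qed
  then have ch: "continuous_on UNIV h" by (simp add: h_def[abs_def])
  have hL: "(LINT z|\<mu> x. q (psum A N x z)) = h x" for x
  proof -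
    have "trig (N * n) (\<lambda>z. \<Sum>i\<le>n. complex_of_real (a i) * complex_of_real (psum A N x z) ^ i)"
      by (intro trig_sum trig.scale) (auto intro: trig_mono[OF trig_power[OF psum_trig]])
    then have "(LINT z|\<mu> x. complex_of_real (q (psum A N x z))) = Isig (\<lambda>n. \<alpha> n * ec x) K (\<lambda>z. complex_of_real (q (psum A N x z)))"
      unfolding qs by (intro Bernstein_Szego[OF \<mu>]) (auto simp: K_def)
    also have "\<dots> = integral {0..1} (\<lambda>t. complex_of_real (q (psum A N x (ec t)) * szdens \<alpha> K t x))"
      unfolding Isig_def Phi_szY szdens_def Aleksandrov_szD by simp
    also have "\<dots> = complex_of_real (h x)" unfolding h_def
    proof (rule integral_unique[OF has_integral_of_real[OF integrable_integral]])
      show "(\<lambda>t. q (psum A N x (ec t)) * szdens \<alpha> K t x) integrable_on {0..1}"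
        by (intro integrable_continuous_interval continuous_intros szdens_continuous continuous_on_compose2[OF cq[of UNIV] psum_continuous_ec]) auto
    qed
    finally show ?thesis by (simp only: integral_complex_of_real of_real_eq_iff)
  qed
  have 1: "\<bar>(LINT z|\<mu> x. min 1 (psum A N x z)) - h x\<bar> \<le> e" for x
  proof -
    interpret prob_space "\<mu> x" by (rule verblunsky_prob_space[OF \<mu>])
    have i: "integrable (\<mu> x) (\<lambda>z. min 1 (psum A N x z))" "integrable (\<mu> x) (\<lambda>z. q (psum A N x z))"
      by (intro verblunsky_integrable[OF \<mu>] continuous_intros psum_continuous continuous_on_compose2[OF cq[of UNIV] psum_continuous] subset_UNIV)+
    have "(LINT z|\<mu> x. min 1 (psum A N x z)) - h x = (LINT z|\<mu> x. min 1 (psum A N x z) - q (psum A N x z))"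
      unfolding hL[symmetric] using i by simp
    also have "\<bar>\<dots>\<bar> \<le> (LINT z|\<mu> x. \<bar>min 1 (psum A N x z) - q (psum A N x z)\<bar>)" by (rule integral_abs_bound)
    also have "\<dots> \<le> (LINT z|\<mu> x. e)"
      using i qe by (intro integral_mono) (auto simp: verblunsky_space[OF \<mu>])
    finally show ?thesis using prob_space by simp
  qed
  have 2: "\<bar>integral {0..1} (\<lambda>t. min 1 (psum A N x (ec t)) * szdens \<alpha> K t x) - h x\<bar> \<le> e" for x
  proof -
    have i: "(\<lambda>t. min 1 (psum A N x (ec t)) * szdens \<alpha> K t x) integrable_on {0..1}"
      "(\<lambda>t. q (psum A N x (ec t)) * szdens \<alpha> K t x) integrable_on {0..1}"
      "(\<lambda>t. szdens \<alpha> K t x) integrable_on {0..1}"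
      by (intro integrable_continuous_interval continuous_intros szdens_continuous psum_continuous_ec continuous_on_compose2[OF cq[of UNIV] psum_continuous_ec] subset_UNIV)+
    have d0: "szdens \<alpha> K t x \<ge> 0" for t
      using szD_pos[of \<alpha> K, OF Aleksandrov_lt_1] by (simp add: szdens_def)
    have "integral {0..1} (\<lambda>t. complex_of_real (szdens \<alpha> K t x)) = 1"
      using Isig_1[of "\<lambda>n. \<alpha> n * ec x" K, OF verblunsky_lt_1[OF \<mu>]]
      unfolding Isig_def Phi_szY szdens_def Aleksandrov_szD by simp
    moreover have "integral {0..1} (\<lambda>t. complex_of_real (szdens \<alpha> K t x)) = of_real (integral {0..1} (\<lambda>t. szdens \<alpha> K t x))"
      by (rule integral_unique[OF has_integral_of_real[OF integrable_integral[OF i(3)]]])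
    ultimately have d1: "integral {0..1} (\<lambda>t. szdens \<alpha> K t x) = 1" by simp
    have "integral {0..1} (\<lambda>t. min 1 (psum A N x (ec t)) * szdens \<alpha> K t x) - h x
        = integral {0..1} (\<lambda>t. min 1 (psum A N x (ec t)) * szdens \<alpha> K t x - q (psum A N x (ec t)) * szdens \<alpha> K t x)"
      unfolding h_def by (rule integral_diff[OF i(1,2), symmetric])
    moreover have "norm (integral {0..1} (\<lambda>t. min 1 (psum A N x (ec t)) * szdens \<alpha> K t x - q (psum A N x (ec t)) * szdens \<alpha> K t x))
        \<le> integral {0..1} (\<lambda>t. e * szdens \<alpha> K t x)"
    proof (rule integral_norm_bound_integral)
      show "norm (min 1 (psum A N x (ec t)) * szdens \<alpha> K t x - q (psum A N x (ec t)) * szdens \<alpha> K t x) \<le> e * szdens \<alpha> K t x" for t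
        using mult_right_mono[OF qe[of "ec t" x] d0[of t]] d0[of t]
        by (simp add: left_diff_distrib[symmetric] abs_mult)
    qed (rule integrable_diff[OF i(1,2)], rule integrable_on_mult_right[OF i(3)])
    ultimately show ?thesis by (simp add: d1)
  qed
  show ?thesis using ch 1 2 by (intro exI[of _ h] exI[of _ K]) (auto simp: K_def)
qed

text \<open>The family \<open>\<mu>\<close> comes without measurability in \<open>x\<close>. It is
  obtained here from uniform approximation by continuous functions.\<close>

lemma psum_LINT_measurable: "(\<lambda>x. LINT z|\<mu> x. min 1 (psum A N x z)) \<in> borel_measurable borel"
proof -
  have "\<exists>h. continuous_on UNIV h \<and> (\<forall>x. \<bar>(LINT z|\<mu> x. min 1 (psum A N x z)) - h x\<bar> \<le> 1 / real (Suc i))" for i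
    using psum_approx[of "1 / real (Suc i)" N A] by auto
  then obtain h where h: "\<And>i. continuous_on UNIV (h i)" "\<And>i x. \<bar>(LINT z|\<mu> x. min 1 (psum A N x z)) - h i x\<bar> \<le> 1 / real (Suc i)"
    by metis
  show ?thesis
  proof (rule borel_measurable_LIMSEQ_real)
    show "(\<lambda>i. h i x) \<longlonglongrightarrow> (LINT z|\<mu> x. min 1 (psum A N x z))" for x
    proof (rule LIM_zero_cancel)
      show "(\<lambda>i. h i x - (LINT z|\<mu> x. min 1 (psum A N x z))) \<longlonglongrightarrow> 0"
        by (rule Lim_null_comparison[OF _ lim_1_over_n[THEN LIMSEQ_Suc]]) (use h(2)[of x] in \<open>auto simp: abs_minus_commute\<close>)
    qed
    show "h i \<in> borel_measurable borel" for i by (rule borel_measurable_continuous_onI[OF h(1)])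
  qed
qed

lemma psum_nn_integral:
  "(\<integral>\<^sup>+z. ennreal (min 1 (psum A N x z)) \<partial>\<mu> x) = ennreal (LINT z|\<mu> x. min 1 (psum A N x z))"
  by (intro nn_integral_eq_integral verblunsky_integrable[OF \<mu>] continuous_intros psum_continuous AE_I2) (simp add: psum_nonneg)

text \<open>\<open>psum_approx\<close> replaces every \<open>\<mu> x\<close> by its approximant of
  one common degree \<open>K\<close> at an arbitrarily small cost, and the tail bound does not
  depend on \<open>K\<close>.\<close>

lemma psum_nuN_bound:
  assumes tail: "\<And>K. N \<le> K \<Longrightarrow>
      (\<integral>\<^sup>+p. ennreal (min 1 (\<Sum>n\<in>{A..N}. (norm (szY \<alpha> n (fst p) (snd p)) / \<rho> ^ n)\<^sup>2)) \<partial>nuN \<alpha> K) \<le> ennreal \<epsilon>"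
  shows "(\<integral>\<^sup>+x. (\<integral>\<^sup>+z. ennreal (min 1 (psum A N x z)) \<partial>\<mu> x) * indicator {0..1} x \<partial>lborel) \<le> ennreal \<epsilon>"
proof (rule ennreal_le_epsilon)
  fix e :: real assume e: "e > 0"
  obtain h K where K: "N \<le> K" and h: "\<And>x. \<bar>(LINT z|\<mu> x. min 1 (psum A N x z)) - h x\<bar> \<le> e / 2"
      "\<And>x. \<bar>integral {0..1} (\<lambda>t. min 1 (psum A N x (ec t)) * szdens \<alpha> K t x) - h x\<bar> \<le> e / 2"
    using psum_approx[of "e / 2" N A] e by auto
  have d0: "szdens \<alpha> K t x \<ge> 0" for t x
    using szD_pos[of \<alpha> K, OF Aleksandrov_lt_1] by (simp add: szdens_def)
  define f where "f p = ennreal (min 1 (\<Sum>n\<in>{A..N}. (norm (szY \<alpha> n (fst p) (snd p)) / \<rho> ^ n)\<^sup>2))" for p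
  have fm [measurable]: "f \<in> borel_measurable borel" unfolding f_def by measurable
  have le: "(\<integral>\<^sup>+z. ennreal (min 1 (psum A N x z)) \<partial>\<mu> x)
      \<le> (\<integral>\<^sup>+t. ennreal (szdens \<alpha> K t x) * f (t, x) * indicator {0..1} t \<partial>lborel) + ennreal e" for x
  proof -
    have I: "(\<lambda>t. min 1 (psum A N x (ec t)) * szdens \<alpha> K t x) integrable_on {0..1}"
      by (intro integrable_continuous_interval continuous_intros psum_continuous_ec szdens_continuous)
    have "(LINT z|\<mu> x. min 1 (psum A N x z)) \<le> integral {0..1} (\<lambda>t. min 1 (psum A N x (ec t)) * szdens \<alpha> K t x) + e"
      using h(1)[of x] h(2)[of x] by (simp only: abs_le_iff) linarith
    then have "ennreal (LINT z|\<mu> x. min 1 (psum A N x z)) \<le> ennreal (integral {0..1} (\<lambda>t. min 1 (psum A N x (ec t)) * szdens \<alpha> K t x) + e)"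
      by (rule ennreal_leI)
    also have "\<dots> = ennreal (integral {0..1} (\<lambda>t. min 1 (psum A N x (ec t)) * szdens \<alpha> K t x)) + ennreal e"
      using e d0 psum_nonneg I by (intro ennreal_plus integral_nonneg) auto
    also have "ennreal (integral {0..1} (\<lambda>t. min 1 (psum A N x (ec t)) * szdens \<alpha> K t x))
        = (\<integral>\<^sup>+t. ennreal (min 1 (psum A N x (ec t)) * szdens \<alpha> K t x) * indicator {0..1} t \<partial>lborel)"
      by (rule nn_integral_has_integral_lebesgue'[symmetric]) (use d0 psum_nonneg I in \<open>auto intro: integrable_integral\<close>)
    also have "\<dots> = (\<integral>\<^sup>+t. ennreal (szdens \<alpha> K t x) * f (t, x) * indicator {0..1} t \<partial>lborel)"
      using d0 psum_nonneg by (intro nn_integral_cong) (simp add: f_def psum_szY[symmetric] ennreal_mult' mult.commute)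
    finally show ?thesis unfolding psum_nn_integral .
  qed
  have mf: "(\<lambda>x. \<integral>\<^sup>+t. ennreal (szdens \<alpha> K t x) * f (t, x) * indicator {0..1} t \<partial>lborel) \<in> borel_measurable lborel"
  proof (rule lborel.borel_measurable_nn_integral)
    have sw: "(\<lambda>p::real \<times> real. (snd p, fst p)) \<in> borel_measurable borel"
      by (intro borel_measurable_continuous_onI continuous_intros)
    have "(\<lambda>p. ennreal (szdens \<alpha> K (fst p) (snd p)) * f p * indicator {0..1} (fst p)) \<in> borel_measurable borel" by measurable
    from measurable_compose[OF sw this]
    have "(\<lambda>p. ennreal (szdens \<alpha> K (snd p) (fst p)) * f (snd p, fst p) * indicator {0..1} (snd p)) \<in> borel_measurable (lborel :: (real \<times> real) measure)" by simp
    then show "(\<lambda>(x, t). ennreal (szdens \<alpha> K t x) * f (t, x) * indicator {0..1} t) \<in> borel_measurable (lborel \<Otimes>\<^sub>M lborel)"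
      unfolding lborel_prod case_prod_beta .
  qed
  have "(\<integral>\<^sup>+x. (\<integral>\<^sup>+z. ennreal (min 1 (psum A N x z)) \<partial>\<mu> x) * indicator {0..1} x \<partial>lborel)
      \<le> (\<integral>\<^sup>+x. (\<integral>\<^sup>+t. ennreal (szdens \<alpha> K t x) * f (t, x) * indicator {0..1} t \<partial>lborel) * indicator {0..1} x + ennreal e * indicator {0..1} x \<partial>lborel)"
    using le by (intro nn_integral_mono) (auto simp: indicator_def)
  also have "\<dots> = (\<integral>\<^sup>+x. (\<integral>\<^sup>+t. ennreal (szdens \<alpha> K t x) * f (t, x) * indicator {0..1} t \<partial>lborel) * indicator {0..1} x \<partial>lborel) + ennreal e"
    using mf by (subst nn_integral_add) (auto simp: nn_integral_cmult_indicator)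
  also have "\<dots> = (\<integral>\<^sup>+p. f p \<partial>nuN \<alpha> K) + ennreal e" by (subst nn_integral_nuN_swap) auto
  also have "\<dots> \<le> ennreal \<epsilon> + ennreal e" unfolding f_def by (intro add_right_mono tail K)
  finally show "(\<integral>\<^sup>+x. (\<integral>\<^sup>+z. ennreal (min 1 (psum A N x z)) \<partial>\<mu> x) * indicator {0..1} x \<partial>lborel) \<le> ennreal \<epsilon> + ennreal e" .
qed

text \<open>Monotone convergence extends the bound to whole tails. Along starting points with bounds
  \<open>1 / (i + 1)\<close> the infimum has integral 0, so for almost every \<open>x\<close> the
  infimum of the truncated tails vanishes \<open>\<mu> x\<close>-almost everywhere.\<close>

lemma Aleksandrov_pure_point:
  assumes tail: "\<And>\<epsilon>. \<epsilon> > 0 \<Longrightarrow> \<exists>A. \<forall>N K. N \<le> K \<longrightarrow>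
      (\<integral>\<^sup>+p. ennreal (min 1 (\<Sum>n\<in>{A..N}. (norm (szY \<alpha> n (fst p) (snd p)) / \<rho> ^ n)\<^sup>2)) \<partial>nuN \<alpha> K) \<le> ennreal \<epsilon>"
  shows "AE x in lborel. x \<in> {0..1} \<longrightarrow> pure_point (\<mu> x)"
proof -
  define g where "g A x z = (SUP N. ennreal (min 1 (psum A N x z)))" for A x z
  define G where "G A x = (\<integral>\<^sup>+z. g A x z \<partial>\<mu> x)" for A x
  have pm: "(\<lambda>z. ennreal (min 1 (psum A N x z))) \<in> borel_measurable (\<mu> x)" for A N x
    by (intro measurable_compose[OF _ measurable_ennreal] verblunsky_measurable[OF \<mu>] continuous_intros psum_continuous)
  have gm [measurable]: "g A x \<in> borel_measurable (\<mu> x)" for A x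
    unfolding g_def[abs_def] using pm by (intro borel_measurable_SUP) auto
  have G: "G A x = (SUP N. \<integral>\<^sup>+z. ennreal (min 1 (psum A N x z)) \<partial>\<mu> x)" for A x
    unfolding G_def g_def
    by (intro nn_integral_monotone_convergence_SUP pm) (auto simp: incseq_def le_fun_def intro!: ennreal_leI min.mono psum_mono)
  have Gm [measurable]: "(\<lambda>x. \<integral>\<^sup>+z. ennreal (min 1 (psum A N x z)) \<partial>\<mu> x) \<in> borel_measurable borel" for A N
    unfolding psum_nn_integral by (intro measurable_compose[OF psum_LINT_measurable measurable_ennreal])
  have GM [measurable]: "G A \<in> borel_measurable borel" for A
    unfolding G[abs_def] by (intro borel_measurable_SUP Gm) auto
  have "\<exists>A. (\<integral>\<^sup>+x. G A x * indicator {0..1} x \<partial>lborel) \<le> ennreal (1 / real (Suc i))" for i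
  proof -
    obtain A where A: "\<forall>N K. N \<le> K \<longrightarrow>
        (\<integral>\<^sup>+p. ennreal (min 1 (\<Sum>n\<in>{A..N}. (norm (szY \<alpha> n (fst p) (snd p)) / \<rho> ^ n)\<^sup>2)) \<partial>nuN \<alpha> K) \<le> ennreal (1 / real (Suc i))"
      using tail[of "1 / real (Suc i)"] by auto
    have "(\<integral>\<^sup>+x. G A x * indicator {0..1} x \<partial>lborel)
        = (\<integral>\<^sup>+x. (SUP N. (\<integral>\<^sup>+z. ennreal (min 1 (psum A N x z)) \<partial>\<mu> x) * indicator {0..1} x) \<partial>lborel)"
      unfolding G by (simp add: SUP_mult_right_ennreal)
    also have "\<dots> = (SUP N. \<integral>\<^sup>+x. (\<integral>\<^sup>+z. ennreal (min 1 (psum A N x z)) \<partial>\<mu> x) * indicator {0..1} x \<partial>lborel)"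
      by (intro nn_integral_monotone_convergence_SUP)
        (auto simp: incseq_def le_fun_def intro!: mult_right_mono nn_integral_mono ennreal_leI min.mono psum_mono)
    also have "\<dots> \<le> ennreal (1 / real (Suc i))"
      using A by (intro SUP_least psum_nuN_bound) blast
    finally show ?thesis by blast
  qed
  then obtain A where A: "\<And>i. (\<integral>\<^sup>+x. G (A i) x * indicator {0..1} x \<partial>lborel) \<le> ennreal (1 / real (Suc i))" by metis
  have "(\<integral>\<^sup>+x. (INF i. G (A i) x) * indicator {0..1} x \<partial>lborel) = 0"
  proof -
    have "(\<integral>\<^sup>+x. (INF i. G (A i) x) * indicator {0..1} x \<partial>lborel) \<le> ennreal (1 / real (Suc i))" for i
      by (rule order_trans[OF _ A[of i]]) (intro nn_integral_mono mult_right_mono INF_lower, auto)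
    moreover have "(\<lambda>i. ennreal (1 / real (Suc i))) \<longlonglongrightarrow> ennreal 0"
      by (intro tendsto_ennrealI lim_1_over_n[THEN LIMSEQ_Suc])
    ultimately have "(\<integral>\<^sup>+x. (INF i. G (A i) x) * indicator {0..1} x \<partial>lborel) \<le> ennreal 0"
      by (intro LIMSEQ_le_const) auto
    then show ?thesis by simp
  qed
  then have "AE x in lborel. (INF i. G (A i) x) * indicator {0..1} x = 0"
    by (subst (asm) nn_integral_0_iff_AE) auto
  then show ?thesis
  proof (rule AE_mp, intro AE_I2 impI)
    fix x :: real assume "(INF i. G (A i) x) * indicator {0..1} x = 0" "x \<in> {0..1}"
    then have G0: "(INF i. G (A i) x) = 0" by simp
    have "(\<integral>\<^sup>+z. (INF i. g (A i) x z) \<partial>\<mu> x) \<le> (INF i. G (A i) x)"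
      unfolding G_def by (intro INF_greatest nn_integral_mono INF_lower) auto
    then have "(\<integral>\<^sup>+z. (INF i. g (A i) x z) \<partial>\<mu> x) = 0" unfolding G0 by simp
    then have "AE z in \<mu> x. (INF i. g (A i) x z) = 0"
      by (subst (asm) nn_integral_0_iff_AE) auto
    then show "pure_point (\<mu> x)"
    proof (intro verblunsky_pure_point[OF \<mu>], elim AE_mp, intro AE_I2 impI)
      fix z assume "(INF i. g (A i) x z) = 0"
      then have "(INF i. g (A i) x z) < 1" by simp
      then obtain i where i: "g (A i) x z < 1" unfolding INF_less_iff by blast
      \<comment> \<open>Below 1 the truncation is inactive, so the true partial sums beyond
        \<open>A i\<close> are bounded.\<close>
      have p1: "psum (A i) N x z \<le> 1" for N
      proof -
        have "ennreal (min 1 (psum (A i) N x z)) \<le> g (A i) x z" unfolding g_def by (intro SUP_upper) auto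
        then have "ennreal (min 1 (psum (A i) N x z)) < 1" using i by (rule le_less_trans)
        then show ?thesis using psum_nonneg[of "A i" N x z] by (simp add: ennreal_less_one_iff min_def split: if_splits)
      qed
      let ?f = "\<lambda>j. (norm (poly (Phi (\<lambda>n. \<alpha> n * ec x) j) z) / \<rho> ^ j)\<^sup>2"
      have "summable ?f"
      proof (rule summableI_nonneg_bounded)
        fix n
        have "(\<Sum>j<n. ?f j) \<le> (\<Sum>j\<in>{..<A i} \<union> {A i..n}. ?f j)" by (intro sum_mono2) auto
        also have "\<dots> = (\<Sum>j<A i. ?f j) + psum (A i) n x z"
          unfolding psum_def by (intro sum.union_disjoint) auto
        also have "\<dots> \<le> (\<Sum>j<A i. ?f j) + 1" using p1 by simp
        finally show "(\<Sum>j<n. ?f j) \<le> (\<Sum>j<A i. ?f j) + 1" .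
      qed simp
      then show "summable (\<lambda>j. (norm (poly (Phi (\<lambda>n. \<alpha> n * ec x) j) z))\<^sup>2 / szD (\<lambda>n. \<alpha> n * ec x) j)"
        by (simp add: Aleksandrov_szD power_divide)
    qed
  qed
qed

end

lemma AE_lborel_shift:
  fixes P :: "real \<Rightarrow> bool"
  assumes "AE x in lborel. P (x + a)"
  shows "AE x in lborel. P x"
proof -
  obtain N where N: "N \<in> null_sets lborel" "{x \<in> space lborel. \<not> P (x + a)} \<subseteq> N"
    using assms unfolding eventually_ae_filter by blast
  have "{x \<in> space lborel. \<not> P x} \<subseteq> {x. x - a \<in> N}" using N(2) by auto
  then show ?thesis using null_sets_translation[OF N(1), of a] unfolding eventually_ae_filter by blast
qed

theorem theorem1p2:
  fixes k :: nat and \<omega> :: real and l :: complex and \<mu> :: "real \<Rightarrow> complex measure"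
  assumes "k \<ge> 2"
    and "\<omega> \<notin> \<rat>"
    and "0 < norm l" and "norm l < 1"
    and "\<And>x. has_verblunsky_coeffs (\<mu> x)
               (\<lambda>n. l * cis (2 * pi * (\<omega> * real n ^ k)) * cis (2 * pi * x))"
  shows "AE x in lebesgue. pure_point (\<mu> x)"
proof -
  define \<rho> where "\<rho> = sqrt (1 - (norm l)\<^sup>2)"
  have "(norm l)\<^sup>2 < 1" using assms(4) by (simp add: abs_square_less_1)
  then have \<rho>: "\<rho> > 0" "\<rho>\<^sup>2 = 1 - (norm l)\<^sup>2" by (simp_all add: \<rho>_def)
  define \<alpha> where "\<alpha> = (\<lambda>n. l * ec (\<omega> * real n ^ k))"
  \<comment> \<open>As \<open>ec\<close> has period 1, each integer translate of the family has the
    same coefficients. The result for \<open>{0..1}\<close> is applied to every translate, and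
    countably many null sets cover the exceptions on the line.\<close>
  have per: "has_verblunsky_coeffs (\<mu> (x + of_int m)) (\<lambda>n. \<alpha> n * ec x)" for x and m :: int
  proof -
    have "2 * pi * (x + of_int m) = 2 * pi * x + 2 * pi * of_int m" by (simp add: algebra_simps)
    then have "ec (x + of_int m) = ec x" by (simp add: cis_mult[symmetric])
    then show ?thesis using assms(5)[of "x + of_int m"] by (simp add: \<alpha>_def)
  qed
  have c: "norm (\<alpha> n) = norm l" for n by (simp add: \<alpha>_def norm_mult)
  have tail: "\<exists>A. \<forall>N K. N \<le> K \<longrightarrow>
      (\<integral>\<^sup>+p. ennreal (min 1 (\<Sum>n\<in>{A..N}. (norm (szY \<alpha> n (fst p) (snd p)) / \<rho> ^ n)\<^sup>2)) \<partial>nuN \<alpha> K) \<le> ennreal \<epsilon>"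
    if "\<epsilon> > 0" for \<epsilon>
    unfolding \<alpha>_def by (rule nuN_tail[OF assms(1,2,4,3) \<rho> that])
  have "AE x in lborel. x \<in> {0..1} \<longrightarrow> pure_point (\<mu> (x + of_int m))" for m
    by (rule Aleksandrov_pure_point[OF per c \<rho> tail])
  then have "AE x in lborel. x + of_int m - of_int m \<in> {0..1} \<longrightarrow> pure_point (\<mu> (x + of_int m))" for m
    by simp
  then have "AE x in lborel. x - of_int m \<in> {0..1} \<longrightarrow> pure_point (\<mu> x)" for m
    by (rule AE_lborel_shift)
  then have "AE x in lborel. \<forall>m::int. x - of_int m \<in> {0..1} \<longrightarrow> pure_point (\<mu> x)"
    unfolding AE_all_countable ..
  then have "AE x in lborel. pure_point (\<mu> x)"
  proof (rule AE_mp, intro AE_I2 impI)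
    fix x :: real assume "\<forall>m::int. x - of_int m \<in> {0..1} \<longrightarrow> pure_point (\<mu> x)"
    then show "pure_point (\<mu> x)" by (rule allE[of _ "\<lfloor>x\<rfloor>"]) (simp, linarith)
  qed
  then show ?thesis by (rule AE_completion)
qed

end
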